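(* Let $\tau$ be the Prouhet-Thue-Morse substitution over $\{a,b\}$, given by $\tau(a)=ab$ and $\tau(b)=ba$. Then the profinite group $G(\tau)$ is not relatively free.
   Context: A pseudovariety of groups is a class of finite groups closed under subgroups, homomorphic images and finite direct products. For a pseudovariety of groups $\mathsf V$ and a finite set $X$, $\overline\Omega_X\mathsf V$ is the pro-$\mathsf V$ group freely generated by $X$. A profinite group is relatively free if it is isomorphic (as a topological group) to $\overline\Omega_X\mathsf V$ for some pseudovariety of groups $\mathsf V$ and some finite set $X$. $\overline\Omega_A\mathsf S$ is the free profinite semigroup on the finite set $A$; the subsemigroup generated by $A$ is identified with the free semigroup $A^+$. A substitution over $A$ is an endomorphism $\varphi$ of $A^+$; it is primitive if there is $n\ge1$ such that every letter $c$ occurs in $\varphi^n(d)$ for all $c,d\in A$, and $\lim_n|\varphi^n(d)|=\infty$. A primitive $\varphi$ (such as $\tau$) defines a minimal subshift $\mathcal X_\varphi\subseteq A^{\mathbb Z}$ whose language $L(\mathcal X_\varphi)$ of finite blocks consists of the words that are factors of $\varphi^k(c)$ for all $c\in A$ and all sufficiently large $k$. The closure of $L(\mathcal X_\varphi)$ in $\overline\Omega_A\mathsf S$ is the disjoint union of $L(\mathcal X_\varphi)$ and a regular $\mathcal J$-class $J(\varphi)$. The Schützenberger group $G(\varphi)$ is the profinite group isomorphic to the maximal subgroups of $J(\varphi)$ (which are all isomorphic). *)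

theory Defs
  imports
    "HOL-Analysis.Function_Topology"
    "HOL-Algebra.Product_Groups"
    "HOL-Library.Sublist"
begin

section \<open>Projective limits of finite quotients of a semigroup of words\<close>

text \<open>
  \<open>W\<close> is a set of words closed under concatenation: the free semigroup \<open>A\<^sup>+\<close> or the
  free monoid \<open>X\<^sup>*\<close>.
\<close>

definition finite_congruences :: "'a list set \<Rightarrow> ('a list \<times> 'a list) set set" where
  "finite_congruences W =
     {\<theta>. equiv W \<theta> \<and> finite (W // \<theta>) \<and>
          (\<forall>(u, u') \<in> \<theta>. \<forall>(v, v') \<in> \<theta>. (u @ v, u' @ v') \<in> \<theta>)}"

definition class_mult ::
    "('a list \<times> 'a list) set \<Rightarrow> 'a list set \<Rightarrow> 'a list set \<Rightarrow> 'a list set" where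
  "class_mult \<theta> C D = \<theta> `` {u @ v | u v. u \<in> C \<and> v \<in> D}"

text \<open>
  The projective limit of the quotients \<open>W/\<theta>\<close>, for \<open>\<theta>\<close> in a set \<open>I\<close> of finite-index
  congruences.  The connecting homomorphism from \<open>W/\<theta>\<close> to \<open>W/\<rho>\<close>, for \<open>\<theta> \<subseteq> \<rho>\<close>, maps a class
  to the unique class containing it.
\<close>

definition lim_carrier ::
    "'a list set \<Rightarrow> ('a list \<times> 'a list) set set
      \<Rightarrow> (('a list \<times> 'a list) set \<Rightarrow> 'a list set) set" where
  "lim_carrier W I =
     {x \<in> (\<Pi>\<^sub>E \<theta>\<in>I. W // \<theta>). \<forall>\<theta>\<in>I. \<forall>\<rho>\<in>I. \<theta> \<subseteq> \<rho> \<longrightarrow> x \<theta> \<subseteq> x \<rho>}"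

definition lim_mult ::
    "('a list \<times> 'a list) set set
      \<Rightarrow> (('a list \<times> 'a list) set \<Rightarrow> 'a list set)
      \<Rightarrow> (('a list \<times> 'a list) set \<Rightarrow> 'a list set)
      \<Rightarrow> (('a list \<times> 'a list) set \<Rightarrow> 'a list set)" where
  "lim_mult I x y = (\<lambda>\<theta>\<in>I. class_mult \<theta> (x \<theta>) (y \<theta>))"

definition lim_topology ::
    "'a list set \<Rightarrow> ('a list \<times> 'a list) set set
      \<Rightarrow> (('a list \<times> 'a list) set \<Rightarrow> 'a list set) topology" where
  "lim_topology W I =
     subtopology (product_topology (\<lambda>\<theta>. discrete_topology (W // \<theta>)) I) (lim_carrier W I)"

definition lim_word ::
    "('a list \<times> 'a list) set set \<Rightarrow> 'a list \<Rightarrow> (('a list \<times> 'a list) set \<Rightarrow> 'a list set)" where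
  "lim_word I w = (\<lambda>\<theta>\<in>I. \<theta> `` {w})"


section \<open>Relatively free profinite groups\<close>

text \<open>
  Every finite group is isomorphic to one whose carrier is a set of natural numbers, so a
  pseudovariety is represented by the set of its members over \<open>nat\<close>.  The closure under
  homomorphic images makes this set closed under isomorphism.
\<close>

definition group_pseudovariety :: "nat monoid set \<Rightarrow> bool" where
  "group_pseudovariety V \<longleftrightarrow>
     (\<forall>G\<in>V. group G \<and> finite (carrier G)) \<and>
     (\<forall>G\<in>V. \<forall>H. subgroup H G \<longrightarrow> G\<lparr>carrier := H\<rparr> \<in> V) \<and>
     (\<forall>G\<in>V. \<forall>H :: nat monoid. \<forall>f \<in> hom G H.
        group H \<and> f ` carrier G = carrier H \<longrightarrow> H \<in> V) \<and>
     (\<forall>(I :: nat set) G. \<forall>H :: nat monoid.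
        finite I \<and> (\<forall>i\<in>I. G i \<in> V) \<and> group H \<and> H \<cong> product_group I G \<longrightarrow> H \<in> V)"

definition quotient_monoid :: "'a list set \<Rightarrow> ('a list \<times> 'a list) set \<Rightarrow> 'a list set monoid" where
  "quotient_monoid W \<theta> = \<lparr>carrier = W // \<theta>, mult = class_mult \<theta>, one = \<theta> `` {[]}\<rparr>"

text \<open>
  The pro-\<open>V\<close> group freely generated by a finite set \<open>X\<close> is the projective limit of the
  \<open>X\<close>-generated members of \<open>V\<close>.  As a finite group generated by \<open>X\<close> is also generated by \<open>X\<close> as a
  monoid, these are the quotients of the free monoid \<open>lists X\<close> that are isomorphic to members
  of \<open>V\<close>.
\<close>

definition group_congruences :: "nat monoid set \<Rightarrow> 'x set \<Rightarrow> ('x list \<times> 'x list) set set" where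
  "group_congruences V X =
     {\<theta> \<in> finite_congruences (lists X). \<exists>H\<in>V. quotient_monoid (lists X) \<theta> \<cong> H}"

definition free_pro_group ::
    "nat monoid set \<Rightarrow> 'x set \<Rightarrow> (('x list \<times> 'x list) set \<Rightarrow> 'x list set) monoid" where
  "free_pro_group V X =
     \<lparr>carrier = lim_carrier (lists X) (group_congruences V X),
      mult = lim_mult (group_congruences V X),
      one = lim_word (group_congruences V X) []\<rparr>"

definition free_pro_group_topology ::
    "nat monoid set \<Rightarrow> 'x set \<Rightarrow> (('x list \<times> 'x list) set \<Rightarrow> 'x list set) topology" where
  "free_pro_group_topology V X = lim_topology (lists X) (group_congruences V X)"

definition topological_group_isomorphic ::
    "'a monoid \<Rightarrow> 'a topology \<Rightarrow> 'b monoid \<Rightarrow> 'b topology \<Rightarrow> bool" where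
  "topological_group_isomorphic G S H T \<longleftrightarrow> (\<exists>h \<in> iso G H. homeomorphic_map S T h)"

definition relatively_free :: "'a monoid \<Rightarrow> 'a topology \<Rightarrow> bool" where
  "relatively_free G T \<longleftrightarrow>
     (\<exists>(V :: nat monoid set) (X :: nat set). group_pseudovariety V \<and> finite X \<and>
        topological_group_isomorphic G T (free_pro_group V X) (free_pro_group_topology V X))"


section \<open>The free profinite semigroup\<close>

text \<open>The alphabet \<open>A\<close> is the universe of a finite type, so that \<open>A\<^sup>+\<close> is the set of nonempty lists.\<close>

definition nonempty_words :: "'a::finite list set" where
  "nonempty_words = {w. w \<noteq> []}"

type_synonym 'a pseudoword = "('a list \<times> 'a list) set \<Rightarrow> 'a list set"

definition pseudowords :: "'a::finite pseudoword set" where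
  "pseudowords = lim_carrier nonempty_words (finite_congruences nonempty_words)"

definition pseudoword_mult :: "'a::finite pseudoword \<Rightarrow> 'a pseudoword \<Rightarrow> 'a pseudoword" where
  "pseudoword_mult = lim_mult (finite_congruences nonempty_words)"

definition pseudoword_topology :: "'a::finite pseudoword topology" where
  "pseudoword_topology = lim_topology nonempty_words (finite_congruences nonempty_words)"

definition word_embedding :: "'a::finite list \<Rightarrow> 'a pseudoword" where
  "word_embedding = lim_word (finite_congruences nonempty_words)"


section \<open>Substitutions and Schuetzenberger groups\<close>

text \<open>A substitution is given by the images of the letters, \<open>subst \<phi>\<close> being its extension to words.\<close>

definition subst :: "('a \<Rightarrow> 'a list) \<Rightarrow> 'a list \<Rightarrow> 'a list" where
  "subst \<phi> w = concat (map \<phi> w)"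

definition primitive_subst :: "('a::finite \<Rightarrow> 'a list) \<Rightarrow> bool" where
  "primitive_subst \<phi> \<longleftrightarrow>
     (\<forall>c. \<phi> c \<noteq> []) \<and>
     (\<exists>n\<ge>1. \<forall>c d. c \<in> set ((subst \<phi> ^^ n) [d])) \<and>
     (\<forall>d. filterlim (\<lambda>n. length ((subst \<phi> ^^ n) [d])) at_top sequentially)"

definition subst_language :: "('a::finite \<Rightarrow> 'a list) \<Rightarrow> 'a list set" where
  "subst_language \<phi> =
     {w \<in> nonempty_words. \<exists>N. \<forall>k\<ge>N. \<forall>c. sublist w ((subst \<phi> ^^ k) [c])}"

text \<open>
  For primitive \<open>\<phi>\<close>, the closure of the language is the disjoint union of the language and the
  regular \<open>\<J>\<close>-class \<open>J(\<phi>)\<close>.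
\<close>

definition subst_J_class :: "('a::finite \<Rightarrow> 'a list) \<Rightarrow> 'a pseudoword set" where
  "subst_J_class \<phi> =
     pseudoword_topology closure_of (word_embedding ` subst_language \<phi>)
       - word_embedding ` subst_language \<phi>"

text \<open>A subgroup of a semigroup may have any idempotent of the semigroup as its identity.\<close>

definition semigroup_subgroup :: "'s set \<Rightarrow> ('s \<Rightarrow> 's \<Rightarrow> 's) \<Rightarrow> 's monoid \<Rightarrow> bool" where
  "semigroup_subgroup S m G \<longleftrightarrow> group G \<and> carrier G \<subseteq> S \<and> mult G = m"

definition maximal_subgroup :: "'s set \<Rightarrow> ('s \<Rightarrow> 's \<Rightarrow> 's) \<Rightarrow> 's monoid \<Rightarrow> bool" where
  "maximal_subgroup S m G \<longleftrightarrow> semigroup_subgroup S m G \<and>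
     (\<forall>H. semigroup_subgroup S m H \<and> carrier G \<subseteq> carrier H \<longrightarrow> carrier H = carrier G)"

text \<open>
  The maximal subgroups of \<open>J(\<phi>)\<close> are all isomorphic as topological groups, so the choice of one
  of them as representative of \<open>G(\<phi>)\<close> is immaterial.
\<close>

definition Schuetzenberger_group :: "('a::finite \<Rightarrow> 'a list) \<Rightarrow> 'a pseudoword monoid" where
  "Schuetzenberger_group \<phi> =
     (SOME G. maximal_subgroup pseudowords pseudoword_mult G \<and> carrier G \<subseteq> subst_J_class \<phi>)"

definition Schuetzenberger_topology :: "('a::finite \<Rightarrow> 'a list) \<Rightarrow> 'a pseudoword topology" where
  "Schuetzenberger_topology \<phi> =
     subtopology pseudoword_topology (carrier (Schuetzenberger_group \<phi>))"


section \<open>The Prouhet-Thue-Morse substitution\<close>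

datatype letter = LA | LB

lemma UNIV_letter: "UNIV = {LA, LB}"
  using letter.exhaust by auto

instance letter :: finite
  by standard (simp add: UNIV_letter)

primrec thue_morse :: "letter \<Rightarrow> letter list" where
  "thue_morse LA = [LA, LB]"
| "thue_morse LB = [LB, LA]"

lemma length_subst_thue_morse: "length (subst thue_morse w) = 2 * length w"
proof (induction w)
  case (Cons c w)
  then show ?case by (cases c) (simp_all add: subst_def)
qed (simp add: subst_def)

lemma length_subst_thue_morse_funpow: "length ((subst thue_morse ^^ n) w) = 2 ^ n * length w"
  by (induction n) (simp_all add: length_subst_thue_morse)

lemma primitive_thue_morse: "primitive_subst thue_morse"
  unfolding primitive_subst_def
proof (intro conjI allI)
  show "thue_morse c \<noteq> []" for c
    by (cases c) simp_all
  have "c \<in> set ((subst thue_morse ^^ 1) [d])" for c d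
    by (cases c; cases d) (simp_all add: subst_def)
  then show "\<exists>n\<ge>1. \<forall>c d. c \<in> set ((subst thue_morse ^^ n) [d])"
    by blast
  show "filterlim (\<lambda>n. length ((subst thue_morse ^^ n) [d])) at_top sequentially" for d
    unfolding length_subst_thue_morse_funpow
    by (rule filterlim_at_top_mono[OF filterlim_ident])
       (auto intro!: always_eventually less_imp_le[OF less_exp])
qed

end

theory Submission
  imports
    Defs
    "HOL-Algebra.Sylow"
    "HOL-Algebra.Multiplicative_Group"
begin

text \<open>
  If \<open>G(\<tau>)\<close> were free pro-\<open>V\<close> on \<open>X\<close>, then \<open>X\<close> would have at least two elements because
  \<open>G(\<tau>)\<close> has the symmetric group of degree three as a continuous quotient, and \<open>V\<close> would contain
  the group of order two because some element of \<open>G(\<tau>)\<close> has even order in that quotient.  Counting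
  occurrences of two generators modulo \<open>2\<close> would then give two different nontrivial continuous
  homomorphisms from \<open>G(\<tau>)\<close> to the group of order two.

  There is only one.  The maximal subgroup is taken at the idempotent power \<open>e0\<close> of \<open>\<tau>\<^sup>\<omega>(a)\<close>.  By
  recognizability, modulo any finite congruence its elements are \<open>e0 \<tau>\<^sup>\<omega>(z) e0\<close> for words \<open>z\<close>.  A
  homomorphism \<open>h\<close> to the group of order two that vanishes on \<open>\<tau>\<^sup>\<omega>(a)\<close> satisfies
  \<open>h (e0 \<tau>\<^sup>\<omega>(z) e0) = B |z|\<^sub>b + C |z|\<^sub>b\<^sub>b\<close> modulo \<open>2\<close>, where \<open>|z|\<^sub>w\<close> counts the occurrences of
  \<open>w\<close>.  This value does not change if \<open>z\<close> is replaced by \<open>\<tau>\<^sup>n(z)\<close> for suitable even \<open>n\<close>; comparing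
  the counts gives \<open>C = 0\<close>, and then \<open>h = 0\<close> as \<open>|\<tau>\<^sup>n(z)|\<^sub>b\<close> is even.
\<close>

section \<open>Unit groups at idempotents, and stability in finite semigroups\<close>

section \<open>Semigroups\<close>

text \<open>No presentation of the group is computed, only its homomorphisms to the group of order
  two. They are accessible because the elements \<open>E w\<close>, with
  \<open>E w = e0 \<odot> omega w \<odot> e0\<close>, obey an overlap rule: E(cdw) is E(cd) times
  the inverse of E(d) times E(dw). A homomorphism is thus determined on them by its values on
  letters and pairs, and vanishing at \<open>\<alpha>\<close> leaves only B and C. Uniqueness
  follows since two nontrivial homomorphisms both take the value 1 at \<open>\<alpha>\<close>, so
  that their sum vanishes there and hence everywhere.

  The exponent n must be even because \<tau>^2(x) begins and ends with x: the pairs at the joints of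
  blocks are then the pairs of z itself.

  One obstacle is that \<open>e0\<close> and inverses come without explicit words. The algebra is
  therefore done in finite quotients, where stability makes \<open>E w\<close> invertible, and
  compactness lifts divisibility back to pseudowords. Another is that
  \<open>Schuetzenberger_group\<close> is an arbitrary maximal subgroup of the J-class, so it has to
  be identified topologically with the one at \<open>e0\<close>.\<close>

definition unit_group :: "'s set \<Rightarrow> ('s \<Rightarrow> 's \<Rightarrow> 's) \<Rightarrow> 's \<Rightarrow> 's monoid" where
  "unit_group S m e =
     \<lparr>carrier = {x \<in> S. m e x = x \<and> m x e = x \<and>
                   (\<exists>y\<in>S. m e y = y \<and> m y e = y \<and> m x y = e \<and> m y x = e)},
      monoid.mult = m, one = e\<rparr>"

locale semigroup_on =
  fixes S :: "'s set" and m :: "'s \<Rightarrow> 's \<Rightarrow> 's" (infixl "\<cdot>" 70)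
  assumes closed [simp, intro]: "x \<in> S \<Longrightarrow> y \<in> S \<Longrightarrow> x \<cdot> y \<in> S"
    and assoc: "x \<in> S \<Longrightarrow> y \<in> S \<Longrightarrow> z \<in> S \<Longrightarrow> x \<cdot> y \<cdot> z = x \<cdot> (y \<cdot> z)"
begin

text \<open>The one-sided inverses may lie anywhere in \<open>S\<close>: multiplying them by
  \<open>e\<close> on both sides moves them into the local monoid at \<open>e\<close>, where a left
  and a right inverse coincide.\<close>

lemma unit_groupI:
  assumes "x \<in> S" "e \<in> S" "a \<in> S" "b \<in> S" "e \<cdot> e = e" "e \<cdot> x = x" "x \<cdot> e = x"
    and a: "x \<cdot> a = e" and b: "b \<cdot> x = e"
  shows "x \<in> carrier (unit_group S m e)"
proof -
  let ?a = "e \<cdot> a \<cdot> e" and ?b = "e \<cdot> b \<cdot> e"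
  have xa: "x \<cdot> ?a = e"
  proof -
    have "x \<cdot> ?a = x \<cdot> e \<cdot> a \<cdot> e" using assms(1-4) by (simp add: assoc)
    then show ?thesis using assms by simp
  qed
  have bx: "?b \<cdot> x = e"
  proof -
    have "?b \<cdot> x = e \<cdot> (b \<cdot> (e \<cdot> x))" using assms(1-4) by (simp add: assoc)
    then show ?thesis using assms by simp
  qed
  have ea: "e \<cdot> ?a = ?a" "?a \<cdot> e = ?a" and be: "?b \<cdot> e = ?b"
    using assms by (metis assoc closed)+
  have "?b = ?b \<cdot> (x \<cdot> ?a)" using xa be by simp
  also have "\<dots> = ?b \<cdot> x \<cdot> ?a" using assms(1-4) by (simp add: assoc)
  also have "\<dots> = ?a" using bx ea by simp
  finally have ba: "?b = ?a" .
  have "?a \<in> S" using assms by auto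
  moreover have "?a \<cdot> x = e" using bx ba by simp
  ultimately have "\<exists>y\<in>S. e \<cdot> y = y \<and> y \<cdot> e = y \<and> x \<cdot> y = e \<and> y \<cdot> x = e"
    using ea xa by blast
  then show ?thesis
    unfolding unit_group_def using assms by simp
qed

lemma group_unit_group:
  assumes e: "e \<in> S" "e \<cdot> e = e"
  shows "group (unit_group S m e)"
proof (rule groupI)
  let ?G = "unit_group S m e"
  show "\<one>\<^bsub>?G\<^esub> \<in> carrier ?G" using e by (auto simp: unit_group_def)
  show "x \<otimes>\<^bsub>?G\<^esub> y \<in> carrier ?G" if x: "x \<in> carrier ?G" and y: "y \<in> carrier ?G" for x y
  proof -
    obtain x' y' where x': "x' \<in> S" "x' \<cdot> e = x'" "x \<cdot> x' = e" "x' \<cdot> x = e"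
      and y': "y' \<in> S" "e \<cdot> y' = y'" "y \<cdot> y' = e" "y' \<cdot> y = e"
      using x y by (auto simp: unit_group_def)
    have xS: "x \<in> S" "e \<cdot> x = x" "x \<cdot> e = x" and yS: "y \<in> S" "e \<cdot> y = y" "y \<cdot> e = y"
      using x y by (auto simp: unit_group_def)
    have "x \<cdot> y \<in> carrier ?G"
    proof (rule unit_groupI)
      show "e \<cdot> (x \<cdot> y) = x \<cdot> y" using xS yS e by (metis assoc)
      show "x \<cdot> y \<cdot> e = x \<cdot> y" using xS yS e by (metis assoc)
      have "x \<cdot> y \<cdot> (y' \<cdot> x') = x \<cdot> (y \<cdot> y' \<cdot> x')"
        using xS yS x'(1) y'(1) by (simp add: assoc)
      also have "\<dots> = x \<cdot> (e \<cdot> x')" using y' by simp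
      also have "\<dots> = x \<cdot> e \<cdot> x'" using xS(1) x'(1) e(1) by (simp add: assoc)
      finally show "x \<cdot> y \<cdot> (y' \<cdot> x') = e" using xS x' by simp
      have "y' \<cdot> x' \<cdot> (x \<cdot> y) = y' \<cdot> (x' \<cdot> x \<cdot> y)"
        using xS(1) yS(1) x'(1) y'(1) by (simp add: assoc)
      then show "y' \<cdot> x' \<cdot> (x \<cdot> y) = e" using y' yS x' by simp
    qed (use xS yS x' y' e in auto)
    then show ?thesis by (simp add: unit_group_def)
  qed
  show "x \<otimes>\<^bsub>?G\<^esub> y \<otimes>\<^bsub>?G\<^esub> z = x \<otimes>\<^bsub>?G\<^esub> (y \<otimes>\<^bsub>?G\<^esub> z)"
    if "x \<in> carrier ?G" "y \<in> carrier ?G" "z \<in> carrier ?G" for x y z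
    using that by (simp add: unit_group_def assoc)
  show "\<one>\<^bsub>?G\<^esub> \<otimes>\<^bsub>?G\<^esub> x = x" if "x \<in> carrier ?G" for x
    using that by (simp add: unit_group_def)
  show "\<exists>y\<in>carrier ?G. y \<otimes>\<^bsub>?G\<^esub> x = \<one>\<^bsub>?G\<^esub>" if "x \<in> carrier ?G" for x
  proof -
    from that obtain y where y: "y \<in> S" "e \<cdot> y = y" "y \<cdot> e = y" "x \<cdot> y = e" "y \<cdot> x = e"
      and "x \<in> S" "e \<cdot> x = x" "x \<cdot> e = x"
      by (auto simp: unit_group_def)
    then have "y \<in> carrier ?G" by (auto simp: unit_group_def)
    then show ?thesis using y by (auto simp: unit_group_def)
  qed
qed

lemma semigroup_subgroup_unit_group:
  "e \<in> S \<Longrightarrow> e \<cdot> e = e \<Longrightarrow> semigroup_subgroup S m (unit_group S m e)"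
  using group_unit_group[of e] by (auto simp: semigroup_subgroup_def unit_group_def)

lemma semigroup_subgroup_le:
  assumes "semigroup_subgroup S m H"
  shows "carrier H \<subseteq> carrier (unit_group S m (one H))"
proof
  fix x assume x: "x \<in> carrier H"
  interpret H: group H using assms by (simp add: semigroup_subgroup_def)
  have S: "carrier H \<subseteq> S" and m: "monoid.mult H = m" using assms by (auto simp: semigroup_subgroup_def)
  have "m (one H) x = x" "m x (one H) = x" "m x (inv\<^bsub>H\<^esub> x) = one H" "m (inv\<^bsub>H\<^esub> x) x = one H"
    "m (one H) (inv\<^bsub>H\<^esub> x) = inv\<^bsub>H\<^esub> x" "m (inv\<^bsub>H\<^esub> x) (one H) = inv\<^bsub>H\<^esub> x"
    using x H.r_inv H.l_inv H.l_one H.r_one H.inv_closed unfolding m[symmetric] by simp_all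
  then show "x \<in> carrier (unit_group S m (one H))"
    using x S H.inv_closed[OF x] unfolding unit_group_def by (simp, blast)
qed

text \<open>A larger subgroup contains the idempotent \<open>e\<close>, which must be its identity,
  so it consists of units at \<open>e\<close>.\<close>

lemma maximal_unit_group:
  assumes e: "e \<in> S" "e \<cdot> e = e"
  shows "maximal_subgroup S m (unit_group S m e)"
  unfolding maximal_subgroup_def
proof (intro conjI allI impI)
  show "semigroup_subgroup S m (unit_group S m e)"
    using e by (rule semigroup_subgroup_unit_group)
  fix H assume H: "semigroup_subgroup S m H \<and> carrier (unit_group S m e) \<subseteq> carrier H"
  interpret H: group H using H by (simp add: semigroup_subgroup_def)
  have m: "monoid.mult H = m" using H by (simp add: semigroup_subgroup_def)
  have "e \<in> carrier (unit_group S m e)" using e by (auto simp: unit_group_def)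
  then have "e \<in> carrier H" using H by auto
  then have "e = one H" using e(2) H.l_cancel_one[of e e] unfolding m by simp
  then show "carrier H = carrier (unit_group S m e)"
    using H semigroup_subgroup_le[of H] by auto
qed

text \<open>Makes the maximal subgroup chosen by \<open>SOME\<close> concrete: it is determined by
  its identity, since every subgroup lies in the unit group of its identity.\<close>

lemma maximal_subgroup_eq_unit_group:
  assumes "maximal_subgroup S m G"
  shows "one G \<in> S" "one G \<cdot> one G = one G" "G = unit_group S m (one G)"
proof -
  have sub: "semigroup_subgroup S m G" using assms by (simp add: maximal_subgroup_def)
  interpret G: group G using sub by (simp add: semigroup_subgroup_def)
  have m: "monoid.mult G = m" and S: "carrier G \<subseteq> S" using sub by (auto simp: semigroup_subgroup_def)
  show e: "one G \<in> S" using S by auto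
  show ee: "one G \<cdot> one G = one G" using G.l_one[OF G.one_closed] unfolding m .
  have "carrier (unit_group S m (one G)) = carrier G"
    using assms semigroup_subgroup_le[OF sub] semigroup_subgroup_unit_group[OF e ee]
    unfolding maximal_subgroup_def by blast
  then show "G = unit_group S m (one G)"
    using m by (simp add: unit_group_def)
qed

text \<open>The inverse of \<open>p \<cdot> x \<cdot> q\<close> is
  \<open>p \<cdot> y \<cdot> q\<close> for the inverse \<open>y\<close> of \<open>x\<close>, because
  the inner \<open>q \<cdot> p = f\<close> is absorbed.\<close>

lemma unit_group_transport:
  assumes S: "p \<in> S" "q \<in> S" "e \<in> S" "f \<in> S" and e: "p \<cdot> q = e" and f: "q \<cdot> p = f"
    and ff: "f \<cdot> f = f" and p: "e \<cdot> p = p" and q: "q \<cdot> e = q"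
    and x: "x \<in> carrier (unit_group S m f)"
  shows "p \<cdot> x \<cdot> q \<in> carrier (unit_group S m e)" "q \<cdot> (p \<cdot> x \<cdot> q) \<cdot> p = x"
proof -
  obtain y where y: "y \<in> S" "f \<cdot> y = y" "y \<cdot> f = y" "x \<cdot> y = f" "y \<cdot> x = f"
    and xS: "x \<in> S" "f \<cdot> x = x" "x \<cdot> f = x"
    using x by (auto simp: unit_group_def)
  have pq: "p \<cdot> x \<cdot> q \<cdot> (p \<cdot> y \<cdot> q) = e" if "x \<in> S" "y \<in> S" "x \<cdot> f = x" "x \<cdot> y = f" for x y
  proof -
    have "p \<cdot> x \<cdot> q \<cdot> (p \<cdot> y \<cdot> q) = p \<cdot> (x \<cdot> (q \<cdot> p) \<cdot> y) \<cdot> q"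
      using that S by (simp add: assoc)
    also have "\<dots> = p \<cdot> (q \<cdot> p) \<cdot> q" using that f by simp
    also have "\<dots> = (p \<cdot> q) \<cdot> (p \<cdot> q)" using S by (simp add: assoc)
    also have "\<dots> = e \<cdot> p \<cdot> q" using e S by (simp add: assoc)
    finally show ?thesis using p e by simp
  qed
  have "e \<cdot> e = e" using e p S assoc[of e p q] by simp
  moreover have "e \<cdot> (p \<cdot> x \<cdot> q) = p \<cdot> x \<cdot> q"
  proof -
    have "e \<cdot> (p \<cdot> x \<cdot> q) = (e \<cdot> p) \<cdot> x \<cdot> q" using S xS by (simp add: assoc)
    then show ?thesis using p by simp
  qed
  moreover have "p \<cdot> x \<cdot> q \<cdot> e = p \<cdot> x \<cdot> q" using S xS by (simp add: assoc q)
  ultimately show "p \<cdot> x \<cdot> q \<in> carrier (unit_group S m e)"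
    using pq[of x y] pq[of y x] S xS y by (intro unit_groupI[where a="p \<cdot> y \<cdot> q" and b="p \<cdot> y \<cdot> q"]) auto
  have "q \<cdot> (p \<cdot> x \<cdot> q) \<cdot> p = (q \<cdot> p) \<cdot> x \<cdot> (q \<cdot> p)" using S xS by (simp add: assoc)
  then show "q \<cdot> (p \<cdot> x \<cdot> q) \<cdot> p = x" using f xS by simp
qed

lemma unit_group_iso:
  assumes S: "p \<in> S" "q \<in> S" "e \<in> S" "f \<in> S" and e: "p \<cdot> q = e" and f: "q \<cdot> p = f"
    and ee: "e \<cdot> e = e" and ff: "f \<cdot> f = f"
    and p: "e \<cdot> p = p" "p \<cdot> f = p" and q: "q \<cdot> e = q" "f \<cdot> q = q"
  shows "(\<lambda>x. p \<cdot> x \<cdot> q) \<in> iso (unit_group S m f) (unit_group S m e)"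
proof (rule isoI)
  let ?F = "unit_group S m f" and ?E = "unit_group S m e"
  have 1: "p \<cdot> x \<cdot> q \<in> carrier ?E" "q \<cdot> (p \<cdot> x \<cdot> q) \<cdot> p = x" if "x \<in> carrier ?F" for x
    using unit_group_transport[OF S e f ff p(1) q(1) that] by auto
  have 2: "q \<cdot> y \<cdot> p \<in> carrier ?F" "p \<cdot> (q \<cdot> y \<cdot> p) \<cdot> q = y" if "y \<in> carrier ?E" for y
    using unit_group_transport[OF S(2,1,4,3) f e ee q(2) p(2) that] by auto
  show "bij_betw (\<lambda>x. p \<cdot> x \<cdot> q) (carrier ?F) (carrier ?E)"
    by (rule bij_betw_byWitness[where f'="\<lambda>y. q \<cdot> y \<cdot> p"]) (use 1 2 in auto)
  show "(\<lambda>x. p \<cdot> x \<cdot> q) \<in> hom ?F ?E"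
  proof (rule homI)
    fix x y assume x: "x \<in> carrier ?F" and y: "y \<in> carrier ?F"
    then have xy: "x \<in> S" "y \<in> S" "x \<cdot> f = x" by (auto simp: unit_group_def)
    have "p \<cdot> x \<cdot> q \<cdot> (p \<cdot> y \<cdot> q) = p \<cdot> (x \<cdot> (q \<cdot> p) \<cdot> y) \<cdot> q"
      using S xy by (simp add: assoc)
    then show "p \<cdot> (x \<otimes>\<^bsub>?F\<^esub> y) \<cdot> q = p \<cdot> x \<cdot> q \<otimes>\<^bsub>?E\<^esub> (p \<cdot> y \<cdot> q)"
      using f xy by (simp add: unit_group_def)
  qed (use 1 in auto)
qed

end

locale finite_semigroup_on = semigroup_on +
  assumes finite: "finite S"
begin

text \<open>Green's relations of a finite semigroup are stable.\<close>

lemma stable_right: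
  assumes S: "s \<in> S" "x \<in> S" "t \<in> S" and s: "s = x \<cdot> (s \<cdot> t)"
  shows "\<exists>r\<in>S. s = s \<cdot> t \<cdot> r"
proof -
  let ?R = "\<lambda>y. y \<cdot> t" and ?L = "\<lambda>y. x \<cdot> y"
  have R: "(?R ^^ j) y \<in> S" if "y \<in> S" for j y
    using that S by (induction j) auto
  have LR: "?L ((?R ^^ j) y) = (?R ^^ j) (?L y)" if "y \<in> S" for j y
    by (induction j) (use that S R in \<open>simp_all add: assoc[symmetric]\<close>)
  \<comment> \<open>Left multiplications by \<open>x\<close> undo right multiplications by
    \<open>t\<close>. A repetition among the elements s t^i, forced by finiteness, therefore cancels
    down to s t^d = s.\<close>
  have absorb: "(?L ^^ j) ((?R ^^ j) s) = s" for j
  proof (induction j)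
    case (Suc j)
    have "?L ((?R ^^ Suc j) s) = (?R ^^ j) (?L (?R s))"
      using LR[of "?R s" j] S by (simp only: funpow_Suc_right comp_apply closed)
    also have "\<dots> = (?R ^^ j) s" using s by simp
    finally have *: "?L ((?R ^^ Suc j) s) = (?R ^^ j) s" .
    have "(?L ^^ Suc j) ((?R ^^ Suc j) s) = (?L ^^ j) (?L ((?R ^^ Suc j) s))"
      by (simp only: funpow_Suc_right comp_apply)
    then show ?case unfolding * using Suc by simp
  qed simp
  have LRj: "(?L ^^ i) ((?R ^^ j) y) = (?R ^^ j) ((?L ^^ i) y)" if "y \<in> S" for i j y
  proof (induction i)
    case (Suc i)
    have "(?L ^^ i) y \<in> S" using that S by (induction i) auto
    then show ?case using Suc LR by simp
  qed simp
  have "\<not> inj (\<lambda>j. (?R ^^ j) s)"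
  proof
    assume "inj (\<lambda>j. (?R ^^ j) s)"
    then have "infinite (range (\<lambda>j. (?R ^^ j) s))" by (simp add: finite_image_iff)
    moreover have "range (\<lambda>j. (?R ^^ j) s) \<subseteq> S" using R S by auto
    ultimately show False using finite finite_subset by blast
  qed
  then obtain i j where "i \<noteq> j" "(?R ^^ i) s = (?R ^^ j) s" by (auto simp: inj_def)
  then obtain i d where d: "d > 0" and eq: "(?R ^^ i) s = (?R ^^ (d + i)) s"
    by (metis add.commute less_imp_add_positive linorder_neqE_nat)
  have "(?L ^^ i) ((?R ^^ (d + i)) s) = (?R ^^ d) ((?L ^^ i) ((?R ^^ i) s))"
    using LRj[of "(?R ^^ i) s" i d] R S by (simp add: funpow_add)
  then have sd: "(?R ^^ d) s = s" using eq absorb by metis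
  \<comment> \<open>The doubled period is at least 2, so after splitting off one \<open>t\<close> a
    positive power of \<open>t\<close> remains to serve as \<open>r\<close>; there may be no
    identity in \<open>S\<close>.\<close>
  then have sdd: "(?R ^^ (d + d)) s = s" by (simp add: funpow_add)
  have pw: "k > 0 \<Longrightarrow> \<exists>r\<in>S. \<forall>y\<in>S. (?R ^^ k) y = y \<cdot> r" for k
  proof (induction k)
    case (Suc k)
    show ?case
    proof (cases "k = 0")
      case False
      then obtain r where "r \<in> S" "\<forall>y\<in>S. (?R ^^ k) y = y \<cdot> r" using Suc by auto
      then show ?thesis using S by (intro bexI[of _ "r \<cdot> t"]) (auto simp: assoc)
    qed (use S in auto)
  qed simp
  from d obtain k where k: "d + d = Suc k" "k > 0" by (cases "d + d") auto
  from pw[OF k(2)] obtain r where r: "r \<in> S" "\<forall>y\<in>S. (?R ^^ k) y = y \<cdot> r" by auto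
  have "s = (?R ^^ k) (?R s)" using sdd unfolding k by (simp only: funpow_Suc_right comp_apply)
  then show ?thesis using r S by auto
qed

lemma stable_left:
  assumes S: "s \<in> S" "x \<in> S" "t \<in> S" and s: "s = t \<cdot> s \<cdot> x"
  shows "\<exists>r\<in>S. s = r \<cdot> (t \<cdot> s)"
proof -
  interpret op: finite_semigroup_on S "\<lambda>x y. y \<cdot> x"
    by unfold_locales (use finite in \<open>auto simp: assoc\<close>)
  show ?thesis using op.stable_right[of s x t] assms by auto
qed

text \<open>Left multiplication by \<open>r\<close> cancels one factor of a power of
  \<open>s\<close>, so the powers of \<open>s\<close> are periodic from the start and form a cyclic
  group.\<close>

lemma group_element:
  assumes s: "s \<in> S" and r: "r \<in> S" and eq: "s = r \<cdot> (s \<cdot> s)"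
  shows "\<exists>e\<in>S. \<exists>t\<in>S. e \<cdot> e = e \<and> e \<cdot> s = s \<and> s \<cdot> e = s \<and> s \<cdot> t = e \<and> t \<cdot> s = e"
proof -
  \<comment> \<open>\<open>pw k\<close> is s^(k+1), as the power s^0 may not exist.\<close>
  define pw where "pw k = ((\<lambda>y. y \<cdot> s) ^^ k) s" for k
  have pw0: "pw 0 = s" and pwS: "pw (Suc k) = pw k \<cdot> s" for k by (simp_all add: pw_def)
  have pw [simp]: "pw k \<in> S" for k by (induction k) (simp_all add: pw0 pwS s)
  have mult: "pw i \<cdot> pw j = pw (Suc (i + j))" for i j
  proof (induction j)
    case (Suc j)
    have "pw i \<cdot> pw (Suc j) = pw i \<cdot> pw j \<cdot> s" unfolding pwS using s by (simp add: assoc)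
    then show ?case unfolding Suc by (simp only: pwS add_Suc_right)
  qed (simp add: pw0 pwS)
  have rpw: "r \<cdot> pw (Suc k) = pw k" for k
  proof (induction k)
    case 0
    then show ?case using eq by (simp add: pw0 pwS)
  next
    case (Suc k)
    have "r \<cdot> pw (Suc (Suc k)) = r \<cdot> pw (Suc k) \<cdot> s" unfolding pwS[of "Suc k"] using r s by (simp add: assoc)
    then show ?case unfolding Suc by (simp only: pwS)
  qed
  have "\<not> inj pw"
  proof
    assume "inj pw"
    then have "infinite (range pw)" by (simp add: finite_image_iff)
    moreover have "range pw \<subseteq> S" by auto
    ultimately show False using finite finite_subset by blast
  qed
  then obtain i j where "i < j" "pw i = pw j" unfolding inj_def by (metis linorder_neqE_nat)
  then obtain d where d: "d > 0" "pw i = pw (i + d)" using less_imp_add_positive by metis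
  have "pw i = pw (i + d) \<Longrightarrow> pw 0 = pw d"
  proof (induction i)
    case (Suc i)
    then have "r \<cdot> pw (Suc i) = r \<cdot> pw (Suc (i + d))" by simp
    then show ?case using Suc.IH unfolding rpw by simp
  qed simp
  then have sd: "pw d = s" using d(2) pw0 by simp
  obtain c where c: "d = Suc c" using d(1) gr0_implies_Suc by blast
  \<comment> \<open>These are s^d and s^(2d-1); the exponent d-1 would be zero for d = 1.\<close>
  let ?e = "pw c" and ?t = "pw (c + c)"
  have es: "?e \<cdot> s = s" "s \<cdot> ?e = s"
    using mult[of c 0] mult[of 0 c] sd c by (simp_all add: pw0)
  have "?e \<cdot> pw j = pw j" for j
  proof (induction j)
    case 0
    then show ?case using es by (simp add: pw0)
  next
    case (Suc j)
    have "?e \<cdot> (pw j \<cdot> s) = ?e \<cdot> pw j \<cdot> s" using s by (simp add: assoc)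
    then show ?case unfolding pwS Suc by simp
  qed
  then have ee: "?e \<cdot> ?e = ?e" .
  have "s \<cdot> ?t = ?e" "?t \<cdot> s = ?e"
    using mult[of 0 "c + c"] mult[of "c + c" 0] mult[of c c] ee by (simp_all add: pw0)
  then show ?thesis using es ee by (intro bexI[of _ ?e] bexI[of _ ?t]) simp_all
qed

end

section \<open>Coordinates, topology and compactness of projective limits of finite
  quotients\<close>

section \<open>Finite congruences and projective limits\<close>

lemma finite_congruencesD:
  assumes "\<theta> \<in> finite_congruences W"
  shows "equiv W \<theta>" "finite (W // \<theta>)"
    "(u, u') \<in> \<theta> \<Longrightarrow> (v, v') \<in> \<theta> \<Longrightarrow> (u @ v, u' @ v') \<in> \<theta>"
  using assms by (fastforce simp: finite_congruences_def)+

lemma class_eq_iff: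
  assumes "\<theta> \<in> finite_congruences W" "u \<in> W" "v \<in> W"
  shows "\<theta> `` {u} = \<theta> `` {v} \<longleftrightarrow> (u, v) \<in> \<theta>"
  using assms eq_equiv_class_iff finite_congruencesD(1) by metis

lemma self_in_class:
  assumes "\<theta> \<in> finite_congruences W" "u \<in> W"
  shows "u \<in> \<theta> `` {u}"
  using assms equiv_class_self finite_congruencesD(1) by metis

lemma class_mult_class:
  assumes \<theta>: "\<theta> \<in> finite_congruences W" and "u \<in> W" "v \<in> W"
  shows "class_mult \<theta> (\<theta> `` {u}) (\<theta> `` {v}) = \<theta> `` {u @ v}"
proof -
  have refl: "(u, u) \<in> \<theta>" "(v, v) \<in> \<theta>" and tr: "trans \<theta>"
    using assms finite_congruencesD(1)[OF \<theta>] by (auto simp: equiv_def refl_on_def)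
  show ?thesis
    unfolding class_mult_def
  proof (intro equalityI subsetI)
    fix x assume "x \<in> \<theta> `` {u' @ v' |u' v'. u' \<in> \<theta> `` {u} \<and> v' \<in> \<theta> `` {v}}"
    then obtain u' v' where "(u, u') \<in> \<theta>" "(v, v') \<in> \<theta>" "(u' @ v', x) \<in> \<theta>" by auto
    then show "x \<in> \<theta> `` {u @ v}"
      using transD[OF tr finite_congruencesD(3)[OF \<theta>]] by blast
  next
    fix x assume "x \<in> \<theta> `` {u @ v}"
    then show "x \<in> \<theta> `` {u' @ v' |u' v'. u' \<in> \<theta> `` {u} \<and> v' \<in> \<theta> `` {v}}"
      using refl by auto
  qed
qed

text \<open>The source of the concrete congruences below: each is the kernel of a map with finitely
  many values that is compatible with concatenation.\<close>

lemma kernel_finite_congruence: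
  assumes "finite (F ` W)"
    and "\<And>u u' v v'. \<lbrakk>u \<in> W; u' \<in> W; v \<in> W; v' \<in> W; F u = F u'; F v = F v'\<rbrakk> \<Longrightarrow> F (u @ v) = F (u' @ v')"
    and app: "\<And>u v. u \<in> W \<Longrightarrow> v \<in> W \<Longrightarrow> u @ v \<in> W"
  shows "{(u, v). u \<in> W \<and> v \<in> W \<and> F u = F v} \<in> finite_congruences W" (is "?\<theta> \<in> _")
proof -
  have "?\<theta> `` {w} = {u \<in> W. F u = F w}" if "w \<in> W" for w using that by auto
  then have "W // ?\<theta> \<subseteq> (\<lambda>c. {u \<in> W. F u = c}) ` F ` W"
    unfolding quotient_def by auto
  then have "finite (W // ?\<theta>)" using assms(1) finite_subset by blast
  moreover have "equiv W ?\<theta>" by (auto simp: equiv_def refl_on_def sym_def trans_def)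
  moreover have "\<forall>p\<in>?\<theta>. \<forall>q\<in>?\<theta>. (fst p @ fst q, snd p @ snd q) \<in> ?\<theta>"
  proof (intro ballI)
    fix p q assume "p \<in> ?\<theta>" "q \<in> ?\<theta>"
    then show "(fst p @ fst q, snd p @ snd q) \<in> ?\<theta>"
      using app assms(2)[of "fst p" "snd p" "fst q" "snd q"] by (simp add: case_prod_unfold)
  qed
  ultimately show ?thesis by (simp add: finite_congruences_def case_prod_unfold) blast
qed

locale word_semigroup =
  fixes W :: "'a list set"
  assumes append_closed: "u \<in> W \<Longrightarrow> v \<in> W \<Longrightarrow> u @ v \<in> W"
begin

lemma finite_semigroup_class_mult:
  assumes \<theta>: "\<theta> \<in> finite_congruences W"
  shows "finite_semigroup_on (W // \<theta>) (class_mult \<theta>)"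
proof
  show "class_mult \<theta> x y \<in> W // \<theta>" if x: "x \<in> W // \<theta>" and y: "y \<in> W // \<theta>" for x y
  proof -
    obtain u where "u \<in> W" "x = \<theta> `` {u}" using x by (rule quotientE)
    moreover obtain v where "v \<in> W" "y = \<theta> `` {v}" using y by (rule quotientE)
    ultimately show ?thesis using class_mult_class[OF \<theta>] append_closed by (simp add: quotientI)
  qed
  show "class_mult \<theta> (class_mult \<theta> x y) z = class_mult \<theta> x (class_mult \<theta> y z)"
    if x: "x \<in> W // \<theta>" and y: "y \<in> W // \<theta>" and z: "z \<in> W // \<theta>" for x y z
  proof -
    obtain u where "u \<in> W" "x = \<theta> `` {u}" using x by (rule quotientE)
    moreover obtain v where "v \<in> W" "y = \<theta> `` {v}" using y by (rule quotientE)
    moreover obtain w where "w \<in> W" "z = \<theta> `` {w}" using z by (rule quotientE)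
    ultimately show ?thesis using class_mult_class[OF \<theta>] append_closed by simp
  qed
  show "finite (W // \<theta>)" using \<theta> by (rule finite_congruencesD(2))
qed

lemma Int_finite_congruences:
  assumes "\<theta> \<in> finite_congruences W" "\<rho> \<in> finite_congruences W"
  shows "\<theta> \<inter> \<rho> \<in> finite_congruences W"
proof -
  let ?F = "\<lambda>w. (\<theta> `` {w}, \<rho> `` {w})"
  have "\<theta> \<subseteq> W \<times> W"
    using finite_congruencesD(1)[OF assms(1)] by (simp add: equiv_def)
  moreover have "?F u = ?F v \<longleftrightarrow> (u, v) \<in> \<theta> \<inter> \<rho>" if "u \<in> W" "v \<in> W" for u v
    using class_eq_iff[OF assms(1) that] class_eq_iff[OF assms(2) that] by simp
  ultimately have "\<theta> \<inter> \<rho> = {(u, v). u \<in> W \<and> v \<in> W \<and> ?F u = ?F v}"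
    by blast
  moreover have "{(u, v). u \<in> W \<and> v \<in> W \<and> ?F u = ?F v} \<in> finite_congruences W"
  proof (rule kernel_finite_congruence)
    have "?F ` W \<subseteq> (W // \<theta>) \<times> (W // \<rho>)" by (simp add: image_subset_iff quotientI)
    moreover have "finite ((W // \<theta>) \<times> (W // \<rho>))"
      using assms[THEN finite_congruencesD(2)] by (rule finite_cartesian_product)
    ultimately show "finite (?F ` W)" by (rule finite_subset)
    show "?F (u @ v) = ?F (u' @ v')"
      if "u \<in> W" "u' \<in> W" "v \<in> W" "v' \<in> W" "?F u = ?F u'" "?F v = ?F v'" for u u' v v'
      using that class_mult_class[OF assms(1), of u v] class_mult_class[OF assms(1), of u' v']
        class_mult_class[OF assms(2), of u v] class_mult_class[OF assms(2), of u' v']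
      by simp
  qed (rule append_closed)
  ultimately show ?thesis by simp
qed

text \<open>Conditions on finitely many coordinates thus become a condition on one. The factor
  \<open>W \<times> W\<close> keeps the empty intersection a relation on \<open>W\<close>.\<close>

lemma Inter_finite_congruences:
  assumes "finite K" "K \<subseteq> finite_congruences W"
  shows "W \<times> W \<inter> \<Inter>K \<in> finite_congruences W"
  using assms
proof (induction K rule: finite_induct)
  case empty
  have "W \<times> W = {(u, v). u \<in> W \<and> v \<in> W \<and> () = ()}" by auto
  then show ?case using kernel_finite_congruence[of "\<lambda>_. ()" W] append_closed by simp
next
  case (insert \<theta> K)
  have "W \<times> W \<inter> \<Inter>(insert \<theta> K) = \<theta> \<inter> (W \<times> W \<inter> \<Inter>K)" by auto
  moreover have "\<theta> \<inter> (W \<times> W \<inter> \<Inter>K) \<in> finite_congruences W"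
    by (rule Int_finite_congruences) (use insert in auto)
  ultimately show ?case by simp
qed

end

context
  fixes W :: "'a list set" and I
  assumes I: "I \<subseteq> finite_congruences W"
begin

lemma lim_carrierD:
  assumes "x \<in> lim_carrier W I" "\<theta> \<in> I"
  shows "x \<theta> \<in> W // \<theta>" "\<rho> \<in> I \<Longrightarrow> \<theta> \<subseteq> \<rho> \<Longrightarrow> x \<theta> \<subseteq> x \<rho>"
  using assms by (auto simp: lim_carrier_def)

lemma lim_class:
  assumes "x \<in> lim_carrier W I" "\<theta> \<in> I" "w \<in> x \<theta>"
  shows "w \<in> W" "x \<theta> = \<theta> `` {w}"
proof -
  have \<theta>: "equiv W \<theta>" using assms I finite_congruencesD(1) by blast
  obtain u where u: "u \<in> W" "x \<theta> = \<theta> `` {u}"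
    using lim_carrierD(1)[OF assms(1,2)] by (auto elim: quotientE)
  then have "(u, w) \<in> \<theta>" using assms by auto
  then show "x \<theta> = \<theta> `` {w}" using u equiv_class_eq[OF \<theta>] by metis
  show "w \<in> W" using \<theta> \<open>(u, w) \<in> \<theta>\<close> by (auto simp: equiv_def)
qed

lemma lim_class_mono:
  assumes "x \<in> lim_carrier W I" "\<theta> \<in> I" "\<rho> \<in> I" "\<theta> \<subseteq> \<rho>" "w \<in> x \<theta>"
  shows "x \<rho> = \<rho> `` {w}"
  using assms lim_carrierD(2) lim_class(2) by blast

lemma lim_obtain:
  assumes "x \<in> lim_carrier W I" "\<theta> \<in> I"
  obtains w where "w \<in> W" "w \<in> x \<theta>" "x \<theta> = \<theta> `` {w}"
proof -
  obtain u where u: "u \<in> W" "x \<theta> = \<theta> `` {u}"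
    using lim_carrierD(1)[OF assms] by (auto elim: quotientE)
  then have "u \<in> x \<theta>" using assms(2) I self_in_class by blast
  with u show thesis by (rule_tac that)
qed

lemma lim_eq_mono:
  assumes "x \<in> lim_carrier W I" "y \<in> lim_carrier W I" "\<theta> \<in> I" "\<rho> \<in> I" "\<theta> \<subseteq> \<rho>" "x \<theta> = y \<theta>"
  shows "x \<rho> = y \<rho>"
  by (metis assms lim_class_mono lim_obtain)

lemma lim_eqI:
  assumes "x \<in> lim_carrier W I" "y \<in> lim_carrier W I" "\<And>\<theta>. \<theta> \<in> I \<Longrightarrow> x \<theta> = y \<theta>"
  shows "x = y"
  using assms by (auto simp: lim_carrier_def intro: PiE_ext)

lemma lim_word_closed: "w \<in> W \<Longrightarrow> lim_word I w \<in> lim_carrier W I"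
  by (auto simp: lim_word_def lim_carrier_def quotientI)

lemma topspace_lim_topology: "topspace (lim_topology W I) = lim_carrier W I"
  by (auto simp: lim_topology_def lim_carrier_def)

lemma openin_lim_coordinate:
  assumes "\<theta> \<in> I"
  shows "openin (lim_topology W I) {x \<in> lim_carrier W I. P (x \<theta>)}"
proof -
  let ?X = "product_topology (\<lambda>\<theta>. discrete_topology (W // \<theta>)) I"
  have "openin ?X {x \<in> topspace ?X. x \<theta> \<in> {C \<in> W // \<theta>. P C}}"
    by (rule openin_continuous_map_preimage[OF continuous_map_product_projection[OF assms]]) auto
  then have "openin (lim_topology W I) ({x \<in> topspace ?X. x \<theta> \<in> {C \<in> W // \<theta>. P C}} \<inter> lim_carrier W I)"
    unfolding lim_topology_def openin_subtopology by blast
  moreover have "{x \<in> topspace ?X. x \<theta> \<in> {C \<in> W // \<theta>. P C}} \<inter> lim_carrier W I = {x \<in> lim_carrier W I. P (x \<theta>)}"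
    using assms by (auto simp: lim_carrier_def)
  ultimately show ?thesis by metis
qed

text \<open>Finitely many coordinates appear because \<open>I\<close> is an arbitrary set of finite
  congruences, such as \<open>group_congruences V X\<close>; closure under intersection, which
  reduces them to one, is available for the set of all finite congruences.\<close>

lemma lim_nhd:
  assumes "openin (lim_topology W I) U" "x \<in> U"
  obtains K where "finite K" "K \<subseteq> I"
    "\<And>y. y \<in> lim_carrier W I \<Longrightarrow> (\<And>\<theta>. \<theta> \<in> K \<Longrightarrow> y \<theta> = x \<theta>) \<Longrightarrow> y \<in> U"
proof -
  obtain T where T: "openin (product_topology (\<lambda>\<theta>. discrete_topology (W // \<theta>)) I) T"
    and U: "U = T \<inter> lim_carrier W I"
    using assms(1) by (auto simp: lim_topology_def openin_subtopology)
  have "x \<in> T" using assms(2) U by simp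
  then obtain Z where Z: "finite {i \<in> I. Z i \<noteq> topspace (discrete_topology (W // i))}"
      "x \<in> Pi\<^sub>E I Z" "Pi\<^sub>E I Z \<subseteq> T"
    using bspec[OF T[unfolded openin_product_topology_alt] \<open>x \<in> T\<close>] by meson
  show thesis
  proof (rule that[OF Z(1)])
    fix y assume y: "y \<in> lim_carrier W I"
      and eq: "\<And>\<theta>. \<theta> \<in> {i \<in> I. Z i \<noteq> topspace (discrete_topology (W // i))} \<Longrightarrow> y \<theta> = x \<theta>"
    have "y \<in> Pi\<^sub>E I Z"
    proof (rule PiE_I)
      show "y i \<in> Z i" if "i \<in> I" for i
      proof (cases "Z i = topspace (discrete_topology (W // i))")
        case True then show ?thesis using lim_carrierD(1)[OF y that] by simp
      next
        case False then show ?thesis using eq[of i] that Z(2) by (auto simp: PiE_iff)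
      qed
      show "y i = undefined" if "i \<notin> I" for i using y that by (auto simp: lim_carrier_def)
    qed
    then have "y \<in> T" using Z(3) by (rule rev_subsetD)
    then show "y \<in> U" unfolding U using y by (rule IntI)
  qed (rule Collect_restrict)
qed

lemma continuous_map_lim:
  assumes f: "f \<in> lim_carrier W I \<rightarrow> lim_carrier W I"
    and eq: "\<And>\<theta> x y. \<lbrakk>\<theta> \<in> I; x \<in> lim_carrier W I; y \<in> lim_carrier W I; x \<theta> = y \<theta>\<rbrakk> \<Longrightarrow> f x \<theta> = f y \<theta>"
  shows "continuous_map (lim_topology W I) (lim_topology W I) f"
proof -
  let ?X = "product_topology (\<lambda>\<theta>. discrete_topology (W // \<theta>)) I"
  have "continuous_map (lim_topology W I) (discrete_topology (W // \<theta>)) (\<lambda>x. f x \<theta>)" if \<theta>: "\<theta> \<in> I" for \<theta>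
  proof (unfold continuous_map, intro conjI allI impI)
    show "(\<lambda>x. f x \<theta>) ` topspace (lim_topology W I) \<subseteq> topspace (discrete_topology (W // \<theta>))"
      using funcset_mem[OF f, THEN lim_carrierD(1), OF _ \<theta>]
      by (simp add: topspace_lim_topology image_subset_iff)
    fix U
    let ?P = "\<lambda>C. \<exists>y\<in>lim_carrier W I. y \<theta> = C \<and> f y \<theta> \<in> U"
    have "{x \<in> topspace (lim_topology W I). f x \<theta> \<in> U} = {x \<in> lim_carrier W I. ?P (x \<theta>)}"
      unfolding topspace_lim_topology by (intro Collect_cong conj_cong refl) (metis eq[OF \<theta>])
    then show "openin (lim_topology W I) {x \<in> topspace (lim_topology W I). f x \<theta> \<in> U}"
      using openin_lim_coordinate[OF \<theta>, of ?P] by (simp only:)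
  qed
  then have "continuous_map (lim_topology W I) ?X f"
    using f unfolding continuous_map_componentwise topspace_lim_topology
    by (auto simp: lim_carrier_def PiE_def)
  then have "continuous_map (lim_topology W I) (subtopology ?X (lim_carrier W I)) f"
    using f by (rule_tac continuous_map_into_subtopology) (simp_all add: topspace_lim_topology)
  then show ?thesis by (simp only: lim_topology_def[of W I, symmetric])
qed

end

lemma lim_mult_apply: "\<theta> \<in> I \<Longrightarrow> lim_mult I x y \<theta> = class_mult \<theta> (x \<theta>) (y \<theta>)"
  by (simp add: lim_mult_def)

lemma lim_mult_class:
  assumes I: "I \<subseteq> finite_congruences W" and \<theta>: "\<theta> \<in> I"
    and x: "x \<in> lim_carrier W I" and y: "y \<in> lim_carrier W I"
    and u: "u \<in> x \<theta>" and v: "v \<in> y \<theta>"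
  shows "lim_mult I x y \<theta> = \<theta> `` {u @ v}"
  unfolding lim_mult_apply[OF \<theta>] lim_class(2)[OF I x \<theta> u] lim_class(2)[OF I y \<theta> v]
  by (rule class_mult_class[OF subsetD[OF I \<theta>] lim_class(1)[OF I x \<theta> u] lim_class(1)[OF I y \<theta> v]])

context word_semigroup
begin

lemma semigroup_on_lim:
  assumes I: "I \<subseteq> finite_congruences W"
  shows "semigroup_on (lim_carrier W I) (lim_mult I)"
proof
  show closed: "lim_mult I x y \<in> lim_carrier W I" if x: "x \<in> lim_carrier W I" and y: "y \<in> lim_carrier W I" for x y
  proof -
    have "lim_mult I x y \<theta> \<in> W // \<theta>" if \<theta>: "\<theta> \<in> I" for \<theta>
    proof -
      interpret q: finite_semigroup_on "W // \<theta>" "class_mult \<theta>"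
        using finite_semigroup_class_mult \<theta> I by blast
      show ?thesis
        using x[THEN lim_carrierD(1)[OF I _ \<theta>]] y[THEN lim_carrierD(1)[OF I _ \<theta>]]
        by (simp add: lim_mult_apply[OF \<theta>])
    qed
    moreover have "lim_mult I x y \<theta> \<subseteq> lim_mult I x y \<rho>" if \<theta>: "\<theta> \<in> I" and \<rho>: "\<rho> \<in> I" and le: "\<theta> \<subseteq> \<rho>" for \<theta> \<rho>
    proof -
      obtain u v where u: "u \<in> x \<theta>" and v: "v \<in> y \<theta>"
        using lim_obtain[OF I x \<theta>] lim_obtain[OF I y \<theta>] by metis
      then have "u \<in> x \<rho>" "v \<in> y \<rho>" using lim_carrierD(2)[OF I _ \<theta> \<rho> le] x y by auto
      then show ?thesis using lim_mult_class[OF I \<theta> x y u v] lim_mult_class[OF I \<rho> x y] le by auto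
    qed
    moreover have "lim_mult I x y \<theta> = undefined" if "\<theta> \<notin> I" for \<theta>
      using that by (simp add: lim_mult_def)
    ultimately show ?thesis
      unfolding lim_carrier_def by (intro CollectI conjI PiE_I ballI impI) blast+
  qed
  show "lim_mult I (lim_mult I x y) z = lim_mult I x (lim_mult I y z)"
    if x: "x \<in> lim_carrier W I" and y: "y \<in> lim_carrier W I" and z: "z \<in> lim_carrier W I" for x y z
  proof (rule lim_eqI[OF I])
    fix \<theta> assume \<theta>: "\<theta> \<in> I"
    interpret q: finite_semigroup_on "W // \<theta>" "class_mult \<theta>"
      using finite_semigroup_class_mult \<theta> I by blast
    show "lim_mult I (lim_mult I x y) z \<theta> = lim_mult I x (lim_mult I y z) \<theta>"
      unfolding lim_mult_apply[OF \<theta>] by (rule q.assoc[OF lim_carrierD(1)[OF I x \<theta>] lim_carrierD(1)[OF I y \<theta>] lim_carrierD(1)[OF I z \<theta>]])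
  next
    show "lim_mult I (lim_mult I x y) z \<in> lim_carrier W I" by (rule closed[OF closed[OF x y] z])
    show "lim_mult I x (lim_mult I y z) \<in> lim_carrier W I" by (rule closed[OF x closed[OF y z]])
  qed
qed

lemma lim_nhd_single:
  assumes "openin (lim_topology W (finite_congruences W)) U" "x \<in> U"
  obtains \<theta> where "\<theta> \<in> finite_congruences W"
    "\<And>y. y \<in> lim_carrier W (finite_congruences W) \<Longrightarrow> y \<theta> = x \<theta> \<Longrightarrow> y \<in> U"
proof -
  have xU: "x \<in> lim_carrier W (finite_congruences W)"
    using assms openin_subset topspace_lim_topology[OF order_refl] by blast
  obtain K where K: "finite K" "K \<subseteq> finite_congruences W"
    "\<And>y. y \<in> lim_carrier W (finite_congruences W) \<Longrightarrow> (\<And>\<theta>. \<theta> \<in> K \<Longrightarrow> y \<theta> = x \<theta>) \<Longrightarrow> y \<in> U"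
    using lim_nhd[OF order_refl assms] by metis
  let ?\<theta> = "W \<times> W \<inter> \<Inter>K"
  have \<theta>: "?\<theta> \<in> finite_congruences W" using Inter_finite_congruences K by blast
  show thesis
  proof (rule that[OF \<theta>])
    fix y assume y: "y \<in> lim_carrier W (finite_congruences W)" and eq: "y ?\<theta> = x ?\<theta>"
    show "y \<in> U"
    proof (rule K(3)[OF y])
      fix \<rho> assume "\<rho> \<in> K"
      then show "y \<rho> = x \<rho>"
        using lim_eq_mono[OF order_refl y xU \<theta> _ _ eq] K(2) by blast
    qed
  qed
qed

lemma closure_of_lim_word:
  assumes L: "L \<subseteq> W"
  shows "lim_topology W (finite_congruences W) closure_of (lim_word (finite_congruences W) ` L) =
    {x \<in> lim_carrier W (finite_congruences W). \<forall>\<theta>\<in>finite_congruences W. \<exists>w\<in>L. w \<in> x \<theta>}"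
proof (intro equalityI subsetI)
  let ?I = "finite_congruences W" and ?T = "lim_topology W (finite_congruences W)"
  note I = order_refl[of ?I]
  fix x assume x: "x \<in> ?T closure_of (lim_word ?I ` L)"
  then have xc: "x \<in> lim_carrier W ?I"
    by (simp add: in_closure_of topspace_lim_topology[OF I])
  moreover have "\<exists>w\<in>L. w \<in> x \<theta>" if \<theta>: "\<theta> \<in> ?I" for \<theta>
  proof -
    let ?U = "{y \<in> lim_carrier W ?I. y \<theta> = x \<theta>}"
    have "openin ?T ?U" by (rule openin_lim_coordinate[OF I \<theta>])
    moreover have "x \<in> ?U" using xc by simp
    ultimately have "\<exists>y. y \<in> lim_word ?I ` L \<and> y \<in> ?U"
      using x[unfolded in_closure_of, THEN conjunct2, THEN spec, of ?U] by (simp only: simp_thms)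
    then obtain w where w: "w \<in> L" "lim_word ?I w \<theta> = x \<theta>" by (elim exE conjE imageE) simp
    then have "\<theta> `` {w} = x \<theta>" using \<theta> by (simp add: lim_word_def)
    then show ?thesis using w(1) L self_in_class[OF \<theta>, of w] by (intro bexI[OF _ w(1)]) (simp add: subset_iff)
  qed
  ultimately show "x \<in> {x \<in> lim_carrier W ?I. \<forall>\<theta>\<in>?I. \<exists>w\<in>L. w \<in> x \<theta>}" by blast
next
  let ?I = "finite_congruences W" and ?T = "lim_topology W (finite_congruences W)"
  note I = order_refl[of ?I]
  fix x assume "x \<in> {x \<in> lim_carrier W ?I. \<forall>\<theta>\<in>?I. \<exists>w\<in>L. w \<in> x \<theta>}"
  then have x: "x \<in> lim_carrier W ?I" and xL: "\<forall>\<theta>\<in>?I. \<exists>w\<in>L. w \<in> x \<theta>" by auto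
  show "x \<in> ?T closure_of (lim_word ?I ` L)"
    unfolding in_closure_of topspace_lim_topology[OF I]
  proof (intro conjI allI impI x)
    fix U assume U: "x \<in> U \<and> openin ?T U"
    then obtain \<theta> where \<theta>: "\<theta> \<in> ?I" "\<And>y. y \<in> lim_carrier W ?I \<Longrightarrow> y \<theta> = x \<theta> \<Longrightarrow> y \<in> U"
      using lim_nhd_single by metis
    then obtain w where w: "w \<in> L" "w \<in> x \<theta>" using xL by auto
    then have "lim_word ?I w \<theta> = x \<theta>"
      using lim_class(2)[OF I x \<theta>(1)] \<theta>(1) by (simp add: lim_word_def)
    then show "\<exists>y. y \<in> lim_word ?I ` L \<and> y \<in> U"
      using \<theta>(2)[of "lim_word ?I w"] w(1) lim_word_closed[OF I subsetD[OF L w(1)]]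
      by (intro exI[of _ "lim_word ?I w"]) simp
  qed
qed

text \<open>A compactness argument: the projective limit of nonempty finite sets is nonempty.\<close>

lemma lim_exists:
  assumes R: "\<And>\<theta>. \<theta> \<in> finite_congruences W \<Longrightarrow> \<exists>w\<in>W. R \<theta> (\<theta> `` {w})"
    and mono: "\<And>\<theta> \<rho> w. \<lbrakk>\<theta> \<in> finite_congruences W; \<rho> \<in> finite_congruences W; \<theta> \<subseteq> \<rho>; w \<in> W;
      R \<theta> (\<theta> `` {w})\<rbrakk> \<Longrightarrow> R \<rho> (\<rho> `` {w})"
  shows "\<exists>x\<in>lim_carrier W (finite_congruences W). \<forall>\<theta>\<in>finite_congruences W. R \<theta> (x \<theta>)"
proof -
  let ?I = "finite_congruences W"
  let ?X = "product_topology (\<lambda>\<theta>. discrete_topology (W // \<theta>)) ?I"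
  have coord: "closedin ?X {x \<in> topspace ?X. P (x \<theta>)}" if "\<theta> \<in> ?I" for \<theta> P
  proof -
    have "closedin ?X {x \<in> topspace ?X. x \<theta> \<in> {C \<in> W // \<theta>. P C}}"
      by (rule closedin_continuous_map_preimage[OF continuous_map_product_projection[OF that]]) auto
    moreover have "{x \<in> topspace ?X. x \<theta> \<in> {C \<in> W // \<theta>. P C}} = {x \<in> topspace ?X. P (x \<theta>)}"
      using that by auto
    ultimately show ?thesis by metis
  qed
  have coord2: "closedin ?X {x \<in> topspace ?X. x \<theta> \<subseteq> x \<rho>}" if "\<theta> \<in> ?I" "\<rho> \<in> ?I" for \<theta> \<rho>
  proof -
    have "{x \<in> topspace ?X. x \<theta> \<subseteq> x \<rho>} =
      (\<Union>C\<in>W // \<theta>. {x \<in> topspace ?X. x \<theta> = C} \<inter> {x \<in> topspace ?X. C \<subseteq> x \<rho>})"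
      using that by (auto simp: PiE_iff)
    moreover have "closedin ?X ({x \<in> topspace ?X. x \<theta> = C} \<inter> {x \<in> topspace ?X. C \<subseteq> x \<rho>})" for C
      by (intro closedin_Int coord that)
    then have "closedin ?X (\<Union>C\<in>W // \<theta>. {x \<in> topspace ?X. x \<theta> = C} \<inter> {x \<in> topspace ?X. C \<subseteq> x \<rho>})"
      by (intro closedin_Union finite_imageI finite_congruencesD(2)[OF that(1)]) (elim imageE, simp only:)
    ultimately show ?thesis by (simp only:)
  qed
  \<comment> \<open>\<open>F \<theta>\<close> asks for \<open>R\<close> at \<open>\<theta>\<close>
    and compatibility from \<open>\<theta>\<close> upwards. It is closed, and a point of all these
    sets is a point of the limit.\<close>
  define F where "F = (\<lambda>\<theta>. {x \<in> topspace ?X. R \<theta> (x \<theta>)} \<inter>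
    (\<Inter>\<rho>\<in>{\<rho>\<in>?I. \<theta> \<subseteq> \<rho>}. {x \<in> topspace ?X. x \<theta> \<subseteq> x \<rho>}))"
  have closed: "closedin ?X (F \<theta>)" if "\<theta> \<in> ?I" for \<theta>
    unfolding F_def using coord2[OF that] that
    by (intro closedin_Int coord[OF that] closedin_Inter) auto
  have fip: "\<Inter>\<F> \<noteq> {}" if \<F>: "finite \<F>" "\<F> \<subseteq> F ` ?I" for \<F>
  proof -
    obtain K where K: "K \<subseteq> ?I" "finite K" "\<F> = F ` K"
      using finite_subset_image[OF \<F>] by metis
    \<comment> \<open>A word with the property at the intersection of \<open>K\<close> has it at
      each member of \<open>K\<close> by monotonicity, so its image in the limit lies in all the
      chosen sets.\<close>
    let ?\<theta> = "W \<times> W \<inter> \<Inter>K"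
    have \<theta>: "?\<theta> \<in> ?I" using Inter_finite_congruences K by blast
    then obtain w where w: "w \<in> W" "R ?\<theta> (?\<theta> `` {w})" using R by blast
    have "lim_word ?I w \<in> F \<theta>" if "\<theta> \<in> K" for \<theta>
    proof -
      have \<theta>': "\<theta> \<in> ?I" using that K by auto
      have "R \<theta> (\<theta> `` {w})" using mono[OF \<theta> \<theta>' _ w] that by blast
      then show ?thesis
        using \<theta>' lim_word_closed[OF order_refl w(1)] w(1)
        by (auto simp: F_def lim_word_def quotientI)
    qed
    then show ?thesis using K by auto
  qed
  have compact: "compact_space ?X"
    unfolding compact_space_product_topology
    by (auto simp: compact_space_discrete_topology finite_congruencesD(2))
  have "\<Inter>(F ` ?I) \<noteq> {}"
    by (rule compact[unfolded compact_space_fip, rule_format]) (use closed fip in auto)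
  then obtain x where x: "\<And>\<theta>. \<theta> \<in> ?I \<Longrightarrow> x \<in> F \<theta>" by blast
  have "?I \<noteq> {}" using Inter_finite_congruences[of "{}"] by auto
  then have "x \<in> topspace ?X" using x by (auto simp: F_def)
  then have "x \<in> lim_carrier W ?I" using x by (auto simp: lim_carrier_def F_def)
  then show ?thesis using x by (auto simp: F_def)
qed

end

interpretation nonempty: word_semigroup "nonempty_words :: 'a::finite list set"
  by unfold_locales (auto simp: nonempty_words_def)

interpretation pw: semigroup_on "pseudowords :: 'a::finite pseudoword set" pseudoword_mult
  unfolding pseudowords_def pseudoword_mult_def by (rule nonempty.semigroup_on_lim) simp

section \<open>Recognizability of the Thue-Morse word and its language\<close>

section \<open>The Prouhet-Thue-Morse word\<close>

abbreviation \<tau> :: "letter list \<Rightarrow> letter list" where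
  "\<tau> \<equiv> subst thue_morse"

lemma subst_simps [simp]:
  "subst \<phi> [] = []" "subst \<phi> (x # w) = \<phi> x @ subst \<phi> w" "subst \<phi> (u @ v) = subst \<phi> u @ subst \<phi> v"
  by (simp_all add: subst_def)

lemma subst_funpow_append: "(subst \<phi> ^^ n) (u @ v) = (subst \<phi> ^^ n) u @ (subst \<phi> ^^ n) v"
  by (induction n) simp_all

lemma funpow_add_apply: "(f ^^ (m + n)) x = (f ^^ m) ((f ^^ n) x)"
  by (simp add: funpow_add)

lemma \<tau>_funpow_nonempty: "(\<tau> ^^ n) w \<noteq> [] \<longleftrightarrow> w \<noteq> []"
proof -
  have "length ((\<tau> ^^ n) w) = 0 \<longleftrightarrow> length w = 0"
    unfolding length_subst_thue_morse_funpow by simp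
  then show ?thesis by simp
qed

primrec flip :: "letter \<Rightarrow> letter" where
  "flip LA = LB"
| "flip LB = LA"

lemma flip_neq [simp]: "flip x \<noteq> x" "x \<noteq> flip x"
  by (cases x; simp)+

lemma flip_flip [simp]: "flip (flip x) = x"
  by (cases x) simp_all

lemma flip_eq_iff [simp]: "flip x = flip y \<longleftrightarrow> x = y"
  by (cases x; cases y; simp)

lemma thue_morse_flip: "thue_morse x = [x, flip x]"
  by (cases x) simp_all

text \<open>The fixed point of \<open>\<tau>\<close> starting with \<open>LA\<close>, through the
  binary digits of the position. The case 0 is separate because 0 is its own half.\<close>

fun tm :: "nat \<Rightarrow> letter" where
  "tm n = (if n = 0 then LA else if even n then tm (n div 2) else flip (tm (n div 2)))"

declare tm.simps [simp del]

lemma tm_0: "tm 0 = LA" by (simp add: tm.simps)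

lemma tm_even: "tm (2 * n) = tm n"
  by (cases "n = 0") (simp_all add: tm.simps[of "2 * n"])

lemma tm_odd: "tm (Suc (2 * n)) = flip (tm n)"
  by (simp add: tm.simps[of "Suc (2 * n)"])

text \<open>Treating words as segments at positions turns recognizability into a congruence of
  positions modulo a power of two.\<close>

definition seg :: "nat \<Rightarrow> nat \<Rightarrow> letter list" where
  "seg i j = map tm [i..<j]"

lemma length_seg [simp]: "length (seg i j) = j - i"
  by (simp add: seg_def)

lemma seg_append: "i \<le> j \<Longrightarrow> j \<le> k \<Longrightarrow> seg i j @ seg j k = seg i k"
  using upt_add_eq_append[of i j "k - j"] by (simp add: seg_def flip: map_append)

lemma seg_eq_appendD:
  assumes "seg i j = u @ v"
  shows "u = seg i (i + length u)" "v = seg (i + length u) j"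
proof -
  have "length (seg i j) = length u + length v" using assms by simp
  then have l: "j - i = length u + length v" by simp
  have "take (length u) (seg i j) = seg i (i + length u)"
  proof (cases "length u = 0")
    case False
    then have "i + length u \<le> j" using l by arith
    then show ?thesis by (simp add: seg_def take_map)
  qed (simp add: seg_def)
  then show "u = seg i (i + length u)" using assms by simp
  have "drop (length u) (seg i j) = seg (i + length u) j" by (simp add: seg_def drop_map)
  then show "v = seg (i + length u) j" using assms by simp
qed

lemma seg_eq_iff: "seg i (i + l) = seg j (j + l) \<longleftrightarrow> (\<forall>m<l. tm (i + m) = tm (j + m))"
  by (auto simp: seg_def list_eq_iff_nth_eq)

lemma \<tau>_seg: "\<tau> (seg i j) = seg (2 * i) (2 * j)"
proof (induction j)
  case (Suc j)
  show ?case
  proof (cases "i \<le> j")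
    case True
    have 1: "seg i (Suc j) = seg i j @ [tm j]" using True by (simp add: seg_def)
    have 2: "seg (2 * i) (2 * Suc j) = seg (2 * i) (2 * j) @ [tm (2 * j), tm (Suc (2 * j))]"
      using True by (simp add: seg_def)
    show ?thesis unfolding 1 2 using Suc by (simp add: thue_morse_flip tm_even tm_odd)
  qed (simp add: seg_def)
qed (simp add: seg_def)

lemma \<tau>_funpow_seg: "(\<tau> ^^ n) (seg i j) = seg (2 ^ n * i) (2 ^ n * j)"
  by (induction n) (simp_all add: \<tau>_seg mult.assoc)

lemma \<tau>_funpow_tm: "(\<tau> ^^ n) [tm m] = seg (2 ^ n * m) (2 ^ n * Suc m)"
proof -
  have "[tm m] = seg m (Suc m)" by (simp add: seg_def)
  then show ?thesis by (simp only: \<tau>_funpow_seg)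
qed

lemma \<tau>_funpow_LA: "(\<tau> ^^ n) [LA] = seg 0 (2 ^ n)"
  using \<tau>_funpow_tm[of n 0] by (simp add: tm_0)

text \<open>Among three consecutive positions two form a block \<open>\<tau> [x]\<close>, whose
  letters differ.\<close>

lemma tm_no_cube: "\<not> (tm q = tm (q + 1) \<and> tm (q + 1) = tm (q + 2))"
proof (cases "even q")
  case True
  then obtain r where "q = 2 * r" by blast
  then show ?thesis using tm_even[of r] tm_odd[of r] by simp
next
  case False
  then obtain r where "q = Suc (2 * r)" by (auto elim: oddE)
  then show ?thesis using tm_even[of "Suc r"] tm_odd[of "Suc r"] by simp
qed

text \<open>Reading the same letters with both parities of block boundaries forces three equal
  letters at \<open>q\<close>.\<close>

lemma tm_parity:
  assumes "\<forall>m<5. tm (2 * p + m) = tm (Suc (2 * q) + m)"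
  shows False
proof -
  have "tm (2 * p) = tm (Suc (2 * q))" "tm (Suc (2 * p)) = tm (2 * Suc q)"
    "tm (2 * Suc p) = tm (Suc (2 * Suc q))" "tm (Suc (2 * Suc p)) = tm (2 * Suc (Suc q))"
    using assms[rule_format, of 0] assms[rule_format, of 1] assms[rule_format, of 2] assms[rule_format, of 3]
    by (simp_all add: eval_nat_numeral)
  then have "tm p = flip (tm q)" "flip (tm p) = tm (Suc q)"
    "tm (Suc p) = flip (tm (Suc q))" "flip (tm (Suc p)) = tm (Suc (Suc q))"
    by (simp_all only: tm_even tm_odd)
  then have "tm (Suc q) = tm q" "tm (Suc (Suc q)) = tm (Suc q)" by auto
  then show False using tm_no_cube[of q] by simp
qed

text \<open>A window of five letters determines the parity of its position; keeping every second
  letter then halves the position and the window.\<close>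

lemma tm_recognizable:
  assumes "\<forall>m<5 * 2 ^ k. tm (i + m) = tm (j + m)"
  shows "i mod 2 ^ k = j mod 2 ^ k"
  using assms
proof (induction k arbitrary: i j)
  case (Suc k)
  have le: "5 \<le> (5::nat) * 2 ^ Suc k" by simp
  have par: "even i \<longleftrightarrow> even j"
  proof (rule ccontr)
    assume "\<not> ?thesis"
    then have "(\<exists>p q. i = 2 * p \<and> j = Suc (2 * q)) \<or> (\<exists>p q. j = 2 * p \<and> i = Suc (2 * q))"
      by (auto elim!: evenE oddE)
    moreover have "\<forall>m<5. tm (i + m) = tm (j + m)"
      using Suc.prems le order_less_le_trans by blast
    ultimately show False using tm_parity by (metis (lifting))
  qed
  have "tm (i div 2 + m) = tm (j div 2 + m)" if "m < 5 * 2 ^ k" for m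
  proof -
    have "2 * m < 5 * 2 ^ Suc k" using that by simp
    then have eq: "tm (i + 2 * m) = tm (j + 2 * m)" using Suc.prems by blast
    show ?thesis
    proof (cases "even i")
      case True
      then have "i + 2 * m = 2 * (i div 2 + m)" "j + 2 * m = 2 * (j div 2 + m)" using par by auto
      then show ?thesis using eq tm_even by metis
    next
      case False
      then have "i + 2 * m = Suc (2 * (i div 2 + m))" "j + 2 * m = Suc (2 * (j div 2 + m))"
        using par by (auto simp: odd_two_times_div_two_nat elim!: oddE)
      then have "flip (tm (i div 2 + m)) = flip (tm (j div 2 + m))" using eq tm_odd by metis
      then show ?thesis by simp
    qed
  qed
  then have "i div 2 mod 2 ^ k = j div 2 mod 2 ^ k" using Suc.IH by blast
  moreover have "i mod 2 = j mod 2" using par by (metis even_iff_mod_2_eq_zero not_mod_2_eq_0_eq_1)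
  ultimately show ?case using mod_mult2_eq[of i 2 "2 ^ k"] mod_mult2_eq[of j 2 "2 ^ k"] by simp
qed simp

text \<open>The window \<open>5 * 2 ^ k\<close> is rounded up to a power of two, to match prefixes
  and suffixes of iterated images of letters.\<close>

lemma seg_recognizable:
  assumes "seg i (i + 2 ^ (k + 3)) = seg j (j + 2 ^ (k + 3))"
  shows "i mod 2 ^ k = j mod 2 ^ k"
proof (rule tm_recognizable)
  have "(5::nat) * 2 ^ k \<le> 2 ^ (k + 3)" by (simp add: power_add)
  then show "\<forall>m<5 * 2 ^ k. tm (i + m) = tm (j + m)"
    using assms unfolding seg_eq_iff by auto
qed

text \<open>Let \<open>p\<close> be the first block of length 2^n starting strictly after
  \<open>i\<close>. One of the blocks p, p+1, p+2 is the image of \<open>LA\<close>, as three equal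
  letters do not occur, and block p+2 ends by i + 4 * 2^n. The fifth block length leaves a nonempty
  rest on the right.\<close>

lemma seg_contains_\<tau>_LA:
  assumes "5 * 2 ^ n \<le> l"
  obtains u v where "seg i (i + l) = u @ (\<tau> ^^ n) [LA] @ v" "u \<noteq> []" "v \<noteq> []"
proof -
  let ?p = "Suc (i div 2 ^ n)"
  obtain m where m: "tm m = LA" "?p \<le> m" "m \<le> ?p + 2"
  proof -
    have "tm ?p = LA \<or> tm (?p + 1) = LA \<or> tm (?p + 2) = LA"
      using tm_no_cube[of ?p] by (cases "tm ?p"; cases "tm (?p + 1)"; cases "tm (?p + 2)") simp_all
    then show thesis using that[of ?p] that[of "?p + 1"] that[of "?p + 2"] by auto
  qed
  have i: "2 ^ n * (i div 2 ^ n) \<le> i" "i < 2 ^ n * ?p"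
    using mult_div_mod_eq[of "2 ^ n" i] mod_less_divisor[of "2 ^ n" i, OF zero_less_power[OF pos2]]
    unfolding mult_Suc_right by linarith+
  have 1: "i < 2 ^ n * m" using i(2) m(2) by (meson mult_le_mono2 order_less_le_trans)
  have "2 ^ n * Suc m \<le> 2 ^ n * (i div 2 ^ n + 4)" using m(3) by (intro mult_le_mono2) simp
  also have "\<dots> \<le> i + 4 * 2 ^ n" using i(1) by (simp add: distrib_left)
  also have "\<dots> < i + 5 * 2 ^ n" by simp
  finally have 2: "2 ^ n * Suc m < i + l" using assms by simp
  have "2 ^ n * m \<le> 2 ^ n * Suc m" by simp
  then have "seg i (i + l) = seg i (2 ^ n * m) @ seg (2 ^ n * m) (2 ^ n * Suc m) @ seg (2 ^ n * Suc m) (i + l)"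
    using seg_append[of i "2 ^ n * m" "i + l"] seg_append[of "2 ^ n * m" "2 ^ n * Suc m" "i + l"] 1 2
    by (simp only: less_imp_le)
  moreover have "seg (2 ^ n * m) (2 ^ n * Suc m) = (\<tau> ^^ n) [LA]"
    using \<tau>_funpow_tm[of n m] m(1) by simp
  moreover have "length (seg i (2 ^ n * m)) > 0" "length (seg (2 ^ n * Suc m) (i + l)) > 0"
    using 1 2 unfolding length_seg by linarith+
  ultimately show thesis using that by (metis length_greater_0_conv)
qed

lemma sublist_funpow_subst: "sublist u v \<Longrightarrow> sublist ((subst \<phi> ^^ n) u) ((subst \<phi> ^^ n) v)"
  unfolding sublist_def by (metis subst_funpow_append)

abbreviation TML :: "letter list set" where
  "TML \<equiv> subst_language thue_morse"

lemma TML_nonempty: "TML \<subseteq> nonempty_words"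
  by (auto simp: subst_language_def)

lemma TML_seg:
  assumes "w \<in> TML"
  obtains i where "w = seg i (i + length w)"
proof -
  obtain N where "sublist w ((\<tau> ^^ N) [LA])" using assms by (auto simp: subst_language_def)
  then obtain u v where "seg 0 (2 ^ N) = u @ w @ v"
    by (auto simp: sublist_def \<tau>_funpow_LA)
  then have "seg (length u) (2 ^ N) = w @ v"
    using seg_eq_appendD(2)[of 0 "2 ^ N" u "w @ v"] by simp
  then show thesis using seg_eq_appendD(1) that by blast
qed

lemma TML_factor:
  assumes "u @ w @ v \<in> TML" "w \<noteq> []"
  shows "w \<in> TML"
proof -
  have "sublist w (u @ w @ v)" by (auto simp: sublist_def)
  then show ?thesis
    using assms sublist_order.order.trans
    unfolding subst_language_def nonempty_words_def mem_Collect_eq by metis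
qed

lemma TML_pair: "[c, d] \<in> TML"
proof -
  have *: "sublist [c, d] ((\<tau> ^^ 3) [y])" for y
  proof -
    have "(\<tau> ^^ 3) [y] = [y, flip y, flip y, y, flip y, y, y, flip y]"
      by (cases y) (simp_all add: eval_nat_numeral)
    then show ?thesis by (cases y; cases c; cases d) (simp_all add: sublist_Cons_right)
  qed
  have "sublist [c, d] ((\<tau> ^^ k) [x])" if "k \<ge> 3" for k x
  proof -
    have "(\<tau> ^^ k) [x] = (\<tau> ^^ 3) ((\<tau> ^^ (k - 3)) [x])"
      using that funpow_add_apply[of 3 "k - 3" \<tau> "[x]"] by simp
    moreover obtain y w where "(\<tau> ^^ (k - 3)) [x] = [y] @ w"
      using \<tau>_funpow_nonempty[of "k - 3" "[x]"] by (cases "(\<tau> ^^ (k - 3)) [x]") auto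
    moreover obtain u v where "(\<tau> ^^ 3) [y] = u @ [c, d] @ v"
      using *[of y] unfolding sublist_def by blast
    ultimately have "(\<tau> ^^ k) [x] = u @ [c, d] @ (v @ (\<tau> ^^ 3) w)"
      by (simp only: subst_funpow_append append_assoc)
    then show ?thesis unfolding sublist_def by blast
  qed
  then show ?thesis by (auto simp: subst_language_def nonempty_words_def)
qed

text \<open>\<tau>^2(x) has four letters, so the image of its second letter has nonempty neighbours
  on both sides. They are required nonempty because cofactors must be elements of the free
  semigroup.\<close>

lemma TML_inner_factor:
  assumes "w \<in> TML"
  shows "\<exists>N. \<forall>k\<ge>N. \<forall>x. \<exists>u v. u \<noteq> [] \<and> v \<noteq> [] \<and> (\<tau> ^^ k) [x] = u @ w @ v"
proof -
  obtain N where N: "\<And>k x. k \<ge> N \<Longrightarrow> sublist w ((\<tau> ^^ k) [x])"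
    using assms by (auto simp: subst_language_def)
  show ?thesis
  proof (rule exI[of _ "N + 2"], intro allI impI)
    fix k x assume k: "N + 2 \<le> k"
    have "(\<tau> ^^ k) [x] = (\<tau> ^^ (k - 2)) ((\<tau> ^^ 2) [x])"
      using k funpow_add_apply[of "k - 2" 2 \<tau> "[x]"] by (simp only: le_add_diff_inverse2 add_leD2)
    also have "(\<tau> ^^ 2) [x] = [x] @ [flip x] @ [flip x, x]"
      by (cases x) (simp_all add: eval_nat_numeral)
    finally have eq: "(\<tau> ^^ k) [x] = (\<tau> ^^ (k - 2)) [x] @ (\<tau> ^^ (k - 2)) [flip x] @ (\<tau> ^^ (k - 2)) [flip x, x]"
      by (simp only: subst_funpow_append)
    obtain u v where "(\<tau> ^^ (k - 2)) [flip x] = u @ w @ v"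
      using N[OF add_le_imp_le_diff[OF k], of "flip x"] by (auto simp: sublist_def)
    then have "(\<tau> ^^ k) [x] = ((\<tau> ^^ (k - 2)) [x] @ u) @ w @ (v @ (\<tau> ^^ (k - 2)) [flip x, x])"
      using eq by simp
    then show "\<exists>u v. u \<noteq> [] \<and> v \<noteq> [] \<and> (\<tau> ^^ k) [x] = u @ w @ v"
      using \<tau>_funpow_nonempty by (metis append_is_Nil_conv list.simps(3))
  qed
qed

lemma \<tau>_funpow_LA_in_TML: "(\<tau> ^^ n) [LA] \<in> TML"
proof -
  have "[LA] \<in> TML" using TML_factor[of "[]" "[LA]" "[LA]"] TML_pair by simp
  then obtain N where N: "\<And>k x. k \<ge> N \<Longrightarrow> \<exists>u v. u \<noteq> [] \<and> v \<noteq> [] \<and> (\<tau> ^^ k) [x] = u @ [LA] @ v"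
    using TML_inner_factor by meson
  have "sublist ((\<tau> ^^ n) [LA]) ((\<tau> ^^ k) [x])" if "k \<ge> n + N" for k x
  proof -
    have "sublist [LA] ((\<tau> ^^ (k - n)) [x])"
      using N[of "k - n" x] that by (fastforce simp: sublist_def)
    then have "sublist ((\<tau> ^^ n) [LA]) ((\<tau> ^^ n) ((\<tau> ^^ (k - n)) [x]))" by (rule sublist_funpow_subst)
    then show ?thesis using that funpow_add_apply[of n "k - n" \<tau> "[x]"] by simp
  qed
  then show ?thesis
    using \<tau>_funpow_nonempty[of n "[LA]"] unfolding subst_language_def nonempty_words_def by blast
qed

section \<open>Letter and block counts\<close>

fun count_bb :: "letter list \<Rightarrow> nat" where
  "count_bb (x # y # w) = (if x = LB \<and> y = LB then 1 else 0) + count_bb (y # w)"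
| "count_bb _ = 0"

lemma \<tau>_square_Cons: "(\<tau> ^^ 2) (x # w) = x # flip x # flip x # x # (\<tau> ^^ 2) w"
  by (cases x) (simp_all add: eval_nat_numeral)

lemma count_b_\<tau>_square: "count_list ((\<tau> ^^ 2) w) LB = 2 * length w"
proof (induction w)
  case (Cons x w)
  then show ?case by (cases x) (simp_all add: \<tau>_square_Cons del: funpow.simps)
qed (simp add: eval_nat_numeral)

text \<open>Inside blocks, bb occurs once in \<tau>^2(a) = abba and never in \<tau>^2(b) = baab. As
  \<tau>^2(x) begins and ends with x, it occurs at a joint of blocks exactly where \<open>w\<close>
  has bb.\<close>

lemma count_bb_\<tau>_square: "count_bb ((\<tau> ^^ 2) w) = count_list w LA + count_bb w"
proof (induction w rule: count_bb.induct)
  case (1 x y w)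
  then show ?case by (cases x; cases y) (simp_all add: \<tau>_square_Cons)
next
  case ("2_2" x)
  then show ?case by (cases x) (simp_all add: \<tau>_square_Cons, simp_all add: eval_nat_numeral)
qed (simp add: eval_nat_numeral)

text \<open>The first square gives the two parities. Afterwards the number of a's is even, since the
  length and the number of b's are, so further squares leave the parity of bb unchanged.\<close>

lemma parity_\<tau>_even:
  assumes "even n" "n > 0"
  shows "even (count_list ((\<tau> ^^ n) w) LB)"
    "odd (count_bb ((\<tau> ^^ n) w)) \<longleftrightarrow> odd (count_list w LA + count_bb w)"
proof -
  obtain k where n: "n = 2 * Suc k" using assms by (metis dvdE gr0_implies_Suc mult_0_right not_gr0)
  have *: "even (count_list ((\<tau> ^^ (2 * Suc k)) w) LB) \<and>
    (odd (count_bb ((\<tau> ^^ (2 * Suc k)) w)) \<longleftrightarrow> odd (count_list w LA + count_bb w))"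
  proof (induction k)
    case 0
    then show ?case using count_b_\<tau>_square[of w] count_bb_\<tau>_square[of w] by simp
  next
    case (Suc k)
    let ?v = "(\<tau> ^^ (2 * Suc k)) w"
    have eq: "(\<tau> ^^ (2 * Suc (Suc k))) w = (\<tau> ^^ 2) ?v"
      using funpow_add_apply[of 2 "2 * Suc k" \<tau> w] by (simp only: mult_Suc_right)
    have len: "count_list ?v LA + count_list ?v LB = length ?v"
    proof -
      have "count_list v LA + count_list v LB = length v" for v
        by (induction v) (auto, metis letter.exhaust)
      then show ?thesis .
    qed
    have "even (length ?v)" unfolding length_subst_thue_morse_funpow by simp
    then have "even (count_list ?v LA)" using len Suc.IH by (metis even_add)
    then show ?case
      unfolding eq count_b_\<tau>_square count_bb_\<tau>_square using Suc.IH by simp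
  qed
  show "even (count_list ((\<tau> ^^ n) w) LB)"
    "odd (count_bb ((\<tau> ^^ n) w)) \<longleftrightarrow> odd (count_list w LA + count_bb w)"
    unfolding n using * by blast+
qed

section \<open>A nonabelian action of words that detects parity\<close>

section \<open>An action of words that is invariant under a power of the substitution\<close>

text \<open>
  The letter read from the state of the previous letter permutes three points:
  the transpositions below were found by searching for a labelling of the four two-letter words
  that the fourth power of the substitution preserves.  The loops at \<open>LA\<close> then generate the
  symmetric group of degree three.
\<close>

fun label :: "letter \<Rightarrow> letter \<Rightarrow> letter option \<Rightarrow> letter option" where
  "label LA LB i = i"
| "label LB LA i = (case i of None \<Rightarrow> Some LA | Some LA \<Rightarrow> None | Some LB \<Rightarrow> Some LB)"
| "label _ _ i = map_option flip i"

text \<open>The state keeps the last letter because the labels belong to pairs of letters.\<close>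

fun step :: "letter \<Rightarrow> letter \<times> letter option \<Rightarrow> letter \<times> letter option" where
  "step d (c, i) = (d, label c d i)"

abbreviation act :: "letter list \<Rightarrow> letter \<times> letter option \<Rightarrow> letter \<times> letter option" where
  "act \<equiv> fold step"

text \<open>Both sides are compositions over letters, so it suffices to compare \<tau>^4(d) with d
  on the six states.\<close>

lemma act_\<tau>: "act ((\<tau> ^^ 4) w) = act w"
proof (induction w)
  case (Cons d w)
  have "act ((\<tau> ^^ 4) [d]) s = step d s" for s
  proof -
    obtain c i where s: "s = (c, i)" by force
    show ?thesis unfolding s
      by (cases d; cases c; cases i; (cases "the i")?) (simp_all add: eval_nat_numeral)
  qed
  then have "act ((\<tau> ^^ 4) ([d] @ w)) = act w \<circ> step d"
    unfolding subst_funpow_append using Cons by (simp add: fun_eq_iff)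
  then show ?case by simp
qed (simp add: eval_nat_numeral)

lemma act_\<tau>_funpow: "4 dvd n \<Longrightarrow> act ((\<tau> ^^ n) w) = act w"
proof (elim dvdE)
  fix k assume "n = 4 * k"
  then show ?thesis
  proof (induction k arbitrary: n)
    case (Suc k)
    have "(\<tau> ^^ n) w = (\<tau> ^^ 4) ((\<tau> ^^ (4 * k)) w)"
      using Suc.prems funpow_add_apply[of 4 "4 * k" \<tau> w] by simp
    then show ?case using Suc.IH act_\<tau> by simp
  qed simp
qed

lemma act_replicate: "act (replicate N LA) (LA, Some LA) = (LA, if even N then Some LA else Some LB)"
proof (induction N)
  case (Suc N)
  have "replicate (Suc N) LA = replicate N LA @ [LA]" by (simp add: replicate_append_same)
  then show ?case using Suc by (simp del: replicate.simps)
qed simp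

text \<open>On the states with last letter a, the word a acts as a transposition and aba as a cycle
  of length three.\<close>

lemma act_noncommuting: "act ([LA] @ [LA, LB, LA]) \<noteq> act ([LA, LB, LA] @ [LA])"
proof
  assume "act ([LA] @ [LA, LB, LA]) = act ([LA, LB, LA] @ [LA])"
  then have "act ([LA] @ [LA, LB, LA]) (LA, None) = act ([LA, LB, LA] @ [LA]) (LA, None)" by simp
  then show False by simp
qed

lemma act_congruence: "{(u, v). u \<in> nonempty_words \<and> v \<in> nonempty_words \<and> act u = act v} \<in> finite_congruences nonempty_words"
  by (rule kernel_finite_congruence) (auto simp: nonempty_words_def)

section \<open>Exponents at which the substitution is idempotent modulo a congruence\<close>

section \<open>Idempotent powers of the substitution\<close>

text \<open>Stated on words rather than on the quotient, since \<open>\<theta>\<close> is not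
  assumed invariant under \<open>\<tau>\<close>, which therefore may not act on the classes.\<close>

definition idem_exponent :: "(letter list \<times> letter list) set \<Rightarrow> nat \<Rightarrow> bool" where
  "idem_exponent \<theta> n \<longleftrightarrow> n > 0 \<and> (\<forall>w\<in>nonempty_words. ((\<tau> ^^ n) ((\<tau> ^^ n) w), (\<tau> ^^ n) w) \<in> \<theta>)"

lemma \<tau>_funpow_nonempty_words [simp, intro]: "w \<in> nonempty_words \<Longrightarrow> (\<tau> ^^ n) w \<in> nonempty_words"
  by (simp add: nonempty_words_def \<tau>_funpow_nonempty)

lemma letterwise_congruent:
  assumes \<theta>: "\<theta> \<in> finite_congruences nonempty_words"
    and eq: "\<And>c. ((\<tau> ^^ i) [c], (\<tau> ^^ j) [c]) \<in> \<theta>"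
    and w: "w \<in> nonempty_words"
  shows "((\<tau> ^^ i) w, (\<tau> ^^ j) w) \<in> \<theta>"
proof -
  have "w \<noteq> [] \<Longrightarrow> ((\<tau> ^^ i) w, (\<tau> ^^ j) w) \<in> \<theta>"
  proof (induction w rule: list_nonempty_induct)
    case (cons x w)
    have "x # w = [x] @ w" by simp
    then show ?case
      using finite_congruencesD(3)[OF \<theta> eq cons.IH, of x] by (simp only: subst_funpow_append)
  qed (rule eq)
  then show ?thesis using w by (simp add: nonempty_words_def)
qed

text \<open>Modulo \<open>\<theta>\<close>, a power of \<open>\<tau>\<close> is determined by the
  classes of the images of the two letters, so the powers are eventually periodic. The extra demands
  serve later uses: \<open>N\<close> for containing given factors, \<open>k\<close> for parity and
  for the period four of \<open>act\<close>.\<close>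

lemma idem_exponent_exists:
  assumes \<theta>: "\<theta> \<in> finite_congruences nonempty_words" and "k > 0"
  obtains n where "idem_exponent \<theta> n" "n \<ge> N" "k dvd n"
proof -
  have tr: "trans \<theta>" and sym: "sym \<theta>" using finite_congruencesD(1)[OF \<theta>] by (auto simp: equiv_def)
  let ?f = "\<lambda>i. (\<theta> `` {(\<tau> ^^ i) [LA]}, \<theta> `` {(\<tau> ^^ i) [LB]})"
  have ne: "(\<tau> ^^ i) [c] \<in> nonempty_words" for i c
    by (simp add: nonempty_words_def \<tau>_funpow_nonempty)
  have "range ?f \<subseteq> (nonempty_words // \<theta>) \<times> (nonempty_words // \<theta>)"
    using ne by (auto intro!: quotientI)
  moreover have "finite ((nonempty_words // \<theta>) \<times> (nonempty_words // \<theta>))"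
    using finite_congruencesD(2)[OF \<theta>] by simp
  ultimately have "finite (range ?f)" by (rule finite_subset)
  then have "\<not> inj ?f" using finite_imageD by auto
  then obtain i j where "i < j" "?f i = ?f j" unfolding inj_def by (metis linorder_neqE_nat)
  then obtain d where d: "d > 0" "?f i = ?f (i + d)" using less_imp_add_positive by metis
  have "((\<tau> ^^ i) [c], (\<tau> ^^ (i + d)) [c]) \<in> \<theta>" for c
    using d(2) class_eq_iff[OF \<theta> ne ne] by (cases c) auto
  then have step: "((\<tau> ^^ i) w, (\<tau> ^^ (i + d)) w) \<in> \<theta>" if "w \<in> nonempty_words" for w
    using letterwise_congruent[OF \<theta> _ that] by blast
  have per: "((\<tau> ^^ (i + m)) w, (\<tau> ^^ (i + m + l * d)) w) \<in> \<theta>" if w: "w \<in> nonempty_words" for w m l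
  proof (induction l)
    case 0
    show ?case using finite_congruencesD(1)[OF \<theta>] w by (simp add: equiv_def refl_on_def)
  next
    case (Suc l)
    \<comment> \<open>The period is applied with another word in place of \<open>w\<close>; this
      avoids applying \<open>\<tau>\<close> to congruent words.\<close>
    have "((\<tau> ^^ i) ((\<tau> ^^ (m + l * d)) w), (\<tau> ^^ (i + d)) ((\<tau> ^^ (m + l * d)) w)) \<in> \<theta>"
      using step w by simp
    then have "((\<tau> ^^ (i + m + l * d)) w, (\<tau> ^^ (i + m + Suc l * d)) w) \<in> \<theta>"
      by (simp only: funpow_add_apply[symmetric]) (simp add: ac_simps)
    then show ?case using Suc.IH transD[OF tr] by blast
  qed
  \<comment> \<open>A multiple of the period \<open>d\<close> and of \<open>k\<close> that exceeds
    the preperiod \<open>i\<close> and \<open>N\<close>.\<close>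
  let ?n = "k * d * (i + N + 1)"
  have ge: "i + N + 1 \<le> ?n" using d(1) \<open>k > 0\<close> mult_le_mono1[of 1 "k * d" "i + N + 1"] by simp
  then obtain m where m: "?n = i + m" by (metis add.assoc le_Suc_ex)
  have "((\<tau> ^^ ?n) ((\<tau> ^^ ?n) w), (\<tau> ^^ ?n) w) \<in> \<theta>" if "w \<in> nonempty_words" for w
  proof -
    have "((\<tau> ^^ (i + m)) w, (\<tau> ^^ (i + m + (k * (i + N + 1)) * d)) w) \<in> \<theta>" by (rule per[OF that])
    moreover have "i + m + (k * (i + N + 1)) * d = ?n + ?n" using m by (simp add: algebra_simps)
    ultimately have "((\<tau> ^^ ?n) w, (\<tau> ^^ (?n + ?n)) w) \<in> \<theta>" using m by metis
    then show ?thesis using symD[OF sym] by (simp only: funpow_add comp_apply)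
  qed
  moreover have "?n > 0" using ge by linarith
  ultimately have "idem_exponent \<theta> ?n" unfolding idem_exponent_def by blast
  then show thesis using ge by (intro that[of ?n]) auto
qed

lemma idem_exponent_multiple:
  assumes \<theta>: "\<theta> \<in> finite_congruences nonempty_words" and n: "idem_exponent \<theta> n" and w: "w \<in> nonempty_words"
  shows "((\<tau> ^^ (n * Suc k)) w, (\<tau> ^^ n) w) \<in> \<theta>"
proof (induction k)
  case 0
  show ?case using finite_congruencesD(1)[OF \<theta>] w by (simp add: equiv_def refl_on_def)
next
  case (Suc k)
  have "((\<tau> ^^ n) ((\<tau> ^^ n) ((\<tau> ^^ (n * k)) w)), (\<tau> ^^ n) ((\<tau> ^^ (n * k)) w)) \<in> \<theta>"
    using n w by (simp add: idem_exponent_def)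
  then have "((\<tau> ^^ (n * Suc (Suc k))) w, (\<tau> ^^ (n * Suc k)) w) \<in> \<theta>"
    by (simp add: funpow_add)
  then show ?case
    using Suc.IH finite_congruencesD(1)[OF \<theta>] by (auto simp: equiv_def dest: transD)
qed

text \<open>Both powers agree with the power at the common multiple \<open>n * m\<close>. This makes
  \<open>omega\<close> independent of the chosen exponent.\<close>

lemma idem_exponent_unique:
  assumes \<theta>: "\<theta> \<in> finite_congruences nonempty_words" and n: "idem_exponent \<theta> n" and m: "idem_exponent \<theta> m"
    and w: "w \<in> nonempty_words"
  shows "((\<tau> ^^ n) w, (\<tau> ^^ m) w) \<in> \<theta>"
proof -
  have "n > 0" "m > 0" using n m by (auto simp: idem_exponent_def)
  then obtain n' m' where "n = Suc n'" "m = Suc m'" by (metis gr0_implies_Suc)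
  then have "((\<tau> ^^ (n * m)) w, (\<tau> ^^ n) w) \<in> \<theta>" "((\<tau> ^^ (n * m)) w, (\<tau> ^^ m) w) \<in> \<theta>"
    using idem_exponent_multiple[OF \<theta> n w, of m'] idem_exponent_multiple[OF \<theta> m w, of n']
    by (simp_all add: mult.commute)
  then show ?thesis
    using finite_congruencesD(1)[OF \<theta>] by (auto simp: equiv_def dest: symD transD)
qed

lemma idem_exponent_mono: "idem_exponent \<theta> n \<Longrightarrow> \<theta> \<subseteq> \<rho> \<Longrightarrow> idem_exponent \<rho> n"
  by (auto simp: idem_exponent_def)

section \<open>Divisibility, factorizations and borders of pseudowords\<close>

section \<open>Pseudowords\<close>

abbreviation NE :: "letter list set" where
  "NE \<equiv> nonempty_words"

abbreviation FC :: "(letter list \<times> letter list) set set" where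
  "FC \<equiv> finite_congruences NE"

abbreviation PW :: "letter pseudoword set" where
  "PW \<equiv> pseudowords"

abbreviation pw_mult :: "letter pseudoword \<Rightarrow> letter pseudoword \<Rightarrow> letter pseudoword" (infixl "\<odot>" 70) where
  "x \<odot> y \<equiv> pseudoword_mult x y"

lemma NE_iff [simp]: "w \<in> NE \<longleftrightarrow> w \<noteq> []"
  by (simp add: nonempty_words_def)

lemma finite_semigroup_NE: "\<theta> \<in> FC \<Longrightarrow> finite_semigroup_on (NE // \<theta>) (class_mult \<theta>)"
  by (rule nonempty.finite_semigroup_class_mult)

lemma pw_coord: "x \<in> PW \<Longrightarrow> \<theta> \<in> FC \<Longrightarrow> x \<theta> \<in> NE // \<theta>"
  unfolding pseudowords_def by (rule lim_carrierD(1)[OF order_refl])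

lemma pw_obtain:
  assumes "x \<in> PW" "\<theta> \<in> FC"
  obtains w where "w \<noteq> []" "w \<in> x \<theta>" "x \<theta> = \<theta> `` {w}"
proof -
  obtain w where "w \<in> NE" "w \<in> x \<theta>" "x \<theta> = \<theta> `` {w}"
    using lim_obtain[OF order_refl assms[unfolded pseudowords_def]] .
  then show thesis by (intro that) simp_all
qed

lemma pw_class:
  assumes "x \<in> PW" "\<theta> \<in> FC" "w \<in> x \<theta>"
  shows "w \<noteq> []" "x \<theta> = \<theta> `` {w}"
  using lim_class[OF order_refl assms[unfolded pseudowords_def]] by simp_all

lemma pw_mono: "\<lbrakk>x \<in> PW; \<theta> \<in> FC; \<rho> \<in> FC; \<theta> \<subseteq> \<rho>; w \<in> x \<theta>\<rbrakk> \<Longrightarrow> w \<in> x \<rho>"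
  unfolding pseudowords_def using lim_carrierD(2)[OF order_refl] by (rule subsetD)

lemma pw_eqI: "\<lbrakk>x \<in> PW; y \<in> PW; \<And>\<theta>. \<theta> \<in> FC \<Longrightarrow> x \<theta> = y \<theta>\<rbrakk> \<Longrightarrow> x = y"
  unfolding pseudowords_def by (rule lim_eqI[OF order_refl])

lemma pw_eq_mono:
  "\<lbrakk>x \<in> PW; y \<in> PW; \<theta> \<in> FC; \<rho> \<in> FC; \<theta> \<subseteq> \<rho>; x \<theta> = y \<theta>\<rbrakk> \<Longrightarrow> x \<rho> = y \<rho>"
  unfolding pseudowords_def by (rule lim_eq_mono[where \<theta>=\<theta>, OF order_refl])

lemma pw_mult_app: "\<theta> \<in> FC \<Longrightarrow> (x \<odot> y) \<theta> = class_mult \<theta> (x \<theta>) (y \<theta>)"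
  unfolding pseudoword_mult_def by (rule lim_mult_apply)

lemma class_mult_NE:
  "\<theta> \<in> FC \<Longrightarrow> u \<noteq> [] \<Longrightarrow> v \<noteq> [] \<Longrightarrow> class_mult \<theta> (\<theta> `` {u}) (\<theta> `` {v}) = \<theta> `` {u @ v}"
  using class_mult_class[of \<theta> NE u v] by simp

lemma class_NE: "u \<noteq> [] \<Longrightarrow> \<theta> `` {u} \<in> NE // \<theta>"
  by (simp add: quotientI)

lemma class_NE_eq_iff: "\<theta> \<in> FC \<Longrightarrow> u \<noteq> [] \<Longrightarrow> v \<noteq> [] \<Longrightarrow> \<theta> `` {u} = \<theta> `` {v} \<longleftrightarrow> (u, v) \<in> \<theta>"
  using class_eq_iff[of \<theta> NE u v] by simp

lemma class_NE_mono:
  "\<lbrakk>\<theta> \<in> FC; \<rho> \<in> FC; \<theta> \<subseteq> \<rho>; u \<noteq> []; v \<noteq> []; \<theta> `` {u} = \<theta> `` {v}\<rbrakk> \<Longrightarrow> \<rho> `` {u} = \<rho> `` {v}"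
  by (simp add: class_NE_eq_iff subset_iff)

lemma pw_mult_mem:
  assumes "x \<in> PW" "y \<in> PW" "\<theta> \<in> FC" "u \<in> x \<theta>" "v \<in> y \<theta>"
  shows "u @ v \<in> (x \<odot> y) \<theta>"
proof -
  have "u \<noteq> []" "v \<noteq> []" "x \<theta> = \<theta> `` {u}" "y \<theta> = \<theta> `` {v}"
    using pw_class[OF assms(1,3,4)] pw_class[OF assms(2,3,5)] by simp_all
  then show ?thesis
    using assms(3) self_in_class[OF assms(3), of "u @ v"] by (simp add: pw_mult_app class_mult_NE)
qed

lemma pw_lim_exists:
  assumes "\<And>\<theta>. \<theta> \<in> FC \<Longrightarrow> \<exists>w. w \<noteq> [] \<and> R \<theta> (\<theta> `` {w})"
    and "\<And>\<theta> \<rho> w. \<lbrakk>\<theta> \<in> FC; \<rho> \<in> FC; \<theta> \<subseteq> \<rho>; w \<noteq> []; R \<theta> (\<theta> `` {w})\<rbrakk> \<Longrightarrow> R \<rho> (\<rho> `` {w})"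
  shows "\<exists>x\<in>PW. \<forall>\<theta>\<in>FC. R \<theta> (x \<theta>)"
  unfolding pseudowords_def
proof (rule nonempty.lim_exists)
  show "\<exists>w\<in>NE. R \<theta> (\<theta> `` {w})" if "\<theta> \<in> FC" for \<theta> using assms(1)[OF that] by auto
  show "R \<rho> (\<rho> `` {w})" if "\<theta> \<in> FC" "\<rho> \<in> FC" "\<theta> \<subseteq> \<rho>" "w \<in> NE" "R \<theta> (\<theta> `` {w})" for \<theta> \<rho> w
    using assms(2)[OF that(1-3) _ that(5)] that(4) by simp
qed

text \<open>Compactness: cofactors in the finite quotients can be chosen coherently, because a
  cofactor modulo \<open>\<theta>\<close> remains one modulo every coarser congruence.\<close>

lemma pw_left_divides:
  assumes x: "x \<in> PW" and y: "y \<in> PW"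
    and ex: "\<And>\<theta>. \<theta> \<in> FC \<Longrightarrow> \<exists>C\<in>NE // \<theta>. class_mult \<theta> (y \<theta>) C = x \<theta>"
  shows "\<exists>v\<in>PW. y \<odot> v = x"
proof -
  have "\<exists>v\<in>PW. \<forall>\<theta>\<in>FC. class_mult \<theta> (y \<theta>) (v \<theta>) = x \<theta>"
  proof (rule pw_lim_exists)
    show "\<exists>w. w \<noteq> [] \<and> class_mult \<theta> (y \<theta>) (\<theta> `` {w}) = x \<theta>" if \<theta>: "\<theta> \<in> FC" for \<theta>
      using ex[OF \<theta>] by (auto elim!: quotientE)
    fix \<theta> \<rho> w
    assume \<theta>: "\<theta> \<in> FC" and \<rho>: "\<rho> \<in> FC" and le: "\<theta> \<subseteq> \<rho>" and w: "w \<noteq> []"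
      and eq: "class_mult \<theta> (y \<theta>) (\<theta> `` {w}) = x \<theta>"
    obtain u where u: "u \<noteq> []" "u \<in> y \<theta>" "y \<theta> = \<theta> `` {u}" using pw_obtain[OF y \<theta>] .
    have "u @ w \<in> x \<theta>"
      using eq u w \<theta> self_in_class[OF \<theta>, of "u @ w"] by (simp add: class_mult_NE)
    then have "x \<rho> = \<rho> `` {u @ w}" using pw_class(2)[OF x \<rho>] pw_mono[OF x \<theta> \<rho> le] by blast
    moreover have "y \<rho> = \<rho> `` {u}" using pw_class(2)[OF y \<rho>] pw_mono[OF y \<theta> \<rho> le] u(2) by blast
    ultimately show "class_mult \<rho> (y \<rho>) (\<rho> `` {w}) = x \<rho>" using u(1) w \<rho> by (simp add: class_mult_NE)
  qed
  then obtain v where v: "v \<in> PW" "\<And>\<theta>. \<theta> \<in> FC \<Longrightarrow> class_mult \<theta> (y \<theta>) (v \<theta>) = x \<theta>" by blast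
  have "y \<odot> v = x" by (rule pw_eqI) (use v x y in \<open>auto simp: pw_mult_app\<close>)
  then show ?thesis using v(1) by blast
qed

lemma pw_right_divides:
  assumes x: "x \<in> PW" and y: "y \<in> PW"
    and ex: "\<And>\<theta>. \<theta> \<in> FC \<Longrightarrow> \<exists>C\<in>NE // \<theta>. class_mult \<theta> C (y \<theta>) = x \<theta>"
  shows "\<exists>v\<in>PW. v \<odot> y = x"
proof -
  have "\<exists>v\<in>PW. \<forall>\<theta>\<in>FC. class_mult \<theta> (v \<theta>) (y \<theta>) = x \<theta>"
  proof (rule pw_lim_exists)
    show "\<exists>w. w \<noteq> [] \<and> class_mult \<theta> (\<theta> `` {w}) (y \<theta>) = x \<theta>" if \<theta>: "\<theta> \<in> FC" for \<theta>
      using ex[OF \<theta>] by (auto elim!: quotientE)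
    fix \<theta> \<rho> w
    assume \<theta>: "\<theta> \<in> FC" and \<rho>: "\<rho> \<in> FC" and le: "\<theta> \<subseteq> \<rho>" and w: "w \<noteq> []"
      and eq: "class_mult \<theta> (\<theta> `` {w}) (y \<theta>) = x \<theta>"
    obtain u where u: "u \<noteq> []" "u \<in> y \<theta>" "y \<theta> = \<theta> `` {u}" using pw_obtain[OF y \<theta>] .
    have "w @ u \<in> x \<theta>"
      using eq u w \<theta> self_in_class[OF \<theta>, of "w @ u"] by (simp add: class_mult_NE)
    then have "x \<rho> = \<rho> `` {w @ u}" using pw_class(2)[OF x \<rho>] pw_mono[OF x \<theta> \<rho> le] by blast
    moreover have "y \<rho> = \<rho> `` {u}" using pw_class(2)[OF y \<rho>] pw_mono[OF y \<theta> \<rho> le] u(2) by blast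
    ultimately show "class_mult \<rho> (\<rho> `` {w}) (y \<rho>) = x \<rho>" using u(1) w \<rho> by (simp add: class_mult_NE)
  qed
  then obtain v where v: "v \<in> PW" "\<And>\<theta>. \<theta> \<in> FC \<Longrightarrow> class_mult \<theta> (v \<theta>) (y \<theta>) = x \<theta>" by blast
  have "v \<odot> y = x" by (rule pw_eqI) (use v x y in \<open>auto simp: pw_mult_app\<close>)
  then show ?thesis using v(1) by blast
qed

text \<open>The left cofactor is chosen first, subject to the existence of a right one in each
  quotient; one-sided divisibility then supplies the right cofactor.\<close>

lemma pw_divides:
  assumes x: "x \<in> PW" and y: "y \<in> PW"
    and ex: "\<And>\<theta>. \<theta> \<in> FC \<Longrightarrow>
      \<exists>C\<in>NE // \<theta>. \<exists>D\<in>NE // \<theta>. class_mult \<theta> (class_mult \<theta> C (y \<theta>)) D = x \<theta>"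
  shows "\<exists>u\<in>PW. \<exists>v\<in>PW. u \<odot> y \<odot> v = x"
proof -
  have "\<exists>u\<in>PW. \<forall>\<theta>\<in>FC. \<exists>D\<in>NE // \<theta>. class_mult \<theta> (class_mult \<theta> (u \<theta>) (y \<theta>)) D = x \<theta>"
  proof (rule pw_lim_exists)
    show "\<exists>w. w \<noteq> [] \<and> (\<exists>D\<in>NE // \<theta>. class_mult \<theta> (class_mult \<theta> (\<theta> `` {w}) (y \<theta>)) D = x \<theta>)" if \<theta>: "\<theta> \<in> FC" for \<theta>
    proof -
      obtain C D where CD: "C \<in> NE // \<theta>" "D \<in> NE // \<theta>" "class_mult \<theta> (class_mult \<theta> C (y \<theta>)) D = x \<theta>"
        using ex[OF \<theta>] by blast
      obtain w where "w \<in> NE" "C = \<theta> `` {w}" using CD(1) by (rule quotientE)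
      then show ?thesis using CD by auto
    qed
    fix \<theta> \<rho> w
    assume \<theta>: "\<theta> \<in> FC" and \<rho>: "\<rho> \<in> FC" and le: "\<theta> \<subseteq> \<rho>" and w: "w \<noteq> []"
      and "\<exists>D\<in>NE // \<theta>. class_mult \<theta> (class_mult \<theta> (\<theta> `` {w}) (y \<theta>)) D = x \<theta>"
    then obtain D where D: "D \<in> NE // \<theta>" "class_mult \<theta> (class_mult \<theta> (\<theta> `` {w}) (y \<theta>)) D = x \<theta>" by blast
    obtain v where v: "v \<in> NE" "D = \<theta> `` {v}" using D(1) by (rule quotientE)
    obtain u where u: "u \<noteq> []" "u \<in> y \<theta>" "y \<theta> = \<theta> `` {u}" using pw_obtain[OF y \<theta>] .
    have "w @ u @ v \<in> x \<theta>"
      using D(2)[symmetric] v u w \<theta> self_in_class[OF \<theta>, of "w @ u @ v"] by (simp add: class_mult_NE)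
    then have "x \<rho> = \<rho> `` {w @ u @ v}" using pw_class(2)[OF x \<rho>] pw_mono[OF x \<theta> \<rho> le] by blast
    moreover have "y \<rho> = \<rho> `` {u}" using pw_class(2)[OF y \<rho>] pw_mono[OF y \<theta> \<rho> le] u(2) by blast
    ultimately have "class_mult \<rho> (class_mult \<rho> (\<rho> `` {w}) (y \<rho>)) (\<rho> `` {v}) = x \<rho>"
      using u(1) w v \<rho> by (simp add: class_mult_NE)
    then show "\<exists>D\<in>NE // \<rho>. class_mult \<rho> (class_mult \<rho> (\<rho> `` {w}) (y \<rho>)) D = x \<rho>"
      using class_NE[of v \<rho>] v(1) by auto
  qed
  then obtain u where u: "u \<in> PW"
    "\<And>\<theta>. \<theta> \<in> FC \<Longrightarrow> \<exists>D\<in>NE // \<theta>. class_mult \<theta> (class_mult \<theta> (u \<theta>) (y \<theta>)) D = x \<theta>" by blast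
  have "\<exists>v\<in>PW. u \<odot> y \<odot> v = x"
    by (rule pw_left_divides) (use u x y in \<open>auto simp: pw_mult_app\<close>)
  then show ?thesis using u(1) by blast
qed

lemma pw_unitI:
  assumes x: "x \<in> PW" and e: "e \<in> PW" "e \<odot> e = e" "e \<odot> x = x" "x \<odot> e = x"
    and "\<And>\<theta>. \<theta> \<in> FC \<Longrightarrow> \<exists>C\<in>NE // \<theta>. class_mult \<theta> (x \<theta>) C = e \<theta>"
    and "\<And>\<theta>. \<theta> \<in> FC \<Longrightarrow> \<exists>C\<in>NE // \<theta>. class_mult \<theta> C (x \<theta>) = e \<theta>"
  shows "x \<in> carrier (unit_group PW pseudoword_mult e)"
proof -
  obtain a b where "a \<in> PW" "x \<odot> a = e" "b \<in> PW" "b \<odot> x = e"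
    using pw_left_divides[OF e(1) x assms(6)] pw_right_divides[OF e(1) x assms(7)] by blast
  then show ?thesis using pw.unit_groupI[OF x e(1)] e by blast
qed

subsection \<open>Factorizations\<close>

definition factorizations :: "(letter list \<times> letter list) set \<Rightarrow> letter list \<Rightarrow> (letter list set \<times> letter list set) set" where
  "factorizations \<theta> w = {(\<theta> `` {u}, \<theta> `` {v}) | u v. u \<noteq> [] \<and> v \<noteq> [] \<and> u @ v = w}"

definition factor_congruence :: "(letter list \<times> letter list) set \<Rightarrow> (letter list \<times> letter list) set" where
  "factor_congruence \<theta> = {(w, w'). w \<in> NE \<and> w' \<in> NE \<and>
     (\<theta> `` {w}, factorizations \<theta> w) = (\<theta> `` {w'}, factorizations \<theta> w')}"

text \<open>A cut of \<open>u @ v\<close> falls inside \<open>u\<close>, at the joint or inside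
  \<open>v\<close>. Hence the factorizations of a product depend only on the data of the factors,
  which makes \<open>factor_congruence \<theta>\<close> a congruence.\<close>

lemma factorizations_append:
  assumes \<theta>: "\<theta> \<in> FC" and "u \<noteq> []" "v \<noteq> []"
  shows "factorizations \<theta> (u @ v) =
    (\<lambda>(C, D). (C, class_mult \<theta> D (\<theta> `` {v}))) ` factorizations \<theta> u \<union> {(\<theta> `` {u}, \<theta> `` {v})} \<union>
    (\<lambda>(C, D). (class_mult \<theta> (\<theta> `` {u}) C, D)) ` factorizations \<theta> v" (is "_ = ?A \<union> _ \<union> ?B")
proof (intro equalityI subsetI)
  fix p assume "p \<in> factorizations \<theta> (u @ v)"
  then obtain s t where p: "p = (\<theta> `` {s}, \<theta> `` {t})" and st: "s \<noteq> []" "t \<noteq> []" "s @ t = u @ v"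
    by (auto simp: factorizations_def)
  have "(\<exists>r. s @ r = u \<and> t = r @ v) \<or> (\<exists>r. s = u @ r \<and> r @ t = v)"
    using st(3) by (auto simp: append_eq_append_conv2)
  then consider "s = u" "t = v" | r where "s @ r = u" "t = r @ v" "r \<noteq> []" | r where "s = u @ r" "r @ t = v" "r \<noteq> []"
    by (elim disjE exE conjE; case_tac "r = []") simp_all
  then show "p \<in> ?A \<union> {(\<theta> `` {u}, \<theta> `` {v})} \<union> ?B"
  proof cases
    case (2 r)
    then have a: "(\<theta> `` {s}, \<theta> `` {r}) \<in> factorizations \<theta> u" using st by (auto simp: factorizations_def)
    have "class_mult \<theta> (\<theta> `` {r}) (\<theta> `` {v}) = \<theta> `` {t}" using 2 assms by (simp add: class_mult_NE)
    then have "p \<in> ?A" unfolding p by (intro image_eqI[OF _ a]) simp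
    then show ?thesis by blast
  next
    case (3 r)
    then have a: "(\<theta> `` {r}, \<theta> `` {t}) \<in> factorizations \<theta> v" using st by (auto simp: factorizations_def)
    have "class_mult \<theta> (\<theta> `` {u}) (\<theta> `` {r}) = \<theta> `` {s}" using 3 assms by (simp add: class_mult_NE)
    then have "p \<in> ?B" unfolding p by (intro image_eqI[OF _ a]) simp
    then show ?thesis by blast
  qed (simp add: p)
next
  fix p assume "p \<in> ?A \<union> {(\<theta> `` {u}, \<theta> `` {v})} \<union> ?B"
  then consider "p \<in> ?A" | "p = (\<theta> `` {u}, \<theta> `` {v})" | "p \<in> ?B" by blast
  then show "p \<in> factorizations \<theta> (u @ v)"
  proof cases
    case 1
    then obtain s t where "s \<noteq> []" "t \<noteq> []" "s @ t = u" "p = (\<theta> `` {s}, class_mult \<theta> (\<theta> `` {t}) (\<theta> `` {v}))"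
      by (auto simp: factorizations_def)
    then show ?thesis unfolding factorizations_def using assms
      by (intro CollectI exI[of _ s] exI[of _ "t @ v"]) (auto simp: class_mult_NE)
  next
    case 2
    then show ?thesis unfolding factorizations_def using assms by blast
  next
    case 3
    then obtain s t where "s \<noteq> []" "t \<noteq> []" "s @ t = v" "p = (class_mult \<theta> (\<theta> `` {u}) (\<theta> `` {s}), \<theta> `` {t})"
      by (auto simp: factorizations_def)
    then show ?thesis unfolding factorizations_def using assms
      by (intro CollectI exI[of _ "u @ s"] exI[of _ t]) (auto simp: class_mult_NE)
  qed
qed

lemma factor_congruence_in: "\<theta> \<in> FC \<Longrightarrow> factor_congruence \<theta> \<in> FC"
  unfolding factor_congruence_def
proof (rule kernel_finite_congruence)
  assume \<theta>: "\<theta> \<in> FC"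
  let ?Q = "NE // \<theta>"
  have "(\<lambda>w. (\<theta> `` {w}, factorizations \<theta> w)) ` NE \<subseteq> ?Q \<times> Pow (?Q \<times> ?Q)"
    by (auto simp: factorizations_def intro!: quotientI)
  moreover have "finite (?Q \<times> Pow (?Q \<times> ?Q))" using finite_congruencesD(2)[OF \<theta>] by simp
  ultimately show "finite ((\<lambda>w. (\<theta> `` {w}, factorizations \<theta> w)) ` NE)" by (rule finite_subset)
  fix u u' v v'
  assume "u \<in> NE" "u' \<in> NE" "v \<in> NE" "v' \<in> NE"
    and "(\<theta> `` {u}, factorizations \<theta> u) = (\<theta> `` {u'}, factorizations \<theta> u')"
    and "(\<theta> `` {v}, factorizations \<theta> v) = (\<theta> `` {v'}, factorizations \<theta> v')"
  then show "(\<theta> `` {u @ v}, factorizations \<theta> (u @ v)) = (\<theta> `` {u' @ v'}, factorizations \<theta> (u' @ v'))"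
    using \<theta> by (simp add: factorizations_append class_mult_NE[symmetric])
qed simp

lemma factor_congruence_subset: "\<theta> \<in> FC \<Longrightarrow> factor_congruence \<theta> \<subseteq> \<theta>"
  by (auto simp: factor_congruence_def class_NE_eq_iff)

text \<open>This is openness of the multiplication: a word close enough to
  \<open>x \<odot> y\<close> splits into words close to \<open>x\<close> and to \<open>y\<close>.
  The finer congruence suffices because it remembers the classes of all factorizations.\<close>

lemma factor_congruence_split:
  assumes x: "x \<in> PW" and y: "y \<in> PW" and \<theta>: "\<theta> \<in> FC"
    and w: "w \<in> (x \<odot> y) (factor_congruence \<theta>)"
  obtains u v where "w = u @ v" "u \<in> x \<theta>" "v \<in> y \<theta>"
proof -
  let ?f = "factor_congruence \<theta>"
  note f = factor_congruence_in[OF \<theta>] and le = factor_congruence_subset[OF \<theta>]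
  obtain u0 where u0: "u0 \<noteq> []" "u0 \<in> x ?f" using pw_obtain[OF x f] by metis
  obtain v0 where v0: "v0 \<noteq> []" "v0 \<in> y ?f" using pw_obtain[OF y f] by metis
  have "u0 @ v0 \<in> (x \<odot> y) ?f" by (rule pw_mult_mem[OF x y f u0(2) v0(2)])
  then have "(x \<odot> y) ?f = ?f `` {u0 @ v0}" using pw_class(2)[OF _ f] pw.closed[OF x y] by blast
  then have "(u0 @ v0, w) \<in> ?f" using w by simp
  then have "factorizations \<theta> (u0 @ v0) = factorizations \<theta> w" by (simp add: factor_congruence_def)
  moreover have "(\<theta> `` {u0}, \<theta> `` {v0}) \<in> factorizations \<theta> (u0 @ v0)"
    using u0 v0 by (auto simp: factorizations_def)
  ultimately obtain u v where uv: "u \<noteq> []" "v \<noteq> []" "u @ v = w" "\<theta> `` {u0} = \<theta> `` {u}" "\<theta> `` {v0} = \<theta> `` {v}"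
    by (auto simp: factorizations_def)
  have "x \<theta> = \<theta> `` {u0}" "y \<theta> = \<theta> `` {v0}"
    using pw_class(2)[OF x \<theta>] pw_class(2)[OF y \<theta>] pw_mono[OF x f \<theta> le u0(2)] pw_mono[OF y f \<theta> le v0(2)] by simp_all
  then show thesis
    using that[of u v] uv self_in_class[OF \<theta>] by simp
qed

subsection \<open>Prefixes and suffixes\<close>

text \<open>Prefixes and suffixes of length \<open>N\<close>, the latter reversed. A word shorter
  than \<open>N\<close> is alone in its class, since it is its own prefix.\<close>

definition border_congruence :: "nat \<Rightarrow> (letter list \<times> letter list) set" where
  "border_congruence N = {(u, v). u \<in> NE \<and> v \<in> NE \<and>
     (take N u, take N (rev u)) = (take N v, take N (rev v))}"

lemma border_congruence_in: "border_congruence N \<in> FC"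
  unfolding border_congruence_def
proof (rule kernel_finite_congruence)
  have fin: "finite {w :: letter list. length w \<le> N}"
    using finite_lists_length_le[of "UNIV :: letter set" N] by simp
  have "(\<lambda>u. (take N u, take N (rev u))) ` NE \<subseteq> {w. length w \<le> N} \<times> {w. length w \<le> N}" by auto
  then show "finite ((\<lambda>u. (take N u, take N (rev u))) ` NE)"
    using fin by (meson finite_SigmaI finite_subset)
  have *: "take N (u @ v) = take N (take N u @ take N v)" for u v :: "letter list"
    by (cases "N \<le> length u") auto
  fix u u' v v' :: "letter list"
  assume "(take N u, take N (rev u)) = (take N u', take N (rev u'))"
    "(take N v, take N (rev v)) = (take N v', take N (rev v'))"
  then show "(take N (u @ v), take N (rev (u @ v))) = (take N (u' @ v'), take N (rev (u' @ v')))"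
    using *[of u v] *[of u' v'] *[of "rev v" "rev u"] *[of "rev v'" "rev u'"] by (simp del: take_append)
qed simp

text \<open>With a border longer than the word \<open>w\<close>, its class is a singleton, yet it
  would contain a longer word ending in \<open>w\<close>.\<close>

lemma word_embedding_not_left_fixed:
  assumes y: "y \<in> PW" and x: "x \<in> PW" and eq: "y \<odot> x = x"
  shows "x \<notin> word_embedding ` NE"
proof
  assume "x \<in> word_embedding ` NE"
  then obtain w where w: "w \<noteq> []" "x = word_embedding w" by auto
  let ?N = "Suc (length w)" and ?\<theta> = "border_congruence (Suc (length w))"
  note \<theta> = border_congruence_in[of ?N]
  have xw: "x ?\<theta> = ?\<theta> `` {w}" using w \<theta> by (simp add: word_embedding_def lim_word_def)
  then have "w \<in> x ?\<theta>" using self_in_class[OF \<theta>] w by simp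
  moreover obtain v where v: "v \<noteq> []" "v \<in> y ?\<theta>" using pw_obtain[OF y \<theta>] by metis
  ultimately have "v @ w \<in> x ?\<theta>" using pw_mult_mem[OF y x \<theta>] eq by metis
  then have "(w, v @ w) \<in> ?\<theta>" using xw by simp
  then have "take ?N w = take ?N (v @ w)" unfolding border_congruence_def by simp
  moreover have "?N \<le> length (v @ w)" using v(1) by (cases v) auto
  then have "length (take ?N (v @ w)) = ?N" by (simp only: length_take min_absorb2)
  ultimately have "length (take ?N w) = ?N" by (simp only:)
  then show False by simp
qed

text \<open>Squaring words within the class of \<open>e\<close> produces arbitrarily long ones, and
  these have a prefix of length \<open>N\<close>.\<close>

lemma idempotent_long:
  assumes e: "e \<in> PW" "e \<odot> e = e" and w: "w \<in> e (border_congruence N)"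
  shows "N \<le> length w"
proof -
  let ?\<theta> = "border_congruence N"
  note \<theta> = border_congruence_in[of N]
  have "\<exists>u. u \<in> e ?\<theta> \<and> k \<le> length u" for k
  proof (induction k)
    case 0
    then show ?case using w by blast
  next
    case (Suc k)
    then obtain u where u: "u \<in> e ?\<theta>" "k \<le> length u" by blast
    then have "u @ u \<in> e ?\<theta>" using pw_mult_mem[OF e(1) e(1) \<theta>] e(2) by metis
    moreover have "u \<noteq> []" using pw_class(1)[OF e(1) \<theta> u(1)] .
    then have "Suc k \<le> length (u @ u)" using u(2) by (cases u) auto
    ultimately show ?case by blast
  qed
  then obtain u where u: "u \<in> e ?\<theta>" "N \<le> length u" by blast
  then have "(w, u) \<in> ?\<theta>" using pw_class(2)[OF e(1) \<theta> w] by simp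
  then have "take N w = take N u" unfolding border_congruence_def by simp
  then have "length (take N w) = N" using u(2) by simp
  then show ?thesis by simp
qed

section \<open>The closure of the language\<close>

definition TMC :: "letter pseudoword set" where
  "TMC = {x \<in> PW. \<forall>\<theta>\<in>FC. \<exists>w\<in>TML. w \<in> x \<theta>}"

lemma J_class_eq: "subst_J_class thue_morse = TMC - word_embedding ` TML"
  unfolding subst_J_class_def pseudoword_topology_def word_embedding_def TMC_def pseudowords_def
  using nonempty.closure_of_lim_word[OF TML_nonempty] by simp

lemma TMC_split:
  assumes x: "x \<in> PW" and y: "y \<in> PW" and xy: "x \<odot> y \<in> TMC" and \<theta>: "\<theta> \<in> FC"
  obtains u v where "u \<in> x \<theta>" "v \<in> y \<theta>" "u @ v \<in> TML"
proof -
  obtain w where "w \<in> TML" "w \<in> (x \<odot> y) (factor_congruence \<theta>)"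
    using xy factor_congruence_in[OF \<theta>] unfolding TMC_def by blast
  then show thesis using factor_congruence_split[OF x y \<theta>] that by metis
qed

text \<open>The language is closed under nonempty factors; openness of the multiplication passes
  this on to its closure.\<close>

lemma TMC_factor:
  assumes x: "x \<in> PW" and y: "y \<in> PW" and xy: "x \<odot> y \<in> TMC"
  shows "x \<in> TMC" "y \<in> TMC"
proof -
  have *: "\<exists>u\<in>TML. u \<in> x \<theta>" "\<exists>v\<in>TML. v \<in> y \<theta>" if \<theta>: "\<theta> \<in> FC" for \<theta>
  proof -
    obtain u v where uv: "u \<in> x \<theta>" "v \<in> y \<theta>" "u @ v \<in> TML" using TMC_split[OF x y xy \<theta>] .
    then have "u \<noteq> []" "v \<noteq> []" using pw_class(1)[OF x \<theta>] pw_class(1)[OF y \<theta>] by blast+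
    then have "u \<in> TML" "v \<in> TML" using TML_factor[of "[]" u v] TML_factor[of u v "[]"] uv(3) by simp_all
    then show "\<exists>u\<in>TML. u \<in> x \<theta>" "\<exists>v\<in>TML. v \<in> y \<theta>" using uv by blast+
  qed
  show "x \<in> TMC" "y \<in> TMC" using x y * unfolding TMC_def by blast+
qed

section \<open>The operator \<tau>^omega and the R- and L-classes of its values\<close>

section \<open>The limits of the iterated substitution\<close>

text \<open>The limit of \<tau>^(n!)(w), read off in each finite quotient at an idempotent
  exponent.\<close>

definition omega :: "letter list \<Rightarrow> letter pseudoword" where
  "omega w = (\<lambda>\<theta>\<in>FC. \<theta> `` {(\<tau> ^^ (SOME n. idem_exponent \<theta> n)) w})"

lemma \<tau>_funpow_neq_Nil [simp]: "(\<tau> ^^ n) w = [] \<longleftrightarrow> w = []"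
  using \<tau>_funpow_nonempty[of n w] by blast

lemma omega_class:
  assumes \<theta>: "\<theta> \<in> FC" and n: "idem_exponent \<theta> n" and w: "w \<noteq> []"
  shows "omega w \<theta> = \<theta> `` {(\<tau> ^^ n) w}"
proof -
  have "idem_exponent \<theta> (SOME n. idem_exponent \<theta> n)" using n by (rule someI)
  then have "((\<tau> ^^ (SOME n. idem_exponent \<theta> n)) w, (\<tau> ^^ n) w) \<in> \<theta>"
    using idem_exponent_unique[OF \<theta> _ n] w by simp
  then show ?thesis using \<theta> w by (simp add: omega_def class_NE_eq_iff)
qed

lemma omega_in [simp]: "w \<noteq> [] \<Longrightarrow> omega w \<in> PW"
proof -
  assume w: "w \<noteq> []"
  have 1: "omega w \<theta> \<in> NE // \<theta>" if \<theta>: "\<theta> \<in> FC" for \<theta>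
    using w \<theta> by (simp add: omega_def quotientI)
  have 2: "omega w \<theta> \<subseteq> omega w \<rho>" if \<theta>: "\<theta> \<in> FC" and \<rho>: "\<rho> \<in> FC" and le: "\<theta> \<subseteq> \<rho>" for \<theta> \<rho>
  proof -
    obtain n where n: "idem_exponent \<theta> n" using idem_exponent_exists[OF \<theta>, of 1] by auto
    then show ?thesis
      using omega_class[OF \<theta> n w] omega_class[OF \<rho> idem_exponent_mono[OF n le] w] le by auto
  qed
  have 3: "omega w \<theta> = undefined" if "\<theta> \<notin> FC" for \<theta> using that by (simp add: omega_def)
  show ?thesis unfolding pseudowords_def lim_carrier_def
    by (intro CollectI conjI PiE_I ballI impI) (use 1 2 3 in blast)+
qed

lemma omega_append: "u \<noteq> [] \<Longrightarrow> v \<noteq> [] \<Longrightarrow> omega (u @ v) = omega u \<odot> omega v"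
proof (rule pw_eqI)
  fix \<theta> assume u: "u \<noteq> []" and v: "v \<noteq> []" and \<theta>: "\<theta> \<in> FC"
  obtain n where n: "idem_exponent \<theta> n" using idem_exponent_exists[OF \<theta>, of 1] by auto
  show "omega (u @ v) \<theta> = (omega u \<odot> omega v) \<theta>"
    using u v \<theta> by (simp add: omega_class[OF \<theta> n] pw_mult_app class_mult_NE subst_funpow_append)
qed (auto intro: pw.closed)

lemma omega_\<tau>_funpow:
  assumes \<theta>: "\<theta> \<in> FC" and n: "idem_exponent \<theta> n" and w: "w \<noteq> []"
  shows "omega ((\<tau> ^^ n) w) \<theta> = omega w \<theta>"
  using n w \<theta> by (simp add: omega_class[OF \<theta> n] class_NE_eq_iff idem_exponent_def)

abbreviation \<alpha> :: "letter pseudoword" where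
  "\<alpha> \<equiv> omega [LA]"

text \<open>
  Every two-letter word is an inner factor of the iterated images of every letter.  By stability, in
  a finite quotient right multiplication by letters cannot leave an R-class.
\<close>

lemma omega_letter_stable:
  assumes \<theta>: "\<theta> \<in> FC"
  shows "\<exists>r\<in>NE // \<theta>. omega [c] \<theta> = class_mult \<theta> (omega [c, d] \<theta>) r"
    and "\<exists>r\<in>NE // \<theta>. omega [d] \<theta> = class_mult \<theta> r (omega [c, d] \<theta>)"
proof -
  interpret q: finite_semigroup_on "NE // \<theta>" "class_mult \<theta>" using \<theta> by (rule finite_semigroup_NE)
  obtain N where N: "\<And>k x. k \<ge> N \<Longrightarrow> \<exists>u v. u \<noteq> [] \<and> v \<noteq> [] \<and> (\<tau> ^^ k) [x] = u @ [c, d] @ v"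
    using TML_inner_factor[OF TML_pair] by meson
  obtain n where n: "idem_exponent \<theta> n" "n \<ge> N" using idem_exponent_exists[OF \<theta>, of 1] by auto
  note app = pw_mult_app[OF \<theta>] and mem = pw_coord[OF omega_in \<theta>]
  have cd: "omega [c, d] \<theta> = class_mult \<theta> (omega [c] \<theta>) (omega [d] \<theta>)"
    using omega_append[of "[c]" "[d]"] by (simp add: app)
  \<comment> \<open>At an idempotent exponent that is large enough, \<open>omega [x]\<close> agrees
    modulo \<open>\<theta>\<close> with the image of a word having cd as an inner factor.\<close>
  have fac: "\<exists>u v. u \<noteq> [] \<and> v \<noteq> [] \<and> omega [x] \<theta> =
    class_mult \<theta> (omega u \<theta>) (class_mult \<theta> (class_mult \<theta> (omega [c] \<theta>) (omega [d] \<theta>)) (omega v \<theta>))" for x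
  proof -
    obtain u v where uv: "u \<noteq> []" "v \<noteq> []" "(\<tau> ^^ n) [x] = u @ [c, d] @ v" using N[OF n(2)] by blast
    have "omega [x] \<theta> = omega (u @ [c, d] @ v) \<theta>"
      using omega_\<tau>_funpow[OF \<theta> n(1), of "[x]"] uv(3) by simp
    also have "\<dots> = class_mult \<theta> (omega u \<theta>) (class_mult \<theta> (omega [c, d] \<theta>) (omega v \<theta>))"
      using uv(1,2) omega_append[of u "[c, d] @ v"] omega_append[of "[c, d]" v] by (simp add: app)
    finally show ?thesis using uv cd by auto
  qed
  obtain u v where uv: "u \<noteq> []" "v \<noteq> []" "omega [c] \<theta> =
    class_mult \<theta> (omega u \<theta>) (class_mult \<theta> (class_mult \<theta> (omega [c] \<theta>) (omega [d] \<theta>)) (omega v \<theta>))"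
    using fac[of c] by blast
  have "omega [c] \<theta> = class_mult \<theta> (omega u \<theta>) (class_mult \<theta> (omega [c] \<theta>) (class_mult \<theta> (omega [d] \<theta>) (omega v \<theta>)))"
    using uv(3) q.assoc[OF mem[of "[c]"] mem[of "[d]"] mem[OF uv(2)]] by simp
  then obtain r where r: "r \<in> NE // \<theta>"
    "omega [c] \<theta> = class_mult \<theta> (class_mult \<theta> (omega [c] \<theta>) (class_mult \<theta> (omega [d] \<theta>) (omega v \<theta>))) r"
    using q.stable_right[OF mem[of "[c]"] mem[OF uv(1)] q.closed[OF mem[of "[d]"] mem[OF uv(2)]]] by auto
  then show "\<exists>r\<in>NE // \<theta>. omega [c] \<theta> = class_mult \<theta> (omega [c, d] \<theta>) r"
    using mem[of "[c]"] mem[of "[d]"] mem[OF uv(2)] unfolding cd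
    by (intro bexI[of _ "class_mult \<theta> (omega v \<theta>) r"]) (simp_all add: q.assoc)
  obtain u v where uv: "u \<noteq> []" "v \<noteq> []" "omega [d] \<theta> =
    class_mult \<theta> (omega u \<theta>) (class_mult \<theta> (class_mult \<theta> (omega [c] \<theta>) (omega [d] \<theta>)) (omega v \<theta>))"
    using fac[of d] by blast
  have "omega [d] \<theta> = class_mult \<theta> (class_mult \<theta> (class_mult \<theta> (omega u \<theta>) (omega [c] \<theta>)) (omega [d] \<theta>)) (omega v \<theta>)"
    using mem[of "[c]"] mem[of "[d]"] mem[OF uv(2)] mem[OF uv(1)] by (subst uv(3)) (simp add: q.assoc)
  then obtain r where r: "r \<in> NE // \<theta>"
    "omega [d] \<theta> = class_mult \<theta> r (class_mult \<theta> (class_mult \<theta> (omega u \<theta>) (omega [c] \<theta>)) (omega [d] \<theta>))"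
    using q.stable_left[OF mem[of "[d]"] mem[OF uv(2)] q.closed[OF mem[OF uv(1)] mem[of "[c]"]]] by auto
  then show "\<exists>r\<in>NE // \<theta>. omega [d] \<theta> = class_mult \<theta> r (omega [c, d] \<theta>)"
    using mem[of "[c]"] mem[of "[d]"] mem[OF uv(1)] unfolding cd
    by (intro bexI[of _ "class_mult \<theta> r (omega u \<theta>)"]) (simp_all add: q.assoc)
qed

text \<open>Modulo \<open>\<theta>\<close> the image of a word stays in the R-class of the image of
  its first letter: each further letter can be undone on the right.\<close>

lemma omega_Cons_right:
  assumes \<theta>: "\<theta> \<in> FC" and w: "w \<noteq> []"
  shows "\<exists>r\<in>NE // \<theta>. omega [c] \<theta> = class_mult \<theta> (omega (c # w) \<theta>) r"
  using w
proof (induction w arbitrary: c rule: list_nonempty_induct)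
  case (single d)
  then show ?case using omega_letter_stable(1)[OF \<theta>] by simp
next
  case (cons d w)
  interpret q: finite_semigroup_on "NE // \<theta>" "class_mult \<theta>" using \<theta> by (rule finite_semigroup_NE)
  note app = pw_mult_app[OF \<theta>] and mem = pw_coord[OF omega_in \<theta>]
  obtain r s where r: "r \<in> NE // \<theta>" "omega [c] \<theta> = class_mult \<theta> (omega [c, d] \<theta>) r"
    and s: "s \<in> NE // \<theta>" "omega [d] \<theta> = class_mult \<theta> (omega (d # w) \<theta>) s"
    using omega_letter_stable(1)[OF \<theta>] cons.IH by blast
  have cd: "omega [c, d] \<theta> = class_mult \<theta> (omega [c] \<theta>) (omega [d] \<theta>)"
    and cdw: "omega (c # d # w) \<theta> = class_mult \<theta> (omega [c] \<theta>) (omega (d # w) \<theta>)"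
    using omega_append[of "[c]" "[d]"] omega_append[of "[c]" "d # w"] by (simp_all add: app)
  have "omega [c] \<theta> = class_mult \<theta> (class_mult \<theta> (omega [c] \<theta>) (class_mult \<theta> (omega (d # w) \<theta>) s)) r"
    using r(2) unfolding cd s(2)[symmetric] .
  also have "\<dots> = class_mult \<theta> (omega (c # d # w) \<theta>) (class_mult \<theta> s r)"
    unfolding cdw using r(1) s(1) mem[of "[c]"] mem[of "d # w"] by (simp add: q.assoc)
  finally show ?case using r(1) s(1) by blast
qed

lemma omega_snoc_left:
  assumes \<theta>: "\<theta> \<in> FC" and w: "w \<noteq> []"
  shows "\<exists>r\<in>NE // \<theta>. omega [c] \<theta> = class_mult \<theta> r (omega (w @ [c]) \<theta>)"
  using w
proof (induction w arbitrary: c rule: rev_nonempty_induct)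
  case (single d)
  then show ?case using omega_letter_stable(2)[OF \<theta>] by simp
next
  case (snoc d w)
  interpret q: finite_semigroup_on "NE // \<theta>" "class_mult \<theta>" using \<theta> by (rule finite_semigroup_NE)
  note app = pw_mult_app[OF \<theta>] and mem = pw_coord[OF omega_in \<theta>]
  obtain r s where r: "r \<in> NE // \<theta>" "omega [c] \<theta> = class_mult \<theta> r (omega [d, c] \<theta>)"
    and s: "s \<in> NE // \<theta>" "omega [d] \<theta> = class_mult \<theta> s (omega (w @ [d]) \<theta>)"
    using omega_letter_stable(2)[OF \<theta>] snoc.IH by blast
  have dc: "omega [d, c] \<theta> = class_mult \<theta> (omega [d] \<theta>) (omega [c] \<theta>)"
    and wdc: "omega ((w @ [d]) @ [c]) \<theta> = class_mult \<theta> (omega (w @ [d]) \<theta>) (omega [c] \<theta>)"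
    using omega_append[of "[d]" "[c]"] omega_append[of "w @ [d]" "[c]"] by (simp_all add: app)
  have "omega [c] \<theta> = class_mult \<theta> r (class_mult \<theta> (class_mult \<theta> s (omega (w @ [d]) \<theta>)) (omega [c] \<theta>))"
    using r(2) unfolding dc s(2)[symmetric] .
  also have "\<dots> = class_mult \<theta> (class_mult \<theta> r s) (omega ((w @ [d]) @ [c]) \<theta>)"
    unfolding wdc using r(1) s(1) mem[of "[c]"] mem[of "w @ [d]"] by (simp add: q.assoc)
  finally show ?case using r(1) s(1) by blast
qed

section \<open>The unit group at \<open>e0\<close> and the elements \<open>E w\<close> in it\<close>

section \<open>A maximal subgroup\<close>

text \<open>By stability \<open>\<alpha>\<close> is a left multiple of its square in every finite
  quotient, hence lies in a subgroup there. Compactness assembles the identities of these subgroups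
  into one pseudoword.\<close>

lemma idempotent_exists:
  "\<exists>e\<in>PW. e \<odot> e = e \<and> e \<odot> \<alpha> = \<alpha> \<and> \<alpha> \<odot> e = \<alpha> \<and>
    (\<forall>\<theta>\<in>FC. \<exists>t\<in>NE // \<theta>. class_mult \<theta> (\<alpha> \<theta>) t = e \<theta> \<and> class_mult \<theta> t (\<alpha> \<theta>) = e \<theta>)"
proof -
  let ?R = "\<lambda>\<theta> C. class_mult \<theta> C C = C \<and> class_mult \<theta> C (\<alpha> \<theta>) = \<alpha> \<theta> \<and> class_mult \<theta> (\<alpha> \<theta>) C = \<alpha> \<theta> \<and>
    (\<exists>v. v \<noteq> [] \<and> class_mult \<theta> (\<alpha> \<theta>) (\<theta> `` {v}) = C \<and> class_mult \<theta> (\<theta> `` {v}) (\<alpha> \<theta>) = C)"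
  have "\<exists>e\<in>PW. \<forall>\<theta>\<in>FC. ?R \<theta> (e \<theta>)"
  proof (rule pw_lim_exists)
    fix \<theta> assume \<theta>: "\<theta> \<in> FC"
    interpret q: finite_semigroup_on "NE // \<theta>" "class_mult \<theta>" using \<theta> by (rule finite_semigroup_NE)
    have aa: "omega [LA, LA] \<theta> = class_mult \<theta> (\<alpha> \<theta>) (\<alpha> \<theta>)"
      using omega_append[of "[LA]" "[LA]"] by (simp add: pw_mult_app[OF \<theta>])
    obtain r where r: "r \<in> NE // \<theta>" "\<alpha> \<theta> = class_mult \<theta> r (class_mult \<theta> (\<alpha> \<theta>) (\<alpha> \<theta>))"
      using omega_letter_stable(2)[OF \<theta>, of LA LA] unfolding aa by blast
    obtain e t where et: "e \<in> NE // \<theta>" "t \<in> NE // \<theta>" "class_mult \<theta> e e = e"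
      "class_mult \<theta> e (\<alpha> \<theta>) = \<alpha> \<theta>" "class_mult \<theta> (\<alpha> \<theta>) e = \<alpha> \<theta>"
      "class_mult \<theta> (\<alpha> \<theta>) t = e" "class_mult \<theta> t (\<alpha> \<theta>) = e"
      using q.group_element[OF pw_coord[OF omega_in \<theta>] r] by blast
    obtain w where w: "w \<in> NE" "e = \<theta> `` {w}" using et(1) by (rule quotientE)
    obtain v where v: "v \<in> NE" "t = \<theta> `` {v}" using et(2) by (rule quotientE)
    have "?R \<theta> (\<theta> `` {w})" using et v unfolding w(2)[symmetric] by (intro conjI exI[of _ v]) simp_all
    then show "\<exists>w. w \<noteq> [] \<and> ?R \<theta> (\<theta> `` {w})" using w(1) by (intro exI[of _ w]) simp
  next
    fix \<theta> \<rho> w assume \<theta>: "\<theta> \<in> FC" and \<rho>: "\<rho> \<in> FC" and le: "\<theta> \<subseteq> \<rho>" and w: "w \<noteq> []"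
      and R: "?R \<theta> (\<theta> `` {w})"
    obtain a where a: "a \<noteq> []" "a \<in> \<alpha> \<theta>" "\<alpha> \<theta> = \<theta> `` {a}" using pw_obtain[OF omega_in \<theta>, of "[LA]"] by blast
    have a': "\<alpha> \<rho> = \<rho> `` {a}"
      using pw_class(2)[OF omega_in \<rho> pw_mono[OF omega_in \<theta> \<rho> le a(2)]] by simp
    obtain v where v: "v \<noteq> []" "class_mult \<theta> (\<alpha> \<theta>) (\<theta> `` {v}) = \<theta> `` {w}"
      "class_mult \<theta> (\<theta> `` {v}) (\<alpha> \<theta>) = \<theta> `` {w}" using R by blast
    \<comment> \<open>Rewritten as congruences between words, the conditions pass to the coarser
      \<open>\<rho>\<close>.\<close>
    have t: "\<theta> `` {w @ w} = \<theta> `` {w}" "\<theta> `` {w @ a} = \<theta> `` {a}" "\<theta> `` {a @ w} = \<theta> `` {a}"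
      "\<theta> `` {a @ v} = \<theta> `` {w}" "\<theta> `` {v @ a} = \<theta> `` {w}"
      using R v a(1) w unfolding a(3) by (simp_all add: class_mult_NE[OF \<theta>])
    note m = class_NE_mono[OF \<theta> \<rho> le]
    have "\<rho> `` {w @ w} = \<rho> `` {w}" by (rule m[OF _ _ t(1)]) (use w in simp_all)
    moreover have "\<rho> `` {w @ a} = \<rho> `` {a}" by (rule m[OF _ _ t(2)]) (use w a(1) in simp_all)
    moreover have "\<rho> `` {a @ w} = \<rho> `` {a}" by (rule m[OF _ _ t(3)]) (use w a(1) in simp_all)
    moreover have "\<rho> `` {a @ v} = \<rho> `` {w}" by (rule m[OF _ _ t(4)]) (use w a(1) in simp_all)
    moreover have "\<rho> `` {v @ a} = \<rho> `` {w}" by (rule m[OF _ _ t(5)]) (use w a(1) in simp_all)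
    ultimately show "?R \<rho> (\<rho> `` {w})"
      unfolding a' class_mult_NE[OF \<rho> w w] class_mult_NE[OF \<rho> w a(1)] class_mult_NE[OF \<rho> a(1) w]
      using class_mult_NE[OF \<rho> v(1) a(1)] class_mult_NE[OF \<rho> a(1) v(1)] v(1)
      by (intro conjI exI[of _ v]) (simp_all only: not_False_eq_True)
  qed
  then obtain e where e: "e \<in> PW" and "\<forall>\<theta>\<in>FC. ?R \<theta> (e \<theta>)" by (rule bexE)
  note R = bspec[OF this(2)]
  have c1: "(e \<odot> e) \<theta> = e \<theta>" if "\<theta> \<in> FC" for \<theta>
    unfolding pw_mult_app[OF that] by (rule R[OF that, THEN conjunct1])
  have c2: "(e \<odot> \<alpha>) \<theta> = \<alpha> \<theta>" if "\<theta> \<in> FC" for \<theta>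
    unfolding pw_mult_app[OF that] by (rule R[OF that, THEN conjunct2, THEN conjunct1])
  have c3: "(\<alpha> \<odot> e) \<theta> = \<alpha> \<theta>" if "\<theta> \<in> FC" for \<theta>
    unfolding pw_mult_app[OF that] by (rule R[OF that, THEN conjunct2, THEN conjunct2, THEN conjunct1])
  have "e \<odot> e = e" by (rule pw_eqI[OF _ _ c1]) (simp_all add: e pw.closed)
  moreover have "e \<odot> \<alpha> = \<alpha>" by (rule pw_eqI[OF _ _ c2]) (simp_all add: e pw.closed)
  moreover have "\<alpha> \<odot> e = \<alpha>" by (rule pw_eqI[OF _ _ c3]) (simp_all add: e pw.closed)
  moreover have "\<exists>t\<in>NE // \<theta>. class_mult \<theta> (\<alpha> \<theta>) t = e \<theta> \<and> class_mult \<theta> t (\<alpha> \<theta>) = e \<theta>" if \<theta>: "\<theta> \<in> FC" for \<theta>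
  proof -
    obtain v where "v \<noteq> []" "class_mult \<theta> (\<alpha> \<theta>) (\<theta> `` {v}) = e \<theta>" "class_mult \<theta> (\<theta> `` {v}) (\<alpha> \<theta>) = e \<theta>"
      using R[OF \<theta>, THEN conjunct2, THEN conjunct2, THEN conjunct2] by (elim exE conjE)
    then show ?thesis using class_NE[of v \<theta>] by (intro bexI[of _ "\<theta> `` {v}"] conjI)
  qed
  ultimately show ?thesis using e by blast
qed

definition \<alpha>_idempotent :: "letter pseudoword \<Rightarrow> bool" where
  "\<alpha>_idempotent e \<longleftrightarrow> e \<in> PW \<and> e \<odot> e = e \<and> e \<odot> \<alpha> = \<alpha> \<and> \<alpha> \<odot> e = \<alpha> \<and>
    (\<forall>\<theta>\<in>FC. \<exists>t\<in>NE // \<theta>. class_mult \<theta> (\<alpha> \<theta>) t = e \<theta> \<and> class_mult \<theta> t (\<alpha> \<theta>) = e \<theta>)"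

definition e0 :: "letter pseudoword" where
  "e0 = (SOME e. \<alpha>_idempotent e)"

lemma \<alpha>_idempotent_e0: "\<alpha>_idempotent e0"
proof -
  have "\<exists>e. \<alpha>_idempotent e" using idempotent_exists unfolding \<alpha>_idempotent_def by blast
  then show ?thesis unfolding e0_def by (rule someI_ex)
qed

lemma e0: "e0 \<in> PW" "e0 \<odot> e0 = e0" "e0 \<odot> \<alpha> = \<alpha>" "\<alpha> \<odot> e0 = \<alpha>"
  and e0_\<alpha>: "\<theta> \<in> FC \<Longrightarrow> \<exists>t\<in>NE // \<theta>. class_mult \<theta> (\<alpha> \<theta>) t = e0 \<theta> \<and> class_mult \<theta> t (\<alpha> \<theta>) = e0 \<theta>"
  using \<alpha>_idempotent_e0 unfolding \<alpha>_idempotent_def by blast+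

abbreviation G0 :: "letter pseudoword monoid" where
  "G0 \<equiv> unit_group PW pseudoword_mult e0"

lemma group_G0: "group G0"
  by (rule pw.group_unit_group[OF e0(1,2)])

lemma G0D: "x \<in> carrier G0 \<Longrightarrow> x \<in> PW \<and> e0 \<odot> x = x \<and> x \<odot> e0 = x"
  by (simp add: unit_group_def)

lemma G0_mult [simp]: "x \<otimes>\<^bsub>G0\<^esub> y = x \<odot> y" and G0_one [simp]: "\<one>\<^bsub>G0\<^esub> = e0"
  by (simp_all add: unit_group_def)

text \<open>Multiplying by \<open>e0\<close> on both sides puts \<open>omega w\<close> in the local
  monoid at \<open>e0\<close>, also when \<open>w\<close> begins or ends with
  \<open>LB\<close>.\<close>

definition E :: "letter list \<Rightarrow> letter pseudoword" where
  "E w = e0 \<odot> omega w \<odot> e0"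

lemma E_in_PW: "w \<noteq> [] \<Longrightarrow> E w \<in> PW"
  by (simp add: E_def e0(1) pw.closed)

lemma e0_absorb: "x \<in> PW \<Longrightarrow> e0 \<odot> (e0 \<odot> x) = e0 \<odot> x" "x \<in> PW \<Longrightarrow> \<alpha> \<odot> (e0 \<odot> x) = \<alpha> \<odot> x"
  "x \<in> PW \<Longrightarrow> e0 \<odot> (\<alpha> \<odot> x) = \<alpha> \<odot> x"
  using pw.assoc[of e0 e0 x] pw.assoc[of \<alpha> e0 x] pw.assoc[of e0 \<alpha> x] e0 by simp_all

text \<open>In each finite quotient the value of \<open>omega\<close> at
  \<open>LA # w @ [LA]\<close> divides \<open>\<alpha>\<close> on both sides by stability. As
  \<open>\<alpha>\<close> is a unit at \<open>e0\<close>, its two occurrences at the ends can be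
  turned into \<open>e0\<close>.\<close>

lemma E_in_G0:
  assumes w: "w \<noteq> []"
  shows "E w \<in> carrier G0"
proof (rule pw_unitI)
  show "E w \<in> PW" "e0 \<in> PW" "e0 \<odot> e0 = e0" using E_in_PW w e0 by simp_all
  show "e0 \<odot> E w = E w" "E w \<odot> e0 = E w"
    using w by (simp_all add: E_def pw.assoc e0(1,2) e0_absorb pw.closed)
next
  fix \<theta> assume \<theta>: "\<theta> \<in> FC"
  interpret q: finite_semigroup_on "NE // \<theta>" "class_mult \<theta>" using \<theta> by (rule finite_semigroup_NE)
  note app = pw_mult_app[OF \<theta>]
  let ?a = "\<alpha> \<theta>" and ?w = "omega w \<theta>" and ?e = "e0 \<theta>"
  have mem: "?a \<in> NE // \<theta>" "?w \<in> NE // \<theta>" "?e \<in> NE // \<theta>" using pw_coord[OF _ \<theta>] w e0(1) by simp_all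
  obtain t where t: "t \<in> NE // \<theta>" "class_mult \<theta> ?a t = ?e" "class_mult \<theta> t ?a = ?e" using e0_\<alpha>[OF \<theta>] by blast
  have ea: "class_mult \<theta> ?e ?a = ?a" "class_mult \<theta> ?a ?e = ?a" using e0(3,4) app by metis+
  have awa: "omega (LA # w @ [LA]) \<theta> = class_mult \<theta> (class_mult \<theta> ?a ?w) ?a"
    using omega_append[of "[LA]" "w @ [LA]"] omega_append[of w "[LA]"] w mem by (simp add: app q.assoc)
  have Ew: "E w \<theta> = class_mult \<theta> (class_mult \<theta> ?e ?w) ?e" by (simp add: E_def app)
  obtain r where r: "r \<in> NE // \<theta>" "?a = class_mult \<theta> (class_mult \<theta> (class_mult \<theta> ?a ?w) ?a) r"
    using omega_Cons_right[OF \<theta>, of "w @ [LA]" LA] awa by auto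
  have "?e = class_mult \<theta> t (class_mult \<theta> (class_mult \<theta> (class_mult \<theta> ?a ?w) ?a) r)" using t(3) r(2) by simp
  also have "\<dots> = class_mult \<theta> (class_mult \<theta> (class_mult \<theta> (class_mult \<theta> t ?a) ?w) ?a) r"
    using mem t(1) r(1) by (simp add: q.assoc)
  also have "\<dots> = class_mult \<theta> (class_mult \<theta> (class_mult \<theta> ?e ?w) (class_mult \<theta> ?e ?a)) r"
    unfolding t(3) ea ..
  also have "\<dots> = class_mult \<theta> (E w \<theta>) (class_mult \<theta> ?a r)"
    unfolding Ew using mem r(1) by (simp add: q.assoc)
  finally have "class_mult \<theta> (E w \<theta>) (class_mult \<theta> ?a r) = ?e" ..
  then show "\<exists>C\<in>NE // \<theta>. class_mult \<theta> (E w \<theta>) C = ?e" using mem r(1) by blast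
  obtain r where r: "r \<in> NE // \<theta>" "?a = class_mult \<theta> r (class_mult \<theta> (class_mult \<theta> ?a ?w) ?a)"
    using omega_snoc_left[OF \<theta>, of "LA # w" LA] awa by auto
  have "?e = class_mult \<theta> (class_mult \<theta> r (class_mult \<theta> (class_mult \<theta> ?a ?w) ?a)) t" using t(2) r(2) by simp
  also have "\<dots> = class_mult \<theta> (class_mult \<theta> (class_mult \<theta> r ?a) ?w) (class_mult \<theta> ?a t)"
    using mem t(1) r(1) by (simp add: q.assoc)
  also have "\<dots> = class_mult \<theta> (class_mult \<theta> (class_mult \<theta> r (class_mult \<theta> ?a ?e)) ?w) ?e"
    unfolding t(2) ea ..
  also have "\<dots> = class_mult \<theta> (class_mult \<theta> r ?a) (E w \<theta>)"
    unfolding Ew using mem r(1) by (simp add: q.assoc)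
  finally have "class_mult \<theta> (class_mult \<theta> r ?a) (E w \<theta>) = ?e" ..
  then show "\<exists>C\<in>NE // \<theta>. class_mult \<theta> C (E w \<theta>) = ?e" using mem r(1) by blast
qed

lemma E_LA: "E [LA] = \<alpha>"
  by (simp add: E_def e0)

lemma E_LA_Cons: "w \<noteq> [] \<Longrightarrow> E (LA # w) = \<alpha> \<odot> E w"
  using omega_append[of "[LA]" w] by (simp add: E_def pw.assoc e0 pw.closed e0_absorb)

lemma E_snoc_LA: "w \<noteq> [] \<Longrightarrow> E (w @ [LA]) = E w \<odot> \<alpha>"
  using omega_append[of w "[LA]"] by (simp add: E_def pw.assoc e0 pw.closed e0_absorb)

text \<open>The identity is clear after multiplying by \<open>e0\<close> on the left. That factor
  can be removed because, modulo each congruence, \<open>omega [d]\<close> is a left multiple of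
  \<open>\<alpha> \<odot> omega [d]\<close>, into which \<open>e0\<close> can be inserted.\<close>

lemma omega_inverse:
  assumes y: "y \<in> carrier G0" and inv: "E [d] \<odot> y = e0"
  shows "omega [d] \<odot> y \<odot> omega [d] = omega [d]"
proof (rule pw_eqI)
  let ?x = "omega [d]"
  have yP: "y \<in> PW" "e0 \<odot> y = y" using G0D[OF y] by auto
  show "?x \<odot> y \<odot> ?x \<in> PW" "?x \<in> PW" using yP by (simp_all add: pw.closed)
  fix \<theta> assume \<theta>: "\<theta> \<in> FC"
  interpret q: finite_semigroup_on "NE // \<theta>" "class_mult \<theta>" using \<theta> by (rule finite_semigroup_NE)
  note app = pw_mult_app[OF \<theta>]
  have mem: "?x \<theta> \<in> NE // \<theta>" "y \<theta> \<in> NE // \<theta>" "e0 \<theta> \<in> NE // \<theta>" "\<alpha> \<theta> \<in> NE // \<theta>"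
    using pw_coord[OF _ \<theta>] yP e0(1) by simp_all
  obtain r where r: "r \<in> NE // \<theta>" "?x \<theta> = class_mult \<theta> r (omega [LA, d] \<theta>)"
    using omega_letter_stable(2)[OF \<theta>] by blast
  have LAd: "omega [LA, d] = \<alpha> \<odot> (e0 \<odot> ?x)" using omega_append[of "[LA]" "[d]"] by (simp add: e0_absorb)
  have "?x \<theta> = class_mult \<theta> r (class_mult \<theta> (\<alpha> \<theta>) (class_mult \<theta> (e0 \<theta>) (?x \<theta>)))"
    using r(2) unfolding LAd app .
  also have "\<dots> = class_mult \<theta> (class_mult \<theta> r (\<alpha> \<theta>)) (class_mult \<theta> (e0 \<theta>) (?x \<theta>))"
    by (rule q.assoc[symmetric, OF r(1) mem(4) q.closed[OF mem(3,1)]])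
  finally have x: "?x \<theta> = class_mult \<theta> (class_mult \<theta> r (\<alpha> \<theta>)) (class_mult \<theta> (e0 \<theta>) (?x \<theta>))" .
  have "e0 \<odot> ?x \<odot> y = E [d] \<odot> y" using yP by (simp add: E_def pw.assoc e0(1) pw.closed)
  then have exy: "class_mult \<theta> (class_mult \<theta> (e0 \<theta>) (?x \<theta>)) (y \<theta>) = e0 \<theta>"
    using inv by (simp flip: app)
  have "(?x \<odot> y \<odot> ?x) \<theta> = class_mult \<theta> (class_mult \<theta> (?x \<theta>) (y \<theta>)) (?x \<theta>)" by (simp add: app)
  also have "\<dots> = class_mult \<theta> (class_mult \<theta>
      (class_mult \<theta> (class_mult \<theta> r (\<alpha> \<theta>)) (class_mult \<theta> (e0 \<theta>) (?x \<theta>))) (y \<theta>)) (?x \<theta>)"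
    using x by (rule arg_cong)
  also have "\<dots> = class_mult \<theta> (class_mult \<theta> r (\<alpha> \<theta>))
      (class_mult \<theta> (class_mult \<theta> (class_mult \<theta> (e0 \<theta>) (?x \<theta>)) (y \<theta>)) (?x \<theta>))"
    using mem r(1) by (simp add: q.assoc)
  also have "\<dots> = ?x \<theta>" unfolding exy by (rule x[symmetric])
  finally show "(?x \<odot> y \<odot> ?x) \<theta> = ?x \<theta>" .
qed

text \<open>By \<open>omega_inverse\<close> the middle factor \<open>omega [d]\<close> may be
  doubled around the inverse of \<open>E [d]\<close>, which absorbs \<open>e0\<close> on both sides.
  The values of \<open>E\<close> thus reduce to letters and pairs.\<close>

lemma E_overlap:
  assumes w: "w \<noteq> []"
  shows "E (c # d # w) = E [c, d] \<odot> inv\<^bsub>G0\<^esub> (E [d]) \<odot> E (d # w)"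
proof -
  interpret G0: group G0 by (rule group_G0)
  obtain y where y_def: "inv\<^bsub>G0\<^esub> (E [d]) = y" by blast
  then have y: "y \<in> carrier G0" using G0.inv_closed[OF E_in_G0[of "[d]"]] by simp
  have yP: "y \<in> PW" "e0 \<odot> y = y" "y \<odot> e0 = y" using G0D[OF y] by auto
  have "E [d] \<odot> y = e0" using G0.r_inv[OF E_in_G0[of "[d]"]] y_def by simp
  then have xyx: "omega [d] \<odot> y \<odot> omega [d] = omega [d]" by (rule omega_inverse[OF y])
  have cd: "E [c, d] = e0 \<odot> (omega [c] \<odot> omega [d]) \<odot> e0" and dw: "E (d # w) = e0 \<odot> (omega [d] \<odot> omega w) \<odot> e0"
    and cdw: "E (c # d # w) = e0 \<odot> (omega [c] \<odot> (omega [d] \<odot> omega w)) \<odot> e0"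
    using omega_append[of "[c]" "[d]"] omega_append[of "[d]" w] omega_append[of "[c]" "d # w"] w
    unfolding E_def by simp_all
  have P: "omega [c] \<in> PW" "omega [d] \<in> PW" "omega w \<in> PW" using w by simp_all
  have "E [c, d] \<odot> y \<odot> E (d # w) =
    e0 \<odot> omega [c] \<odot> omega [d] \<odot> (e0 \<odot> y \<odot> e0) \<odot> omega [d] \<odot> omega w \<odot> e0"
    unfolding cd dw using P yP(1) e0(1) by (simp only: pw.assoc pw.closed)
  also have "\<dots> = e0 \<odot> omega [c] \<odot> (omega [d] \<odot> y \<odot> omega [d]) \<odot> omega w \<odot> e0"
    unfolding yP(2,3) using P yP(1) e0(1) by (simp only: pw.assoc pw.closed)
  also have "\<dots> = E (c # d # w)"
    unfolding xyx cdw using P e0(1) by (simp only: pw.assoc pw.closed)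
  finally show ?thesis unfolding y_def ..
qed

lemma \<alpha>_in_G0: "\<alpha> \<in> carrier G0"
  using E_in_G0[of "[LA]"] E_LA by simp

lemma \<alpha>_in_TMC: "\<alpha> \<in> TMC"
  unfolding TMC_def
proof (intro CollectI conjI ballI)
  fix \<theta> assume \<theta>: "\<theta> \<in> FC"
  obtain n where n: "idem_exponent \<theta> n" using idem_exponent_exists[OF \<theta>, of 1] by auto
  have "(\<tau> ^^ n) [LA] \<in> \<alpha> \<theta>"
    unfolding omega_class[OF \<theta> n, of "[LA]", simplified] using self_in_class[OF \<theta>] by simp
  then show "\<exists>w\<in>TML. w \<in> \<alpha> \<theta>" using \<tau>_funpow_LA_in_TML by blast
qed simp

text \<open>\<open>e0\<close> is a factor of \<open>\<alpha>\<close>, and every unit at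
  \<open>e0\<close> is a factor of \<open>e0\<close>.\<close>

lemma G0_subset_TMC: "carrier G0 \<subseteq> TMC"
proof
  fix x assume x: "x \<in> carrier G0"
  interpret G0: group G0 by (rule group_G0)
  have e: "e0 \<in> TMC" using TMC_factor(1)[OF e0(1) omega_in, of "[LA]"] e0(3) \<alpha>_in_TMC by simp
  have "x \<odot> inv\<^bsub>G0\<^esub> x = e0" using G0.r_inv[OF x] by simp
  moreover have "x \<in> PW" "inv\<^bsub>G0\<^esub> x \<in> PW" using G0D x G0.inv_closed[OF x] by blast+
  ultimately show "x \<in> TMC" using e TMC_factor(1) by metis
qed

lemma G0_subset_J: "carrier G0 \<subseteq> subst_J_class thue_morse"
proof
  fix x assume x: "x \<in> carrier G0"
  then have "x \<notin> word_embedding ` NE" using word_embedding_not_left_fixed[OF e0(1)] G0D by blast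
  then show "x \<in> subst_J_class thue_morse"
    unfolding J_class_eq using G0_subset_TMC x TML_nonempty by blast
qed

lemma Schuetzenberger_group_TM:
  "maximal_subgroup PW pseudoword_mult (Schuetzenberger_group thue_morse)"
  "carrier (Schuetzenberger_group thue_morse) \<subseteq> subst_J_class thue_morse"
proof -
  have "\<exists>G. maximal_subgroup PW pseudoword_mult G \<and> carrier G \<subseteq> subst_J_class thue_morse"
    using pw.maximal_unit_group[OF e0(1,2)] G0_subset_J by blast
  then have "maximal_subgroup PW pseudoword_mult (Schuetzenberger_group thue_morse) \<and>
    carrier (Schuetzenberger_group thue_morse) \<subseteq> subst_J_class thue_morse"
    unfolding Schuetzenberger_group_def by (rule someI_ex)
  then show "maximal_subgroup PW pseudoword_mult (Schuetzenberger_group thue_morse)"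
    "carrier (Schuetzenberger_group thue_morse) \<subseteq> subst_J_class thue_morse" by blast+
qed

section \<open>Approximation of group elements, and homomorphisms vanishing at
  \<open>\<alpha>\<close>\<close>

section \<open>Homomorphisms onto the group of order two\<close>

text \<open>At this coordinate \<open>\<alpha>\<close> is the class of some \<tau>^k(a), the segment
  from 0 to 2^k. Both borders therefore sit at known positions, next to multiples of 2^m.\<close>

lemma border_congruence_prefix:
  assumes "u \<in> \<alpha> (\<theta> \<inter> border_congruence (2 ^ m))" and \<theta>: "\<theta> \<in> FC"
  shows "2 ^ m \<le> length u" "take (2 ^ m) u = seg 0 (2 ^ m)"
    "\<exists>k\<ge>m. drop (length u - 2 ^ m) u = seg (2 ^ k - 2 ^ m) (2 ^ k)"
proof -
  let ?N = "2 ^ m" and ?\<theta> = "\<theta> \<inter> border_congruence (2 ^ m)"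
  have f: "?\<theta> \<in> FC" using nonempty.Int_finite_congruences[OF \<theta> border_congruence_in] .
  obtain k where k: "idem_exponent ?\<theta> k" "k \<ge> m" using idem_exponent_exists[OF f, of 1] by auto
  have "(((\<tau> ^^ k) [LA]), u) \<in> ?\<theta>"
    using assms(1) unfolding omega_class[OF f k(1), of "[LA]", simplified] by simp
  then have "(seg 0 (2 ^ k), u) \<in> border_congruence ?N" by (simp add: \<tau>_funpow_LA)
  then have t: "take ?N (seg 0 (2 ^ k)) = take ?N u" "take ?N (rev (seg 0 (2 ^ k))) = take ?N (rev u)"
    by (simp_all add: border_congruence_def)
  have le: "?N \<le> (2::nat) ^ k" using k(2) by simp
  have pre: "take ?N (seg 0 (2 ^ k)) = seg 0 ?N" using le by (simp add: seg_def take_map)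
  then show "take ?N u = seg 0 ?N" using t(1) by simp
  then have "length (take ?N u) = ?N" by simp
  then show "?N \<le> length u" by simp
  have "rev (take ?N (rev u)) = drop (length u - ?N) u" by (simp add: rev_take)
  moreover have "rev (take ?N (rev (seg 0 (2 ^ k)))) = drop (2 ^ k - ?N) (seg 0 (2 ^ k))" by (simp add: rev_take)
  moreover have "drop (2 ^ k - ?N) (seg 0 (2 ^ k)) = seg (2 ^ k - ?N) (2 ^ k)" by (simp add: seg_def drop_map)
  ultimately show "\<exists>k\<ge>m. drop (length u - ?N) u = seg (2 ^ k - ?N) (2 ^ k)" using t(2) k(2) by metis
qed

text \<open>
  A word approximating \<open>\<alpha> \<odot> x \<odot> \<alpha>\<close> is a block of the Thue-Morse word, and recognizability forces
  the two cuts that delimit the factor \<open>x\<close> to be multiples of \<open>2 ^ n\<close>.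
\<close>

lemma G0_approximation:
  assumes x: "x \<in> carrier G0" and \<theta>: "\<theta> \<in> FC"
  shows "\<exists>z. z \<noteq> [] \<and> x \<theta> = E z \<theta>"
proof -
  obtain n where n: "idem_exponent \<theta> n" using idem_exponent_exists[OF \<theta>, of 1] by auto
  \<comment> \<open>The window with which \<open>seg_recognizable\<close> aligns positions modulo
    2^n.\<close>
  let ?M = "2 ^ (n + 3)" and ?\<rho> = "\<theta> \<inter> border_congruence (2 ^ (n + 3))"
  have \<rho>: "?\<rho> \<in> FC" using nonempty.Int_finite_congruences[OF \<theta> border_congruence_in] .
  interpret G0: group G0 by (rule group_G0)
  have xP: "x \<in> PW" "e0 \<odot> x = x" "x \<odot> e0 = x" using G0D[OF x] by auto
  have x\<alpha>: "x \<odot> \<alpha> \<in> PW" using xP by (simp add: pw.closed)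
  have "\<alpha> \<odot> (x \<odot> \<alpha>) \<in> carrier G0"
    using G0.m_closed[OF \<alpha>_in_G0 G0.m_closed[OF x \<alpha>_in_G0]] by simp
  then have "\<alpha> \<odot> (x \<odot> \<alpha>) \<in> TMC" using G0_subset_TMC by blast
  then obtain w1 w' where w: "w1 \<in> \<alpha> (factor_congruence ?\<rho>)" "w' \<in> (x \<odot> \<alpha>) (factor_congruence ?\<rho>)" "w1 @ w' \<in> TML"
    using TMC_split[OF omega_in x\<alpha> _ factor_congruence_in[OF \<rho>], of "[LA]"] by blast
  have w1: "w1 \<in> \<alpha> ?\<rho>"
    using pw_mono[OF omega_in factor_congruence_in[OF \<rho>] \<rho> factor_congruence_subset[OF \<rho>] w(1)] by simp
  obtain w2 w3 where w': "w' = w2 @ w3" "w2 \<in> x ?\<rho>" "w3 \<in> \<alpha> ?\<rho>"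
    using factor_congruence_split[OF xP(1) omega_in \<rho> w(2)] by blast
  obtain i where i: "w1 @ w' = seg i (i + length (w1 @ w'))" using TML_seg[OF w(3)] .
  define i1 where "i1 = i + length w1"
  define i2 where "i2 = i1 + length w2"
  define i3 where "i3 = i2 + length w3"
  have "seg i i3 = w1 @ w2 @ w3" using i w'(1) by (simp add: i1_def i2_def i3_def add.assoc)
  then have s1: "w1 = seg i i1" and s23: "w2 @ w3 = seg i1 i3"
    using seg_eq_appendD[of i i3 w1 "w2 @ w3"] by (simp_all add: i1_def)
  then have s2: "w2 = seg i1 i2" and s3: "w3 = seg i2 i3"
    using seg_eq_appendD[of i1 i3 w2 w3] by (simp_all add: i2_def)
  note b1 = border_congruence_prefix[OF w1 \<theta>] and b3 = border_congruence_prefix[OF w'(3) \<theta>]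
  obtain k where k: "k \<ge> n + 3" "drop (length w1 - ?M) w1 = seg (2 ^ k - ?M) (2 ^ k)" using b1(3) by blast
  have le1: "?M \<le> length w1" by (rule b1(1))
  have lek: "?M \<le> (2::nat) ^ k" using k(1) by (simp add: power_increasing)
  \<comment> \<open>The last \<open>?M\<close> letters of \<open>w1\<close> also end \<tau>^k(a), at
    position 2^k. Both 2^k and \<open>?M\<close> are multiples of 2^n, so the first cut
    \<open>i1\<close> is one as well.\<close>
  have "drop (length w1 - ?M) w1 = seg (i1 - ?M) i1"
    using le1 unfolding s1 by (simp add: seg_def drop_map i1_def)
  then have "seg (i1 - ?M) (i1 - ?M + ?M) = seg (2 ^ k - ?M) (2 ^ k - ?M + ?M)"
    using k(2) le1 lek by (simp add: i1_def)
  then have "(i1 - ?M) mod 2 ^ n = (2 ^ k - ?M) mod 2 ^ n" by (rule seg_recognizable)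
  moreover have dM: "(2::nat) ^ n dvd ?M" "(2::nat) ^ n dvd 2 ^ k"
    using k(1) by (simp_all add: le_imp_power_dvd)
  ultimately have "2 ^ n dvd i1 - ?M" by (simp add: dvd_diff_nat mod_eq_0_iff_dvd)
  moreover have "i1 = (i1 - ?M) + ?M" using le1 by (simp add: i1_def)
  ultimately have d1: "2 ^ n dvd i1" using dM(1) by (metis dvd_add)
  \<comment> \<open>The first \<open>?M\<close> letters of \<open>w3\<close> also open the
    Thue-Morse word, which aligns the second cut with position 0.\<close>
  have "i2 + ?M \<le> i3" using b3(1) by (simp add: i3_def)
  then have "take ?M w3 = seg i2 (i2 + ?M)"
    unfolding s3 by (simp add: seg_def take_map)
  then have "seg i2 (i2 + ?M) = seg 0 (0 + ?M)" using b3(2) by simp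
  then have "i2 mod 2 ^ n = 0 mod 2 ^ n" by (rule seg_recognizable)
  then have d2: "2 ^ n dvd i2" by (simp add: mod_eq_0_iff_dvd)
  obtain j1 j2 where j: "i1 = 2 ^ n * j1" "i2 = 2 ^ n * j2" using d1 d2 by (elim dvdE)
  have w2z: "w2 = (\<tau> ^^ n) (seg j1 j2)" using s2 j by (simp add: \<tau>_funpow_seg)
  have "w2 \<noteq> []" using pw_class(1)[OF xP(1) \<rho> w'(2)] .
  then have z: "seg j1 j2 \<noteq> []" using w2z by auto
  have "w2 \<in> x \<theta>" using pw_mono[OF xP(1) \<rho> \<theta> _ w'(2)] by blast
  then have "x \<theta> = omega (seg j1 j2) \<theta>"
    using pw_class(2)[OF xP(1) \<theta>] omega_class[OF \<theta> n z] w2z by simp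
  then have "E (seg j1 j2) \<theta> = (e0 \<odot> x \<odot> e0) \<theta>" by (simp add: E_def pw_mult_app[OF \<theta>])
  then show ?thesis using z xP by (intro exI[of _ "seg j1 j2"]) simp
qed

lemma E_\<tau>_funpow:
  assumes "\<theta> \<in> FC" "idem_exponent \<theta> n" "w \<noteq> []"
  shows "E ((\<tau> ^^ n) w) \<theta> = E w \<theta>"
  using omega_\<tau>_funpow[OF assms] by (simp add: E_def pw_mult_app[OF assms(1)])

text \<open>The predicate \<open>h\<close> encodes a homomorphism to the group of order two: truth
  is the nontrivial value, and inequality of truth values is addition.\<close>

lemma hom_to_order_two_trivial:
  assumes hom: "\<And>x y. x \<in> carrier G0 \<Longrightarrow> y \<in> carrier G0 \<Longrightarrow> h (x \<odot> y) \<longleftrightarrow> h x \<noteq> h y"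
    and \<theta>: "\<theta> \<in> FC"
    and cont: "\<And>x y. x \<in> carrier G0 \<Longrightarrow> y \<in> carrier G0 \<Longrightarrow> x \<theta> = y \<theta> \<Longrightarrow> h x = h y"
    and \<alpha>: "\<not> h \<alpha>"
    and x: "x \<in> carrier G0"
  shows "\<not> h x"
proof -
  interpret G0: group G0 by (rule group_G0)
  have h1: "\<not> h e0" using hom[OF G0.one_closed G0.one_closed] e0(2) by simp
  have hinv: "h (inv\<^bsub>G0\<^esub> y) = h y" if y: "y \<in> carrier G0" for y
    using hom[OF y G0.inv_closed[OF y]] G0.r_inv[OF y] h1 by simp
  define f where "f w = h (E w)" for w
  let ?B = "f [LB]" and ?C = "f [LB, LB]"
  have fa: "\<not> f [LA]" using \<alpha> E_LA by (simp add: f_def)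
  have fad: "f [LA, d] = f [d]" for d
    using hom[OF \<alpha>_in_G0 E_in_G0[of "[d]"]] \<alpha> E_LA_Cons[of "[d]"] by (simp add: f_def)
  have fda: "f [d, LA] = f [d]" for d
    using hom[OF E_in_G0[of "[d]"] \<alpha>_in_G0] \<alpha> E_snoc_LA[of "[d]"] by (simp add: f_def)
  have rec: "f (c # d # w) \<longleftrightarrow> (f [c, d] \<noteq> f [d]) \<noteq> f (d # w)" if w: "w \<noteq> []" for c d w
  proof -
    have i: "inv\<^bsub>G0\<^esub> (E [d]) \<in> carrier G0" using E_in_G0[of "[d]"] by simp
    have cd: "E [c, d] \<in> carrier G0" and dw: "E (d # w) \<in> carrier G0" and d: "E [d] \<in> carrier G0"
      using E_in_G0 by simp_all
    have m: "E [c, d] \<odot> inv\<^bsub>G0\<^esub> (E [d]) \<in> carrier G0" using G0.m_closed[OF cd i] by simp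
    show ?thesis unfolding f_def E_overlap[OF w] hom[OF m dw] hom[OF cd i] hinv[OF d] ..
  qed
  \<comment> \<open>By \<open>rec\<close>, \<open>fad\<close> and \<open>fda\<close>, prepending c
    to dw adds 0 if c = a, adds B for ba, and adds C - B, which is B + C modulo 2, for bb.\<close>
  have form: "w \<noteq> [] \<Longrightarrow> f w \<longleftrightarrow> (?B \<and> odd (count_list w LB)) \<noteq> (?C \<and> odd (count_bb w))" for w
  proof (induction w rule: count_bb.induct)
    case (1 c d w)
    show ?case
    proof (cases "w = []")
      case True
      then show ?thesis using fa fad fda by (cases c; cases d) auto
    next
      case False
      show ?thesis unfolding rec[OF False] using 1 fa fad fda by (cases c; cases d) auto
    qed
  next
    case ("2_2" c)
    then show ?case using fa by (cases c) auto
  qed simp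
  obtain n where n: "idem_exponent \<theta> n" "2 dvd n" using idem_exponent_exists[OF \<theta>, of 2] by auto
  then have n0: "n > 0" by (simp add: idem_exponent_def)
  have ft: "f ((\<tau> ^^ n) w) = f w" if "w \<noteq> []" for w
    unfolding f_def using that E_in_G0 by (intro cont E_\<tau>_funpow[OF \<theta> n(1)]) simp_all
  \<comment> \<open>\<tau>^n(a) has an even number of b's and an odd number of bb's, so its value is
    C, whereas the value at a is 0.\<close>
  have "\<not> ?C"
    using ft[of "[LA]"] fa form[of "(\<tau> ^^ n) [LA]"] parity_\<tau>_even[OF n(2) n0, of "[LA]"] by simp
  then have fz: "\<not> f z" if "z \<noteq> []" for z
    using ft[OF that] form[of "(\<tau> ^^ n) z"] parity_\<tau>_even(1)[OF n(2) n0, of z] that by simp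
  obtain z where z: "z \<noteq> []" "x \<theta> = E z \<theta>" using G0_approximation[OF x \<theta>] by blast
  then show ?thesis using cont[OF x E_in_G0[OF z(1)] z(2)] fz[OF z(1)] by (simp add: f_def)
qed

section \<open>Noncommutativity of the group and odd powers of \<open>\<alpha>\<close>\<close>

section \<open>A finite quotient of the maximal subgroup\<close>

definition act_cong :: "(letter list \<times> letter list) set" where
  "act_cong = {(u, v). u \<in> NE \<and> v \<in> NE \<and> act u = act v}"

lemma act_cong_in: "act_cong \<in> FC"
  unfolding act_cong_def by (rule act_congruence)

text \<open>At an idempotent exponent divisible by 4 the substitution does not change the action, so
  \<open>omega w\<close> remembers the action of \<open>w\<close>.\<close>

lemma omega_act_cong:
  assumes "u \<noteq> []" "v \<noteq> []" "omega u act_cong = omega v act_cong"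
  shows "act u = act v"
proof -
  obtain n where n: "idem_exponent act_cong n" "4 dvd n" using idem_exponent_exists[OF act_cong_in, of 4] by auto
  have "((\<tau> ^^ n) u, (\<tau> ^^ n) v) \<in> act_cong"
    using assms by (simp add: omega_class[OF act_cong_in n(1)] class_NE_eq_iff[OF act_cong_in])
  then show ?thesis using act_\<tau>_funpow[OF n(2)] by (simp add: act_cong_def)
qed

text \<open>The word aba begins and ends with a, so its limit is already fixed by \<open>e0\<close>
  and lies in the group; the action separates its two products with \<open>\<alpha>\<close>.\<close>

lemma G0_not_commutative: "\<exists>x\<in>carrier G0. \<exists>y\<in>carrier G0. x \<odot> y \<noteq> y \<odot> x"
proof -
  let ?y = "omega [LA, LB, LA]"
  have P: "omega [LB, LA] \<in> PW" "omega [LA, LB] \<in> PW" by simp_all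
  have "?y = \<alpha> \<odot> omega [LB, LA]" "?y = omega [LA, LB] \<odot> \<alpha>"
    using omega_append[of "[LA]" "[LB, LA]"] omega_append[of "[LA, LB]" "[LA]"] by simp_all
  then have "e0 \<odot> ?y = ?y" "?y \<odot> e0 = ?y"
    using e0_absorb(3)[OF P(1)] pw.assoc[OF P(2) omega_in e0(1), of "[LA]"] e0(4) by simp_all
  then have "E [LA, LB, LA] = ?y" by (simp add: E_def)
  then have y: "?y \<in> carrier G0" using E_in_G0[of "[LA, LB, LA]"] by simp
  have "\<alpha> \<odot> ?y = omega ([LA] @ [LA, LB, LA])" "?y \<odot> \<alpha> = omega ([LA, LB, LA] @ [LA])"
    using omega_append[of "[LA]" "[LA, LB, LA]"] omega_append[of "[LA, LB, LA]" "[LA]"] by simp_all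
  moreover have "omega ([LA] @ [LA, LB, LA]) \<noteq> omega ([LA, LB, LA] @ [LA])"
    using omega_act_cong[of "[LA] @ [LA, LB, LA]" "[LA, LB, LA] @ [LA]"] act_noncommuting by auto
  ultimately show ?thesis using \<alpha>_in_G0 y by (intro bexI[of _ \<alpha>] bexI[of _ ?y]) simp_all
qed

lemma \<alpha>_pow: "\<alpha> [^]\<^bsub>G0\<^esub> Suc N = omega (replicate (Suc N) LA)"
proof (induction N)
  interpret G0: group G0 by (rule group_G0)
  case 0
  show ?case by (simp add: e0)
next
  interpret G0: group G0 by (rule group_G0)
  case (Suc N)
  have eq: "replicate (Suc (Suc N)) LA = replicate (Suc N) LA @ [LA]" by (simp add: replicate_append_same)
  have "omega (replicate (Suc (Suc N)) LA) = omega (replicate (Suc N) LA) \<odot> \<alpha>"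
    unfolding eq by (rule omega_append) simp_all
  then show ?case using Suc G0.nat_pow_Suc[of \<alpha> "Suc N"] by (simp only: G0_mult)
qed

text \<open>The action of \<open>e0\<close> is not known from a word, so its idempotence is used:
  equality would give a^(2N) and a^N the same action, although an even and an odd power of a differ
  at the point \<open>(LA, Some LA)\<close>.\<close>

lemma \<alpha>_pow_odd:
  fixes N :: nat
  assumes "odd N"
  shows "(\<alpha> [^]\<^bsub>G0\<^esub> N) act_cong \<noteq> e0 act_cong"
proof
  obtain M where N: "N = Suc M" using assms by (cases N) auto
  let ?w = "replicate N LA"
  assume "(\<alpha> [^]\<^bsub>G0\<^esub> N) act_cong = e0 act_cong"
  then have eq: "omega ?w act_cong = e0 act_cong" unfolding N \<alpha>_pow .
  have "?w \<noteq> []" using N by simp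
  then have "omega (?w @ ?w) act_cong = (omega ?w \<odot> omega ?w) act_cong" using omega_append by simp
  also have "\<dots> = (e0 \<odot> e0) act_cong" unfolding pw_mult_app[OF act_cong_in] eq ..
  also have "\<dots> = omega ?w act_cong" using e0(2) eq by simp
  finally have "act (?w @ ?w) = act ?w" using omega_act_cong[of "?w @ ?w" ?w] \<open>?w \<noteq> []\<close> by simp
  moreover have "?w @ ?w = replicate (N + N) LA" by (simp add: replicate_add)
  ultimately have "act (replicate (N + N) LA) (LA, Some LA) = act (replicate N LA) (LA, Some LA)" by simp
  then show False using assms unfolding act_replicate by simp
qed

section \<open>Transport between the idempotents of the J-class\<close>

section \<open>All maximal subgroups are isomorphic\<close>

text \<open>In each finite quotient, a long enough word of the language has \<tau>^n(a) as an inner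
  factor and, conversely, every word of the language is an inner factor of \<tau>^n(a) for large
  n.\<close>

lemma idempotent_J_equivalent:
  assumes e: "e \<in> PW" "e \<odot> e = e" "e \<in> TMC"
  shows "\<exists>u\<in>PW. \<exists>v\<in>PW. u \<odot> \<alpha> \<odot> v = e" "\<exists>u\<in>PW. \<exists>v\<in>PW. u \<odot> e \<odot> v = \<alpha>"
proof -
  show "\<exists>u\<in>PW. \<exists>v\<in>PW. u \<odot> \<alpha> \<odot> v = e"
  proof (rule pw_divides[OF e(1) omega_in])
    fix \<theta> assume \<theta>: "\<theta> \<in> FC"
    obtain n where n: "idem_exponent \<theta> n" using idem_exponent_exists[OF \<theta>, of 1] by auto
    let ?b = "border_congruence (5 * 2 ^ n)"
    have \<rho>: "\<theta> \<inter> ?b \<in> FC" using nonempty.Int_finite_congruences[OF \<theta> border_congruence_in] .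
    then obtain w where w: "w \<in> TML" "w \<in> e (\<theta> \<inter> ?b)" using e(3) unfolding TMC_def by blast
    have "w \<in> e ?b" using pw_mono[OF e(1) \<rho> border_congruence_in _ w(2)] by blast
    then have len: "5 * 2 ^ n \<le> length w" by (rule idempotent_long[OF e(1,2)])
    obtain i where "w = seg i (i + length w)" using TML_seg[OF w(1)] .
    then obtain u v where uv: "w = u @ (\<tau> ^^ n) [LA] @ v" "u \<noteq> []" "v \<noteq> []"
      using seg_contains_\<tau>_LA[OF len, of i] by metis
    have "w \<in> e \<theta>" using pw_mono[OF e(1) \<rho> \<theta> _ w(2)] by blast
    then have "e \<theta> = \<theta> `` {w}" using pw_class(2)[OF e(1) \<theta>] by blast
    then have "class_mult \<theta> (class_mult \<theta> (\<theta> `` {u}) (\<alpha> \<theta>)) (\<theta> `` {v}) = e \<theta>"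
      using uv by (simp add: omega_class[OF \<theta> n] class_mult_NE[OF \<theta>])
    then show "\<exists>C\<in>NE // \<theta>. \<exists>D\<in>NE // \<theta>. class_mult \<theta> (class_mult \<theta> C (\<alpha> \<theta>)) D = e \<theta>"
      using class_NE uv(2,3) by blast
  qed simp
  show "\<exists>u\<in>PW. \<exists>v\<in>PW. u \<odot> e \<odot> v = \<alpha>"
  proof (rule pw_divides[OF omega_in e(1)])
    fix \<theta> assume \<theta>: "\<theta> \<in> FC"
    obtain w where w: "w \<in> TML" "w \<in> e \<theta>" using e(3) \<theta> unfolding TMC_def by blast
    obtain N where N: "\<And>k x. k \<ge> N \<Longrightarrow> \<exists>u v. u \<noteq> [] \<and> v \<noteq> [] \<and> (\<tau> ^^ k) [x] = u @ w @ v"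
      using TML_inner_factor[OF w(1)] by meson
    obtain n where n: "idem_exponent \<theta> n" "n \<ge> N" using idem_exponent_exists[OF \<theta>, of 1] by auto
    obtain u v where uv: "u \<noteq> []" "v \<noteq> []" "(\<tau> ^^ n) [LA] = u @ w @ v" using N[OF n(2)] by blast
    have "w \<noteq> []" "e \<theta> = \<theta> `` {w}" using pw_class[OF e(1) \<theta> w(2)] .
    then have "class_mult \<theta> (class_mult \<theta> (\<theta> `` {u}) (e \<theta>)) (\<theta> `` {v}) = \<alpha> \<theta>"
      using uv by (simp add: omega_class[OF \<theta> n(1)] class_mult_NE[OF \<theta>])
    then show "\<exists>C\<in>NE // \<theta>. \<exists>D\<in>NE // \<theta>. class_mult \<theta> (class_mult \<theta> C (e \<theta>)) D = \<alpha> \<theta>"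
      using class_NE uv(1,2) by blast
  qed simp
qed

text \<open>J-equivalent idempotents are D-equivalent by stability. The candidates satisfy
  \<open>p \<odot> q = e\<close> at once; the other product is an idempotent below
  \<open>e0\<close>, and stability makes it equal to \<open>e0\<close>.\<close>

lemma idempotent_transport:
  assumes e: "e \<in> PW" "e \<odot> e = e" "e \<in> TMC"
  obtains p q where "p \<in> PW" "q \<in> PW" "p \<odot> q = e" "q \<odot> p = e0" "e \<odot> p = p" "p \<odot> e0 = p" "q \<odot> e = q" "e0 \<odot> q = q"
proof -
  interpret G0: group G0 by (rule group_G0)
  obtain u v where u: "u \<in> PW" and v: "v \<in> PW" and uv: "u \<odot> \<alpha> \<odot> v = e"
    using idempotent_J_equivalent(1)[OF e] by blast
  obtain u' v' where u': "u' \<in> PW" and v': "v' \<in> PW" and uv': "u' \<odot> e \<odot> v' = \<alpha>"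
    using idempotent_J_equivalent(2)[OF e] by blast
  obtain y where y: "y \<in> PW" "\<alpha> \<odot> y = e0"
    using G0.r_inv[OF \<alpha>_in_G0] G0D[OF G0.inv_closed[OF \<alpha>_in_G0]] by auto
  let ?p = "e \<odot> u \<odot> e0" and ?q = "e0 \<odot> (\<alpha> \<odot> v \<odot> e)"
  note P = e(1) e0(1) u v u' v' y(1) omega_in[of "[LA]", simplified]
  have p: "?p \<in> PW" and q: "?q \<in> PW" using P by simp_all
  have ep: "e \<odot> ?p = ?p" using pw.assoc[OF e(1) e(1), of "u \<odot> e0"] e(2) P by (simp add: pw.assoc)
  have pe: "?p \<odot> e0 = ?p" using P e0(2) by (simp add: pw.assoc)
  have qe: "?q \<odot> e = ?q" using P e(2) by (simp add: pw.assoc)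
  have eq: "e0 \<odot> ?q = ?q" using P by (simp add: e0_absorb)
  have pq: "?p \<odot> ?q = e"
  proof -
    have "?p \<odot> ?q = (?p \<odot> e0) \<odot> (\<alpha> \<odot> v \<odot> e)" using P by (simp add: pw.assoc)
    also have "\<dots> = e \<odot> (u \<odot> \<alpha> \<odot> v) \<odot> e" unfolding pe using P by (simp add: pw.assoc e0_absorb)
    finally show ?thesis using uv e(2) by simp
  qed
  obtain f where f: "f = ?q \<odot> ?p" by blast
  then have fP: "f \<in> PW" using p q by (simp add: pw.closed)
  have ef: "e0 \<odot> f = f" "f \<odot> e0 = f"
    unfolding f using pw.assoc[OF e0(1) q p] pw.assoc[OF q p e0(1)] eq pe by simp_all
  have ff: "f \<odot> f = f"
  proof -
    have "f \<odot> f = ?q \<odot> (?p \<odot> ?q) \<odot> ?p" unfolding f using p q by (simp only: pw.assoc pw.closed)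
    then show ?thesis unfolding pq qe f .
  qed
  \<comment> \<open>These exhibit \<open>e0\<close> as a multiple of \<open>f\<close>: between
    \<open>u'\<close> and \<open>v'\<close> the product collapses to \<open>e\<close>, which gives
    \<open>\<alpha>\<close>, and \<open>y\<close> is the inverse of \<open>\<alpha>\<close>.\<close>
  let ?X = "u' \<odot> ?p" and ?Y = "?q \<odot> (v' \<odot> y)"
  have XY: "?X \<in> PW" "?Y \<in> PW" using p q P by (simp_all add: pw.closed)
  have XfY: "?X \<odot> (e0 \<odot> (f \<odot> ?Y)) = e0"
  proof -
    have "?X \<odot> (e0 \<odot> (f \<odot> ?Y)) = ?X \<odot> (f \<odot> ?Y)"
      using pw.assoc[OF e0(1) fP XY(2)] ef by simp
    also have "\<dots> = u' \<odot> ((?p \<odot> ?q) \<odot> (?p \<odot> ?q)) \<odot> (v' \<odot> y)"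
      unfolding f using p q P by (simp only: pw.assoc pw.closed)
    also have "\<dots> = (u' \<odot> e \<odot> v') \<odot> y" unfolding pq e(2) using P by (simp only: pw.assoc pw.closed)
    finally show ?thesis unfolding uv' y(2) .
  qed
  have "f = e0"
  proof (rule pw_eqI[OF fP e0(1)])
    fix \<theta> assume \<theta>: "\<theta> \<in> FC"
    interpret q: finite_semigroup_on "NE // \<theta>" "class_mult \<theta>" using \<theta> by (rule finite_semigroup_NE)
    let ?m = "class_mult \<theta>"
    note app = pw_mult_app[OF \<theta>]
    have mem: "f \<theta> \<in> NE // \<theta>" "e0 \<theta> \<in> NE // \<theta>" "?X \<theta> \<in> NE // \<theta>" "?Y \<theta> \<in> NE // \<theta>"
      using pw_coord[OF _ \<theta>] fP e0(1) XY by blast+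
    have "e0 \<theta> = ?m (?X \<theta>) (?m (e0 \<theta>) (?m (f \<theta>) (?Y \<theta>)))"
      using XfY unfolding app[symmetric] by (simp only:)
    then obtain r where r: "r \<in> NE // \<theta>" "e0 \<theta> = ?m (?m (e0 \<theta>) (?m (f \<theta>) (?Y \<theta>))) r"
      using q.stable_right[OF mem(2,3) q.closed[OF mem(1,4)]] by blast
    have ef': "?m (e0 \<theta>) (f \<theta>) = f \<theta>" "?m (f \<theta>) (e0 \<theta>) = f \<theta>" "?m (f \<theta>) (f \<theta>) = f \<theta>"
      using ef ff unfolding app[symmetric] by simp_all
    have e': "e0 \<theta> = ?m (f \<theta>) (?m (?Y \<theta>) r)"
      using r(2) unfolding q.assoc[symmetric, OF mem(2,1,4)] ef'(1) q.assoc[OF mem(1,4) r(1)] .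
    have "f \<theta> = ?m (f \<theta>) (e0 \<theta>)" by (rule ef'(2)[symmetric])
    also have "\<dots> = ?m (f \<theta>) (?m (f \<theta>) (?m (?Y \<theta>) r))" using e' by (rule arg_cong)
    also have "\<dots> = ?m (?m (f \<theta>) (f \<theta>)) (?m (?Y \<theta>) r)"
      by (rule q.assoc[symmetric, OF mem(1,1) q.closed[OF mem(4) r(1)]])
    also have "\<dots> = e0 \<theta>" unfolding ef'(3) by (rule e'[symmetric])
    finally show "f \<theta> = e0 \<theta>" .
  qed
  then show thesis using that[OF p q pq _ ep pe qe eq] f by simp
qed

definition G0_topology :: "letter pseudoword topology" where
  "G0_topology = subtopology pseudoword_topology (carrier G0)"

lemma pw_two_sided_mult_continuous:
  assumes p: "p \<in> PW" and q: "q \<in> PW"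
  shows "continuous_map pseudoword_topology pseudoword_topology (\<lambda>x. p \<odot> x \<odot> q)"
  unfolding pseudoword_topology_def
proof (rule continuous_map_lim[OF order_refl])
  show "(\<lambda>x. p \<odot> x \<odot> q) \<in> lim_carrier NE FC \<rightarrow> lim_carrier NE FC"
    using p q pw.closed unfolding pseudowords_def by blast
  show "(p \<odot> x \<odot> q) \<theta> = (p \<odot> y \<odot> q) \<theta>" if "\<theta> \<in> FC" "x \<theta> = y \<theta>" for \<theta> x y
    using that by (simp add: pw_mult_app)
qed

text \<open>The isomorphism is multiplication by \<open>p\<close> and \<open>q\<close>, with inverse
  given by \<open>q\<close> and \<open>p\<close>; both act coordinatewise and are therefore
  continuous.\<close>

lemma Schuetzenberger_group_isomorphic:
  "topological_group_isomorphic G0 G0_topology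
    (Schuetzenberger_group thue_morse) (Schuetzenberger_topology thue_morse)"
proof -
  let ?G = "Schuetzenberger_group thue_morse"
  define e where "e = one ?G"
  have e: "e \<in> PW" "e \<odot> e = e" and G: "?G = unit_group PW pseudoword_mult e"
    using pw.maximal_subgroup_eq_unit_group[OF Schuetzenberger_group_TM(1)] by (simp_all add: e_def)
  have "e \<in> carrier ?G" unfolding G using e by (auto simp: unit_group_def)
  then have "e \<in> TMC" using Schuetzenberger_group_TM(2) J_class_eq by blast
  then obtain p q where p: "p \<in> PW" and q: "q \<in> PW" and pq: "p \<odot> q = e" "q \<odot> p = e0"
    and ids: "e \<odot> p = p" "p \<odot> e0 = p" "q \<odot> e = q" "e0 \<odot> q = q"
    using idempotent_transport[OF e] by blast
  let ?f = "\<lambda>x. p \<odot> x \<odot> q" and ?g = "\<lambda>x. q \<odot> x \<odot> p"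
  have iso: "?f \<in> iso G0 ?G" unfolding G
    by (rule pw.unit_group_iso[OF p q e(1) e0(1) pq e(2) e0(2) ids])
  have f: "?f x \<in> carrier ?G" "?g (?f x) = x" if "x \<in> carrier G0" for x
    using pw.unit_group_transport[OF p q e(1) e0(1) pq e0(2) ids(1,3) that] unfolding G by blast+
  have g: "?g x \<in> carrier G0" "?f (?g x) = x" if "x \<in> carrier ?G" for x
    using pw.unit_group_transport[OF q p e0(1) e(1) pq(2,1) e(2) ids(4,2)] that unfolding G by blast+
  have top: "topspace G0_topology = carrier G0" "topspace (Schuetzenberger_topology thue_morse) = carrier ?G"
  proof -
    have "topspace (pseudoword_topology :: letter pseudoword topology) = PW"
      unfolding pseudoword_topology_def pseudowords_def by (rule topspace_lim_topology[OF order_refl])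
    then show "topspace G0_topology = carrier G0" "topspace (Schuetzenberger_topology thue_morse) = carrier ?G"
      unfolding G0_topology_def Schuetzenberger_topology_def G by (auto simp: unit_group_def)
  qed
  have "homeomorphic_maps G0_topology (Schuetzenberger_topology thue_morse) ?f ?g"
    unfolding homeomorphic_maps_def top
  proof (intro conjI ballI)
    show "continuous_map G0_topology (Schuetzenberger_topology thue_morse) ?f"
      unfolding Schuetzenberger_topology_def
      by (rule continuous_map_into_subtopology)
        (use f pw_two_sided_mult_continuous[OF p q] top in
          \<open>auto simp: G0_topology_def intro: continuous_map_from_subtopology\<close>)
    show "continuous_map (Schuetzenberger_topology thue_morse) G0_topology ?g"
      unfolding G0_topology_def
      by (rule continuous_map_into_subtopology)
        (use g pw_two_sided_mult_continuous[OF q p] top in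
          \<open>auto simp: Schuetzenberger_topology_def intro: continuous_map_from_subtopology\<close>)
  qed (use f g in blast)+
  then have "homeomorphic_map G0_topology (Schuetzenberger_topology thue_morse) ?f"
    using homeomorphic_map_maps by blast
  then show ?thesis unfolding topological_group_isomorphic_def using iso by blast
qed

section \<open>Finite members of the pseudovariety and the contradiction with freeness\<close>

section \<open>Free pro-V groups\<close>

lemma group_pseudovarietyD:
  assumes "group_pseudovariety V" "H \<in> V"
  shows "group H" "finite (carrier H)" "subgroup K H \<Longrightarrow> H\<lparr>carrier := K\<rparr> \<in> V"
proof -
  note V = assms(1)[unfolded group_pseudovariety_def]
  show "group H" "finite (carrier H)" using bspec[OF conjunct1[OF V] assms(2)] by (rule conjunct1, rule conjunct2)
  show "subgroup K H \<Longrightarrow> H\<lparr>carrier := K\<rparr> \<in> V"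
    using bspec[OF conjunct1[OF conjunct2[OF V]] assms(2)] by (elim allE[of _ K] mp)
qed

lemma group_congruences_subset: "group_congruences V X \<subseteq> finite_congruences (lists X)"
  by (auto simp: group_congruences_def)

lemma free_pro_group_simps:
  "carrier (free_pro_group V X) = lim_carrier (lists X) (group_congruences V X)"
  "x \<otimes>\<^bsub>free_pro_group V X\<^esub> y = lim_mult (group_congruences V X) x y"
  by (simp_all add: free_pro_group_def)

text \<open>With at most one generator, any two words are powers of a common letter.\<close>

lemma free_pro_group_commutative:
  assumes X: "\<And>a b. a \<in> X \<Longrightarrow> b \<in> X \<Longrightarrow> a = b"
    and x: "x \<in> carrier (free_pro_group V X)" and y: "y \<in> carrier (free_pro_group V X)"
  shows "x \<otimes>\<^bsub>free_pro_group V X\<^esub> y = y \<otimes>\<^bsub>free_pro_group V X\<^esub> x"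
proof -
  let ?I = "group_congruences V X"
  note I = group_congruences_subset[of V X]
  note xy = x[unfolded free_pro_group_simps] y[unfolded free_pro_group_simps]
  have comm: "u @ v = v @ u" if uv: "u \<in> lists X" "v \<in> lists X" for u v
  proof (cases u)
    case (Cons a u')
    then have "a \<in> X" using uv by simp
    then have "\<forall>b\<in>set u. b = a" "\<forall>b\<in>set v. b = a" using uv X by (auto simp: in_lists_conv_set)
    then have "replicate (length u) a = u" "replicate (length v) a = v"
      using replicate_length_same by metis+
    then show ?thesis by (metis add.commute replicate_add)
  qed simp
  show ?thesis
    unfolding free_pro_group_simps lim_mult_def
  proof (rule restrict_ext)
    fix \<theta> assume \<theta>: "\<theta> \<in> ?I"
    obtain u where u: "u \<in> lists X" "u \<in> x \<theta>" using lim_obtain[OF I xy(1) \<theta>] by metis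
    obtain v where v: "v \<in> lists X" "v \<in> y \<theta>" using lim_obtain[OF I xy(2) \<theta>] by metis
    show "class_mult \<theta> (x \<theta>) (y \<theta>) = class_mult \<theta> (y \<theta>) (x \<theta>)"
      using lim_mult_class[OF I \<theta> xy u(2) v(2)] lim_mult_class[OF I \<theta> xy(2,1) v(2) u(2)]
        comm[OF u(1) v(1)] \<theta> by (simp add: lim_mult_apply)
  qed
qed

lemma coordinate_hom:
  assumes g: "g \<in> hom G (free_pro_group V X)" and \<theta>: "\<theta> \<in> group_congruences V X"
  shows "(\<lambda>z. g z \<theta>) \<in> hom G (quotient_monoid (lists X) \<theta>)"
proof (rule homI)
  show "g z \<theta> \<in> carrier (quotient_monoid (lists X) \<theta>)" if "z \<in> carrier G" for z
    using hom_in_carrier[OF g that] lim_carrierD(1)[OF group_congruences_subset _ \<theta>]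
    by (simp add: free_pro_group_simps quotient_monoid_def)
  show "g (x \<otimes>\<^bsub>G\<^esub> y) \<theta> = g x \<theta> \<otimes>\<^bsub>quotient_monoid (lists X) \<theta>\<^esub> g y \<theta>"
    if "x \<in> carrier G" "y \<in> carrier G" for x y
    using hom_mult[OF g that] lim_mult_apply[OF \<theta>]
    by (simp add: free_pro_group_simps quotient_monoid_def)
qed

text \<open>
  If all groups of \<open>V\<close> had odd order, then an odd power of every element of a pro-\<open>V\<close> group would lie
  in a given neighbourhood of the identity.
\<close>

lemma even_order_member:
  assumes V: "group_pseudovariety V"
    and g: "g \<in> iso G0 (free_pro_group V X)"
    and homeo: "homeomorphic_map G0_topology (free_pro_group_topology V X) g"
  shows "\<exists>H\<in>V. even (order H)"
proof (rule ccontr)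
  assume "\<not> ?thesis"
  then have odd: "\<And>H. H \<in> V \<Longrightarrow> odd (order H)" by blast
  interpret G0: group G0 by (rule group_G0)
  let ?I = "group_congruences V X" and ?F = "free_pro_group V X"
  note I = group_congruences_subset[of V X]
  have gh: "g \<in> hom G0 ?F" and bij: "bij_betw g (carrier G0) (carrier ?F)" using g by (auto simp: iso_def)
  define U where "U = {x \<in> PW. x act_cong = e0 act_cong} \<inter> carrier G0"
  have "openin pseudoword_topology {x \<in> PW. x act_cong = e0 act_cong}"
    unfolding pseudoword_topology_def pseudowords_def
    by (rule openin_lim_coordinate[OF order_refl act_cong_in])
  then have "openin G0_topology U"
    unfolding G0_topology_def U_def openin_subtopology by blast
  then have "openin (free_pro_group_topology V X) (g ` U)"
    using homeomorphic_map_openness_eq[OF homeo] by blast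
  moreover have "e0 \<in> U" unfolding U_def using e0(1) G0.one_closed by simp
  then have "g e0 \<in> g ` U" by (rule imageI)
  ultimately obtain K where K: "finite K" "K \<subseteq> ?I"
    "\<And>y. y \<in> carrier ?F \<Longrightarrow> (\<And>\<theta>. \<theta> \<in> K \<Longrightarrow> y \<theta> = g e0 \<theta>) \<Longrightarrow> y \<in> g ` U"
    using lim_nhd[OF I] unfolding free_pro_group_topology_def free_pro_group_simps by metis
  have "\<forall>\<theta>\<in>K. \<exists>H. H \<in> V \<and> quotient_monoid (lists X) \<theta> \<cong> H"
    using K(2) unfolding group_congruences_def by blast
  then obtain H where H: "\<And>\<theta>. \<theta> \<in> K \<Longrightarrow> H \<theta> \<in> V" "\<And>\<theta>. \<theta> \<in> K \<Longrightarrow> quotient_monoid (lists X) \<theta> \<cong> H \<theta>"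
    using bchoice[of K] by metis
  define N where "N = (\<Prod>\<theta>\<in>K. order (H \<theta>))"
  have "odd N" unfolding N_def using K(1) H(1) odd by (simp add: even_prod_iff)
  let ?x = "\<alpha> [^]\<^bsub>G0\<^esub> N"
  have x: "?x \<in> carrier G0" using \<alpha>_in_G0 by simp
  have "g ?x \<theta> = g e0 \<theta>" if \<theta>: "\<theta> \<in> K" for \<theta>
  proof -
    let ?Q = "quotient_monoid (lists X) \<theta>"
    obtain \<psi> where \<psi>: "\<psi> \<in> iso ?Q (H \<theta>)" using H(2)[OF \<theta>] by (auto simp: is_iso_def)
    interpret H: group "H \<theta>" using group_pseudovarietyD(1)[OF V H(1)[OF \<theta>]] .
    have gQ: "(\<lambda>z. g z \<theta>) \<in> hom G0 ?Q" using coordinate_hom[OF gh] \<theta> K(2) by blast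
    then have "\<psi> \<circ> (\<lambda>z. g z \<theta>) \<in> hom G0 (H \<theta>)"
      using \<psi> by (auto simp: iso_def intro: hom_compose)
    then interpret h: group_hom G0 "H \<theta>" "\<psi> \<circ> (\<lambda>z. g z \<theta>)" by unfold_locales
    obtain M where M: "N = order (H \<theta>) * M" using K(1) \<theta> unfolding N_def by (meson dvdE dvd_prodI)
    have a: "\<psi> (g \<alpha> \<theta>) \<in> carrier (H \<theta>)" using h.hom_closed[OF \<alpha>_in_G0] by simp
    have "\<psi> (g ?x \<theta>) = \<psi> (g \<alpha> \<theta>) [^]\<^bsub>H \<theta>\<^esub> N" using h.hom_nat_pow[OF \<alpha>_in_G0, of N] by simp
    also have "\<dots> = \<one>\<^bsub>H \<theta>\<^esub>"
      unfolding M using H.nat_pow_pow[OF a, symmetric] H.pow_order_eq_1[OF a] by simp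
    also have "\<dots> = \<psi> (g e0 \<theta>)" using h.hom_one by simp
    finally show ?thesis
      using \<psi> hom_in_carrier[OF gQ x] hom_in_carrier[OF gQ G0.one_closed]
      by (auto simp: iso_def bij_betw_def dest: inj_onD)
  qed
  then have "g ?x \<in> g ` U" using K(3) hom_in_carrier[OF gh x] by blast
  moreover have "U \<subseteq> carrier G0" unfolding U_def by blast
  ultimately have "?x \<in> U" using bij x by (metis bij_betw_def inj_on_image_mem_iff)
  then have "?x act_cong = e0 act_cong" unfolding U_def by blast
  then show False using \<alpha>_pow_odd[OF \<open>odd N\<close>] by blast
qed

lemma order_two_member:
  assumes V: "group_pseudovariety V" and H: "H \<in> V" "even (order H)"
  obtains C k where "C \<in> V" "group C" "carrier C = {\<one>\<^bsub>C\<^esub>, k}" "k \<noteq> \<one>\<^bsub>C\<^esub>" "k \<otimes>\<^bsub>C\<^esub> k = \<one>\<^bsub>C\<^esub>"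
proof -
  interpret H: group H using group_pseudovarietyD(1)[OF V H(1)] .
  have fin: "finite (carrier H)" using group_pseudovarietyD(2)[OF V H(1)] .
  \<comment> \<open>The exponent 1 makes Sylow's theorem yield a subgroup of order exactly
    2.\<close>
  obtain m where "order H = 2 ^ 1 * m" using H(2) by (auto elim: evenE)
  then obtain K where K: "subgroup K H" "card K = 2"
    using sylow_thm[OF two_is_prime_nat H.is_group _ fin] by fastforce
  let ?C = "H\<lparr>carrier := K\<rparr>"
  have C: "?C \<in> V" using group_pseudovarietyD(3)[OF V H(1) K(1)] .
  interpret C: group ?C using H.subgroup_imp_group[OF K(1)] .
  have "\<one>\<^bsub>H\<^esub> \<in> K" using K(1) by (rule subgroup.one_closed)
  then obtain k where k: "K = {\<one>\<^bsub>H\<^esub>, k}" "k \<noteq> \<one>\<^bsub>H\<^esub>" using K(2) by (metis card_2_iff doubleton_eq_iff insertE singletonD)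
  have "k \<otimes>\<^bsub>H\<^esub> k \<in> K" using K(1) k(1) by (intro subgroup.m_closed) auto
  moreover have "k \<in> carrier H" using subgroup.subset[OF K(1)] k(1) by blast
  then have "k \<otimes>\<^bsub>H\<^esub> k \<noteq> k" using k(2) H.l_cancel_one by blast
  ultimately have "k \<otimes>\<^bsub>H\<^esub> k = \<one>\<^bsub>H\<^esub>" using k(1) by blast
  then show thesis using that[of ?C k] C C.is_group k by simp
qed

subsection \<open>Parity of the number of occurrences of a generator\<close>

definition parity_congruence :: "'a set \<Rightarrow> 'a \<Rightarrow> ('a list \<times> 'a list) set" where
  "parity_congruence X a =
     {(u, v). u \<in> lists X \<and> v \<in> lists X \<and> odd (count_list u a) = odd (count_list v a)}"

lemma parity_congruence_in: "parity_congruence X a \<in> finite_congruences (lists X)"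
  unfolding parity_congruence_def by (rule kernel_finite_congruence) auto

lemma parity_class_eq_iff:
  assumes "u \<in> lists X" "v \<in> lists X"
  shows "parity_congruence X a `` {u} = parity_congruence X a `` {v} \<longleftrightarrow>
    odd (count_list u a) = odd (count_list v a)"
  using class_eq_iff[OF parity_congruence_in assms] assms by (simp add: parity_congruence_def)

text \<open>Membership in \<open>group_congruences V X\<close> makes the parity of a generator a
  coordinate of the free pro-V group, hence a continuous homomorphism.\<close>

lemma parity_congruence_group:
  assumes a: "a \<in> X" and C: "C \<in> V" "group C" "carrier C = {\<one>\<^bsub>C\<^esub>, k}" "k \<noteq> \<one>\<^bsub>C\<^esub>" "k \<otimes>\<^bsub>C\<^esub> k = \<one>\<^bsub>C\<^esub>"
  shows "parity_congruence X a \<in> group_congruences V X"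
proof -
  interpret C: group C by (rule C(2))
  let ?\<theta> = "parity_congruence X a"
  let ?Q = "quotient_monoid (lists X) ?\<theta>"
  define f where "f D = (if D = ?\<theta> `` {[a]} then k else \<one>\<^bsub>C\<^esub>)" for D
  have f: "f (?\<theta> `` {u}) = (if odd (count_list u a) then k else \<one>\<^bsub>C\<^esub>)" if "u \<in> lists X" for u
    using parity_class_eq_iff[OF that, of "[a]" a] a by (simp add: f_def)
  have k: "k \<in> carrier C" using C(3) by simp
  have "f \<in> hom ?Q C"
  proof (rule homI)
    show "f D \<in> carrier C" for D using C(3) by (simp add: f_def)
    fix D D' assume D: "D \<in> carrier ?Q" "D' \<in> carrier ?Q"
    obtain u where u: "u \<in> lists X" "D = ?\<theta> `` {u}"
      using D(1)[unfolded quotient_monoid_def, simplified] by (rule quotientE)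
    obtain v where v: "v \<in> lists X" "D' = ?\<theta> `` {v}"
      using D(2)[unfolded quotient_monoid_def, simplified] by (rule quotientE)
    have "D \<otimes>\<^bsub>?Q\<^esub> D' = ?\<theta> `` {u @ v}"
      using u v by (simp add: quotient_monoid_def class_mult_class[OF parity_congruence_in])
    then show "f (D \<otimes>\<^bsub>?Q\<^esub> D') = f D \<otimes>\<^bsub>C\<^esub> f D'"
      using f[of "u @ v"] f[OF u(1)] f[OF v(1)] u v C(5) k by auto
  qed
  moreover have "bij_betw f (carrier ?Q) (carrier C)"
    unfolding bij_betw_def
  proof
    show "inj_on f (carrier ?Q)"
    proof (rule inj_onI)
      fix D D' assume D: "D \<in> carrier ?Q" "D' \<in> carrier ?Q" and eq: "f D = f D'"
      obtain u where u: "u \<in> lists X" "D = ?\<theta> `` {u}"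
        using D(1)[unfolded quotient_monoid_def, simplified] by (rule quotientE)
      obtain v where v: "v \<in> lists X" "D' = ?\<theta> `` {v}"
        using D(2)[unfolded quotient_monoid_def, simplified] by (rule quotientE)
      have "odd (count_list u a) = odd (count_list v a)"
        using eq f[OF u(1)] f[OF v(1)] u(2) v(2) C(4) by (auto split: if_splits)
      then show "D = D'" using parity_class_eq_iff[OF u(1) v(1)] u(2) v(2) by simp
    qed
    have m: "?\<theta> `` {[a]} \<in> carrier ?Q" "?\<theta> `` {[]} \<in> carrier ?Q"
      using a by (simp_all add: quotient_monoid_def quotientI)
    have "f (?\<theta> `` {[a]}) = k" "f (?\<theta> `` {[]}) = \<one>\<^bsub>C\<^esub>" using f[of "[a]"] f[of "[]"] a by simp_all
    then have "{\<one>\<^bsub>C\<^esub>, k} \<subseteq> f ` carrier ?Q" using m by (metis empty_subsetI imageI insert_subset)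
    then show "f ` carrier ?Q = carrier C" using C(3) by (auto simp: f_def)
  qed
  ultimately have "?Q \<cong> C" by (auto simp: is_iso_def iso_def)
  then show ?thesis
    unfolding group_congruences_def
    by (intro CollectI conjI parity_congruence_in bexI[OF _ C(1)])
qed

lemma parity_hom:
  assumes g: "g \<in> iso G0 (free_pro_group V X)"
    and homeo: "homeomorphic_map G0_topology (free_pro_group_topology V X) g"
    and a: "a \<in> X" and I: "parity_congruence X a \<in> group_congruences V X"
  defines "h \<equiv> \<lambda>z. g z (parity_congruence X a) = parity_congruence X a `` {[a]}"
  shows "\<And>x y. x \<in> carrier G0 \<Longrightarrow> y \<in> carrier G0 \<Longrightarrow> h (x \<odot> y) \<longleftrightarrow> h x \<noteq> h y"
    and "\<exists>\<theta>\<in>FC. \<forall>x\<in>carrier G0. \<forall>y\<in>carrier G0. x \<theta> = y \<theta> \<longrightarrow> h x = h y"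
proof -
  interpret G0: group G0 by (rule group_G0)
  let ?\<theta> = "parity_congruence X a" and ?F = "free_pro_group V X"
  let ?Q = "quotient_monoid (lists X) ?\<theta>"
  have gh: "g \<in> hom G0 ?F" using g by (simp add: iso_def)
  note gQ = coordinate_hom[OF gh I]
  show hom: "h (x \<odot> y) \<longleftrightarrow> h x \<noteq> h y" if x: "x \<in> carrier G0" and y: "y \<in> carrier G0" for x y
  proof -
    have m: "g x ?\<theta> \<in> lists X // ?\<theta>" "g y ?\<theta> \<in> lists X // ?\<theta>"
      using hom_in_carrier[OF gQ] x y by (simp_all add: quotient_monoid_def)
    obtain u where u: "u \<in> lists X" "g x ?\<theta> = ?\<theta> `` {u}" using m(1) by (rule quotientE)
    obtain v where v: "v \<in> lists X" "g y ?\<theta> = ?\<theta> `` {v}" using m(2) by (rule quotientE)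
    have "g (x \<odot> y) ?\<theta> = ?\<theta> `` {u @ v}"
      using hom_mult[OF gQ x y] u v
      by (simp add: quotient_monoid_def class_mult_class[OF parity_congruence_in])
    then show ?thesis
      using u v a parity_class_eq_iff[of "u @ v" X "[a]" a] parity_class_eq_iff[of u X "[a]" a]
        parity_class_eq_iff[of v X "[a]" a] by (auto simp: h_def)
  qed
  let ?O = "{y \<in> carrier ?F. y ?\<theta> \<noteq> ?\<theta> `` {[a]}}"
  have "openin (free_pro_group_topology V X) ?O"
    unfolding free_pro_group_topology_def free_pro_group_simps
    by (rule openin_lim_coordinate[OF group_congruences_subset I])
  then have "openin G0_topology {x \<in> topspace G0_topology. g x \<in> ?O}"
    using homeomorphic_imp_continuous_map[OF homeo] by (rule openin_continuous_map_preimage[rotated])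
  then obtain W where W: "openin pseudoword_topology W"
    "{x \<in> topspace G0_topology. g x \<in> ?O} = W \<inter> carrier G0"
    unfolding G0_topology_def[symmetric] unfolding G0_topology_def openin_subtopology by blast
  have top: "topspace G0_topology = carrier G0"
  proof -
    have "topspace (pseudoword_topology :: letter pseudoword topology) = PW"
      unfolding pseudoword_topology_def pseudowords_def by (rule topspace_lim_topology[OF order_refl])
    then show ?thesis unfolding G0_topology_def by (auto simp: unit_group_def)
  qed
  have W': "x \<in> W \<longleftrightarrow> \<not> h x" if "x \<in> carrier G0" for x
  proof -
    have "g x \<in> carrier ?F" using hom_in_carrier[OF gh that] .
    then show ?thesis using W(2) that unfolding top h_def by blast
  qed
  have h1: "\<not> h e0" using hom[OF G0.one_closed G0.one_closed] e0(2) by simp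
  then have "e0 \<in> W" using W' G0.one_closed by simp
  then obtain \<rho> where \<rho>: "\<rho> \<in> FC" "\<And>y. y \<in> PW \<Longrightarrow> y \<rho> = e0 \<rho> \<Longrightarrow> y \<in> W"
    using nonempty.lim_nhd_single[OF W(1)[unfolded pseudoword_topology_def]] unfolding pseudowords_def by metis
  \<comment> \<open>Openness of the kernel controls \<open>h\<close> near \<open>e0\<close> only;
    multiplying by the inverse of \<open>y\<close> carries this over to all pairs.\<close>
  have "h x = h y" if x: "x \<in> carrier G0" and y: "y \<in> carrier G0" and eq: "x \<rho> = y \<rho>" for x y
  proof -
    let ?z = "inv\<^bsub>G0\<^esub> y"
    have z: "?z \<in> carrier G0" using y by simp
    have xz: "x \<odot> ?z \<in> carrier G0" using G0.m_closed[OF x z] by simp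
    have yz: "y \<odot> ?z = e0" using G0.r_inv[OF y] by simp
    have "(x \<odot> ?z) \<rho> = (y \<odot> ?z) \<rho>" unfolding pw_mult_app[OF \<rho>(1)] eq ..
    then have "x \<odot> ?z \<in> W" using \<rho>(2) G0D[OF xz] yz by simp
    then have "\<not> h (x \<odot> ?z)" using W'[OF xz] by simp
    then have "h x = h ?z" using hom[OF x z] by simp
    moreover have "h y = h ?z" using hom[OF y z] yz h1 by simp
    ultimately show ?thesis by simp
  qed
  then show "\<exists>\<theta>\<in>FC. \<forall>x\<in>carrier G0. \<forall>y\<in>carrier G0. x \<theta> = y \<theta> \<longrightarrow> h x = h y"
    using \<rho>(1) by blast
qed

lemma G0_not_free:
  assumes V: "group_pseudovariety V"
    and g: "g \<in> iso G0 (free_pro_group V X)"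
    and homeo: "homeomorphic_map G0_topology (free_pro_group_topology V X) g"
  shows False
proof -
  let ?I = "group_congruences V X" and ?F = "free_pro_group V X"
  have gh: "g \<in> hom G0 ?F" and bij: "bij_betw g (carrier G0) (carrier ?F)" using g by (auto simp: iso_def)
  have "\<exists>a\<in>X. \<exists>b\<in>X. a \<noteq> b"
  proof (rule ccontr)
    assume "\<not> ?thesis"
    then have X: "\<And>a b. a \<in> X \<Longrightarrow> b \<in> X \<Longrightarrow> a = b" by blast
    obtain x y where xy: "x \<in> carrier G0" "y \<in> carrier G0" "x \<odot> y \<noteq> y \<odot> x" using G0_not_commutative by blast
    have "g (x \<odot> y) = g (y \<odot> x)"
      using hom_mult[OF gh xy(1,2)] hom_mult[OF gh xy(2,1)]
        free_pro_group_commutative[OF X hom_in_carrier[OF gh xy(1)] hom_in_carrier[OF gh xy(2)]] by simp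
    moreover have "x \<odot> y \<in> carrier G0" "y \<odot> x \<in> carrier G0"
      using monoid.m_closed[OF group.is_monoid[OF group_G0]] xy(1,2) by (metis G0_mult)+
    ultimately show False using bij xy(3) by (auto simp: bij_betw_def dest: inj_onD)
  qed
  then obtain a b where ab: "a \<in> X" "b \<in> X" "a \<noteq> b" by blast
  obtain H where "H \<in> V" "even (order H)" using even_order_member[OF V g homeo] by blast
  then obtain C k where "C \<in> V" "group C" "carrier C = {\<one>\<^bsub>C\<^esub>, k}" "k \<noteq> \<one>\<^bsub>C\<^esub>" "k \<otimes>\<^bsub>C\<^esub> k = \<one>\<^bsub>C\<^esub>"
    using order_two_member[OF V] by metis
  note C = parity_congruence_group[OF _ this]
  note Ia = C[OF ab(1)] and Ib = C[OF ab(2)]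
  define ha where "ha z = (g z (parity_congruence X a) = parity_congruence X a `` {[a]})" for z
  define hb where "hb z = (g z (parity_congruence X b) = parity_congruence X b `` {[b]})" for z
  note hom_a = parity_hom(1)[OF g homeo ab(1) Ia, folded ha_def]
    and hom_b = parity_hom(1)[OF g homeo ab(2) Ib, folded hb_def]
  obtain \<theta> where \<theta>: "\<theta> \<in> FC" "\<And>x y. x \<in> carrier G0 \<Longrightarrow> y \<in> carrier G0 \<Longrightarrow> x \<theta> = y \<theta> \<Longrightarrow> ha x = ha y"
    using parity_hom(2)[OF g homeo ab(1) Ia, folded ha_def] by blast
  obtain \<rho> where \<rho>: "\<rho> \<in> FC" "\<And>x y. x \<in> carrier G0 \<Longrightarrow> y \<in> carrier G0 \<Longrightarrow> x \<rho> = y \<rho> \<Longrightarrow> hb x = hb y"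
    using parity_hom(2)[OF g homeo ab(2) Ib, folded hb_def] by blast
  have gen: "\<exists>z\<in>carrier G0. g z = lim_word ?I [c]" if "c \<in> X" for c
  proof -
    have "lim_word ?I [c] \<in> carrier ?F"
      unfolding free_pro_group_simps by (rule lim_word_closed[OF group_congruences_subset]) (use that in simp)
    then have "lim_word ?I [c] \<in> g ` carrier G0" using bij_betw_imp_surj_on[OF bij] by (simp only:)
    then show ?thesis by (elim imageE) (intro bexI, simp_all)
  qed
  obtain x where x: "x \<in> carrier G0" "g x = lim_word ?I [a]" using gen[OF ab(1)] by blast
  obtain y where y: "y \<in> carrier G0" "g y = lim_word ?I [b]" using gen[OF ab(2)] by blast
  have hax: "ha x" and hby: "hb y" using x(2) y(2) Ia Ib by (simp_all add: ha_def hb_def lim_word_def)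
  have hbx: "\<not> hb x"
    using x(2) Ib ab parity_class_eq_iff[of "[a]" X "[b]" b] by (simp add: hb_def lim_word_def)
  \<comment> \<open>\<open>ha\<close> and \<open>hb\<close> are nontrivial at the preimages of their
    generators, so neither vanishes at \<open>\<alpha>\<close>.\<close>
  have a\<alpha>: "ha \<alpha>" using hom_to_order_two_trivial[of ha, OF hom_a \<theta> _ x(1)] hax by blast
  have b\<alpha>: "hb \<alpha>" using hom_to_order_two_trivial[of hb, OF hom_b \<rho> _ y(1)] hby by blast
  \<comment> \<open>The sum of the two homomorphisms vanishes at \<open>\<alpha>\<close>, yet it is
    nontrivial at the preimage \<open>x\<close> of the generator \<open>a\<close>.\<close>
  let ?h = "\<lambda>z. ha z \<noteq> hb z"
  have "\<not> ?h x"
  proof (rule hom_to_order_two_trivial[of ?h])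
    show "?h (u \<odot> v) \<longleftrightarrow> ?h u \<noteq> ?h v" if "u \<in> carrier G0" "v \<in> carrier G0" for u v
      using hom_a[OF that] hom_b[OF that] by blast
    show \<theta>\<rho>: "\<theta> \<inter> \<rho> \<in> FC" by (rule nonempty.Int_finite_congruences[OF \<theta>(1) \<rho>(1)])
    show "?h u = ?h v" if u: "u \<in> carrier G0" and v: "v \<in> carrier G0" and eq: "u (\<theta> \<inter> \<rho>) = v (\<theta> \<inter> \<rho>)" for u v
    proof -
      have uv: "u \<in> PW" "v \<in> PW" using G0D[OF u] G0D[OF v] by simp_all
      have "u \<theta> = v \<theta>" by (rule pw_eq_mono[where \<theta>="\<theta> \<inter> \<rho>", OF uv \<theta>\<rho> \<theta>(1) Int_lower1 eq])
      moreover have "u \<rho> = v \<rho>" by (rule pw_eq_mono[where \<theta>="\<theta> \<inter> \<rho>", OF uv \<theta>\<rho> \<rho>(1) Int_lower2 eq])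
      ultimately show ?thesis using \<theta>(2)[OF u v] \<rho>(2)[OF u v] by simp
    qed
  qed (use a\<alpha> b\<alpha> x(1) in simp_all)
  then show False using hax hbx by simp
qed

theorem theorem7p6:
  shows "\<not> relatively_free (Schuetzenberger_group thue_morse) (Schuetzenberger_topology thue_morse)"
proof
  assume "relatively_free (Schuetzenberger_group thue_morse) (Schuetzenberger_topology thue_morse)"
  then obtain V and X :: "nat set" and h
    where V: "group_pseudovariety V"
      and h: "h \<in> iso (Schuetzenberger_group thue_morse) (free_pro_group V X)"
        "homeomorphic_map (Schuetzenberger_topology thue_morse) (free_pro_group_topology V X) h"
    unfolding relatively_free_def topological_group_isomorphic_def by blast
  obtain j where j: "j \<in> iso G0 (Schuetzenberger_group thue_morse)"
      "homeomorphic_map G0_topology (Schuetzenberger_topology thue_morse) j"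
    using Schuetzenberger_group_isomorphic unfolding topological_group_isomorphic_def by blast
  show False
    using G0_not_free[OF V iso_set_trans[OF j(1) h(1)] homeomorphic_map_compose[OF j(2) h(2)]] .
qed

end
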